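(* Let $q$ be a prime, let $n$ range over the even positive integers, let $(k_n)$ be a sequence of positive integers, and let $C^{(n)}_{2k-1}$ be the random block bidiagonal matrices described in the context. (1) Assume that $k_n=k$ is constant. Then for all integers $j\ge 0$, $$\mathbb{P}\left(\dim\ker C^{(n)}_{2k_n-1}=j\right)=\sum_{\substack{r_1,r_2,\dots,r_k\ge 0\\ r_1+r_2+\cdots+r_k=j}}(q^{-1};q^{-1})_\infty^k\prod_{i=1}^k\frac{q^{-r_i(r_1+\cdots+r_i)}}{(q^{-1};q^{-1})_{r_i}}.$$ (2) Assume that $k_n\to\infty$ and $\lim_{n\to\infty}\frac{q^{-n/2}}{q-1}k_n=0$. Let $n_1<n_2<\cdots$ be a subsequence of the even positive integers such that the fractional part $\{-\log_q(k_{n_i})\}$ converges to $\zeta$. Let $\chi=q^{-\zeta}/(q-1)$. Then for all $j\in\mathbb{Z}$, $$\lim_{i\to\infty}\mathbb{P}\left(\dim\ker C^{(n_i)}_{2k_{n_i}-1}-\lfloor\log_q(k_{n_i})+\zeta\rceil=j\right)=\mathbb{P}(\mathcal{L}_{1,q^{-1},\chi}=j).$$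
   Context: Let $A=(A_{i,j})_{i,j=1}^\infty$ be a random infinite block matrix over the finite field $\mathbb{F}_q$ whose blocks are $n\times n$ matrices, such that $A_{i,j}=0$ whenever $j\notin\{i,i-1\}$, while the blocks $A_{i,i}$ ($i\ge1$) and $A_{i,i-1}$ ($i\ge 2$) are independent and uniformly distributed over all $n\times n$ matrices over $\mathbb{F}_q$. For $k\ge 1$, $C_{2k-1}=C_{2k-1}^{(n)}$ is the submatrix of $A$ formed by the first $kn$ rows and first $kn$ columns. Notation: $(a;x)_r=\prod_{i=0}^{r-1}(1-ax^i)$ for $0\le r\le\infty$, and $\lfloor x\rceil$ is the integer closest to $x$. For $s\in(0,1)$ and $\chi>0$, $\mathcal{L}_{1,s,\chi}$ is the $\mathbb{Z}$-valued random variable (introduced by Van Peski) with law $$\mathbb{P}(\mathcal{L}_{1,s,\chi}=x)=\frac{1}{(s;s)_\infty}\sum_{m=0}^\infty e^{-\chi s^{x-m}}\frac{(-1)^m s^{m(m-1)/2}}{(s;s)_m},\qquad x\in\mathbb{Z}.$$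
   Formalization: In (1) the equality is replaced by the limit as n→∞ through even n, and each factor of the product gets the additional denominator (q^{-1};q^{-1})_{r_1+...+r_i}; as printed, (1) fails already for k=1. *)

theory Defs
  imports
    "HOL-Probability.Probability"
    "HOL-Computational_Algebra.Primes"
    "Jordan_Normal_Form.Matrix_Kernel"
begin

text \<open>
  A random infinite block matrix is given by its blocks \<open>A i j \<omega>\<close>, with block indices
  \<open>i, j \<ge> 1\<close>; values of \<open>A\<close> at block index \<open>0\<close> are junk and never used.
\<close>

definition band_positions :: "(nat \<times> nat) set" where
  "band_positions = {(i, j). 1 \<le> i \<and> 1 \<le> j \<and> (j = i \<or> j + 1 = i)}"

definition uniform_block_bidiagonal ::
    "nat \<Rightarrow> 'w measure \<Rightarrow> (nat \<Rightarrow> nat \<Rightarrow> 'w \<Rightarrow> 'a::{field,finite} mat) \<Rightarrow> bool" where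
  "uniform_block_bidiagonal n M A \<longleftrightarrow>
     prob_space M \<and>
     (\<forall>i\<ge>1. \<forall>j\<ge>1. (i, j) \<notin> band_positions \<longrightarrow> (\<forall>\<omega>\<in>space M. A i j \<omega> = 0\<^sub>m n n)) \<and>
     (\<forall>(i, j)\<in>band_positions.
        distr M (count_space (carrier_mat n n)) (A i j) = uniform_count_measure (carrier_mat n n)) \<and>
     prob_space.indep_vars M (\<lambda>_. count_space (carrier_mat n n)) (\<lambda>(i, j). A i j) band_positions"

text \<open>
  The top left \<open>k * n\<close> by \<open>k * n\<close> corner. Rows and columns of a matrix are numbered from \<open>0\<close>,
  blocks from \<open>1\<close>.
\<close>

definition corner_matrix ::
    "nat \<Rightarrow> nat \<Rightarrow> (nat \<Rightarrow> nat \<Rightarrow> 'w \<Rightarrow> 'a mat) \<Rightarrow> 'w \<Rightarrow> 'a mat" where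
  "corner_matrix n k A \<omega> =
     mat (k * n) (k * n)
       (\<lambda>(a, b). A (a div n + 1) (b div n + 1) \<omega> $$ (a mod n, b mod n))"

definition qpoch :: "real \<Rightarrow> real \<Rightarrow> nat \<Rightarrow> real" where
  "qpoch a x r = (\<Prod>i<r. 1 - a * x ^ i)"

definition qpoch_inf :: "real \<Rightarrow> real \<Rightarrow> real" where
  "qpoch_inf a x = (\<Prod>i. 1 - a * x ^ i)"

text \<open>
  The probability mass function of Van Peski's integer valued random variable
  \<open>L(1,s,chi)\<close>, for \<open>0 < s < 1\<close> and \<open>chi > 0\<close>.
\<close>

definition van_peski_mass :: "real \<Rightarrow> real \<Rightarrow> int \<Rightarrow> real" where
  "van_peski_mass s chi x =
     1 / qpoch_inf s s *
     (\<Sum>m. exp (- chi * s powi (x - int m)) * ((-1) ^ m * s ^ (m * (m - 1) div 2) / qpoch s s m))"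

text \<open>Limits along this filter are limits as \<open>n \<rightarrow> \<infinity>\<close> through even \<open>n\<close>.\<close>

definition even_sequentially :: "nat filter" where
  "even_sequentially = inf sequentially (principal {n. even n})"

end

theory Submission
  imports Defs "HOL-Real_Asymp.Real_Asymp"
begin

text \<open>
  Write \<open>s = 1/q\<close>, \<open>D\<^sub>i\<close> for the \<open>i\<close>-th diagonal block and \<open>B\<^sub>i\<close> for the block to its left. A vector with blocks
  \<open>x\<^sub>1, x\<^sub>2, \<dots>\<close> lies in the kernel of the corner iff \<open>D\<^sub>i x\<^sub>i = - B\<^sub>i x\<^sub>i\<^sub>-\<^sub>1\<close> for all \<open>i\<close>, so the possible
  values of \<open>x\<^sub>i\<close> form the subspace \<open>W\<^sub>i = D\<^sub>i\<^sup>-\<^sup>1 (B\<^sub>i W\<^sub>i\<^sub>-\<^sub>1)\<close>, with \<open>W\<^sub>1 = ker D\<^sub>1\<close>. If each \<open>B\<^sub>i\<close> is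
  injective on \<open>W\<^sub>i\<^sub>-\<^sub>1\<close> (the configuration is \<^emph>\<open>generic\<close>), the last block determines the kernel vector and
  the kernel has the dimension of \<open>W\<^sub>k\<close> (\<open>card_kernel_corner_generic\<close>).

  For a subspace \<open>U\<close> of dimension \<open>a\<close> and a uniform matrix \<open>D\<close>, the law of \<open>dim D\<^sup>-\<^sup>1 U\<close> depends only on
  \<open>a\<close>; it is computed by exposing \<open>D\<close> column by column (\<open>mean_card_preimage_space\<close>). Its limit for
  \<open>n \<rightarrow> \<infinity>\<close> is the kernel \<open>T(a,b) = (s;s)\<^sub>\<infinity> s\<^bsup>(b-a)b\<^esup> / ((s;s)\<^bsub>b-a\<^esub> (s;s)\<^bsub>b\<^esub>)\<close>. Let \<open>P\<^sub>k\<close> be the law after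
  \<open>k\<close> steps of the Markov chain with kernel \<open>T\<close> started at \<open>0\<close>. This chain never decreases, so a trajectory
  that ends in \<open>j\<close> only meets states up to \<open>j\<close>, and multiplying up the errors of the single steps shows that
  for \<open>j \<le> n\<close> the probability \<open>p\<close> of kernel dimension \<open>j\<close> satisfies (\<open>kernel_dim_prob_bounds\<close>)
  \<open>P\<^sub>k(j) (1 - 2 k s\<^bsup>n-j\<^esup>) \<le> p \<le> P\<^sub>k(j) + 2 k\<^sup>2 s\<^sup>n\<close>. The term \<open>k\<^sup>2 s\<^sup>n\<close> also covers the configurations
  that are not generic, because the mean size of \<open>W\<^sub>i\<close> is at most \<open>i + 1\<close>.

  For constant \<open>k\<close> both bounds tend to \<open>P\<^sub>k(j)\<close>, which is the stated sum over the increments of the chain.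
  For growing \<open>k\<close> the point is that \<open>T\<close> is triangular and can be diagonalised explicitly by the
  \<open>q\<close>-binomial theorem: its eigenvalues are the Euler tails \<open>\<lambda>\<^sub>a = (s;s)\<^sub>\<infinity> / (s;s)\<^sub>a = (1 - s\<^bsup>a+1\<^esup>)(1 - s\<^bsup>a+2\<^esup>)\<cdots>\<close>,
  and \<open>P\<^sub>k(j)\<close> is the sum over \<open>m \<le> j\<close> of \<open>\<lambda>\<^bsub>j-m\<^esub>\<^sup>k / (s;s)\<^bsub>j-m\<^esub>\<close> times
  \<open>(-1)\<^sup>m s\<^bsup>m(m-1)/2\<^esup> / (s;s)\<^sub>m\<close> (\<open>limit_chain_diagonal\<close>). When \<open>j\<close> is \<open>log\<^sub>q k\<close> up to a bounded
  amount, \<open>\<lambda>\<^bsub>j-m\<^esub>\<^sup>k\<close> tends to an exponential, and the sum becomes term by term the series that defines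
  Van Peski's distribution (\<open>limit_chain_tendsto_van_peski\<close>). The hypothesis on \<open>k\<close> makes both error terms
  vanish, since then \<open>s\<^bsup>-j\<^esup>\<close> is of order \<open>k\<close> and \<open>k s\<^bsup>n-j\<^esup>\<close> of order \<open>k\<^sup>2 s\<^sup>n\<close>.
\<close>

section \<open>The finite and infinite Pochhammer symbols\<close>

lemma qpoch_0 [simp]: "qpoch a x 0 = 1"
  by (simp add: qpoch_def)

lemma qpoch_Suc: "qpoch s s (Suc r) = qpoch s s r * (1 - s ^ Suc r)"
  by (simp add: qpoch_def)

lemma qpoch_pos:
  fixes s :: real assumes "0 < s" "s < 1"
  shows "0 < qpoch s s r"
  unfolding qpoch_def
proof (rule prod_pos)
  fix i assume "i \<in> {..<r}"
  have "s ^ Suc i < 1" using assms by (intro power_Suc_less_one) auto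
  then show "0 < 1 - s * s ^ i" by simp
qed

lemma qpoch_nonzero:
  fixes s :: real assumes "0 < s" "s < 1"
  shows "qpoch s s r \<noteq> 0"
  using qpoch_pos[OF assms, of r] by simp

lemma qpoch_antimono:
  fixes s :: real assumes "0 < s" "s < 1" "m \<le> n"
  shows "qpoch s s n \<le> qpoch s s m"
  using assms(3)
proof (induction n rule: dec_induct)
  case (step n)
  have "qpoch s s (Suc n) \<le> qpoch s s n * 1"
    unfolding qpoch_Suc using qpoch_pos[OF assms(1,2), of n] assms(1)
    by (intro mult_left_mono) auto
  then show ?case using step by simp
qed simp

lemma qpoch_shift:
  "qpoch s s (a + m) = qpoch s s a * (\<Prod>i<m. 1 - s ^ (a + m - i))"
proof -
  have "qpoch s s (a + m) = qpoch s s a * (\<Prod>i<m. 1 - s ^ Suc (a + i))" for m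
    by (induction m) (simp_all add: qpoch_Suc)
  also have "(\<Prod>i<m. 1 - s ^ Suc (a + i)) = (\<Prod>i<m. 1 - s ^ Suc (a + (m - Suc i)))"
    by (rule prod.nat_diff_reindex[symmetric])
  also have "\<dots> = (\<Prod>i<m. 1 - s ^ (a + m - i))"
  proof (intro prod.cong refl)
    fix i assume "i \<in> {..<m}"
    then have "Suc (a + (m - Suc i)) = a + m - i" by auto
    then show "1 - s ^ Suc (a + (m - Suc i)) = 1 - s ^ (a + m - i)" by (simp only:)
  qed
  finally show ?thesis .
qed

text \<open>
  The factors after the first \<open>m\<close> cost at most the geometric series
  \<open>s\<^bsup>m+1\<^esup> + s\<^bsup>m+2\<^esup> + \<dots> = s\<^sup>m s / (1 - s)\<close>, by the Weierstrass product inequality.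
\<close>

lemma qpoch_tail_ge:
  fixes s :: real assumes "0 < s" "s < 1" "m \<le> n"
  shows "qpoch s s m * (1 - s ^ m * (s / (1 - s))) \<le> qpoch s s n"
proof -
  obtain d where n: "n = m + d" using assms(3) le_Suc_ex by blast
  have split: "qpoch s s (m + d) = qpoch s s m * (\<Prod>i<d. 1 - s ^ Suc (m + i))"
    by (induction d) (simp_all add: qpoch_Suc)
  have "1 - s ^ m * (s / (1 - s)) \<le> 1 - (\<Sum>i<d. s ^ Suc (m + i))"
  proof -
    have "(\<Sum>i<d. s ^ Suc (m + i)) = s ^ m * s * (\<Sum>i<d. s ^ i)"
      by (simp add: sum_distrib_left power_add mult_ac)
    also have "(\<Sum>i<d. s ^ i) = (1 - s ^ d) / (1 - s)"
      using assms by (simp add: sum_gp_strict)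
    also have "s ^ m * s * ((1 - s ^ d) / (1 - s)) \<le> s ^ m * s * (1 / (1 - s))"
      using assms by (intro mult_left_mono divide_right_mono) auto
    finally show ?thesis by simp
  qed
  also have "\<dots> \<le> (\<Prod>i<d. 1 - s ^ Suc (m + i))"
    using assms by (intro Weierstrass_prod_ineq) (auto intro!: mult_le_one power_le_one)
  finally show ?thesis
    unfolding n split using qpoch_pos[OF assms(1,2), of m] by (intro mult_left_mono) auto
qed

lemma qpoch_LIMSEQ:
  fixes s :: real assumes "0 < s" "s < 1"
  shows "qpoch s s \<longlonglongrightarrow> qpoch_inf s s"
proof -
  have "summable (\<lambda>i. \<bar>- (s * s ^ i)\<bar>)"
    using assms by (simp add: abs_mult power_abs summable_mult)
  moreover have "- (s * s ^ i) \<noteq> - 1" for i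
    using power_Suc_less_one[of s i] assms by auto
  ultimately have "convergent_prod (\<lambda>i. 1 + - (s * s ^ i))"
    by (rule summable_imp_convergent_prod_real)
  then have "convergent_prod (\<lambda>i. 1 - s * s ^ i)" by simp
  then have "(\<lambda>n. \<Prod>i\<le>n. 1 - s * s ^ i) \<longlonglongrightarrow> qpoch_inf s s"
    unfolding qpoch_inf_def by (rule convergent_prod_LIMSEQ)
  then have "(\<lambda>n. qpoch s s (Suc n)) \<longlonglongrightarrow> qpoch_inf s s"
    by (simp add: qpoch_def lessThan_Suc_atMost)
  then show ?thesis by (rule filterlim_sequentially_Suc[THEN iffD1])
qed

lemma qpoch_inf_le_qpoch:
  fixes s :: real assumes "0 < s" "s < 1"
  shows "qpoch_inf s s \<le> qpoch s s m"
  using qpoch_LIMSEQ[OF assms] qpoch_antimono[OF assms]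
  by (intro LIMSEQ_le_const2) auto

lemma qpoch_inf_tail_ge:
  fixes s :: real assumes "0 < s" "s < 1"
  shows "qpoch s s m * (1 - s ^ m * (s / (1 - s))) \<le> qpoch_inf s s"
  using qpoch_LIMSEQ[OF assms] qpoch_tail_ge[OF assms]
  by (intro LIMSEQ_le_const) auto

lemma qpoch_inf_pos:
  fixes s :: real assumes "0 < s" "s < 1"
  shows "0 < qpoch_inf s s"
proof -
  have "(\<lambda>m. s ^ m * (s / (1 - s))) \<longlonglongrightarrow> 0 * (s / (1 - s))"
    using assms by (intro tendsto_intros) auto
  then have "eventually (\<lambda>m. s ^ m * (s / (1 - s)) < 1) sequentially"
    by (rule order_tendstoD) simp
  then obtain m where "s ^ m * (s / (1 - s)) < 1"
    by (auto simp: eventually_sequentially)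
  then have "0 < qpoch s s m * (1 - s ^ m * (s / (1 - s)))"
    using qpoch_pos[OF assms] by simp
  then show ?thesis using qpoch_inf_tail_ge[OF assms, of m] by linarith
qed

section \<open>The finite q-binomial theorem\<close>

definition qbinom :: "real \<Rightarrow> nat \<Rightarrow> nat \<Rightarrow> real" where
  "qbinom s t b = (if b \<le> t then qpoch s s t / (qpoch s s b * qpoch s s (t - b)) else 0)"

lemma qbinom_0 [simp]: "0 < s \<Longrightarrow> s < 1 \<Longrightarrow> qbinom s t 0 = 1"
  using qpoch_nonzero[of s t] by (simp add: qbinom_def)

lemma qbinom_pascal:
  assumes "0 < s" "s < 1"
  shows "qbinom s (Suc t) (Suc b) = s ^ (t - b) * qbinom s t b + qbinom s t (Suc b)"
proof -
  note nz = qpoch_nonzero[OF assms]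
  have fac: "1 - s ^ Suc i \<noteq> 0" for i
    using power_Suc_less_one[of s i] assms by auto
  consider "t < b" | "t = b" | d where "t = Suc (b + d)"
    by (metis less_imp_Suc_add linorder_neqE_nat)
  then show ?thesis
  proof cases
    case 3
    have e: "Suc t - Suc b = Suc d" "t - b = Suc d" "t - Suc b = d" "b \<le> t" "Suc b \<le> t"
      using 3 by auto
    have p: "s ^ Suc t = s ^ Suc b * s ^ Suc d" by (simp add: 3 power_add)
    have "qbinom s (Suc t) (Suc b) =
        qpoch s s t * (1 - s ^ Suc b * s ^ Suc d) /
        (qpoch s s b * (1 - s ^ Suc b) * (qpoch s s d * (1 - s ^ Suc d)))"
      using e(4) unfolding qbinom_def e(1) by (simp only: qpoch_Suc p) simp
    moreover have "qbinom s t b = qpoch s s t / (qpoch s s b * (qpoch s s d * (1 - s ^ Suc d)))"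
      using e(4) unfolding qbinom_def e(2) by (simp only: qpoch_Suc) simp
    moreover have "qbinom s t (Suc b) = qpoch s s t / (qpoch s s b * (1 - s ^ Suc b) * qpoch s s d)"
      using e(5) unfolding qbinom_def e(3) by (simp only: qpoch_Suc) simp
    moreover have "x * (1 - u * v) / (y * (1 - u) * (z * (1 - v))) =
        v * (x / (y * (z * (1 - v)))) + x / (y * (1 - u) * z)"
      if "y \<noteq> 0" "z \<noteq> 0" "1 - u \<noteq> 0" "1 - v \<noteq> 0" for x y z u v :: real
      using that by (simp add: divide_simps) (simp add: algebra_simps)
    ultimately show ?thesis
      unfolding e(2) using nz fac by metis
  qed (use assms in \<open>auto simp: qbinom_def nz\<close>)
qed

text \<open>
  Gauss's \<open>q\<close>-binomial theorem in homogeneous form. It is used at \<open>x = y = 1\<close>, where it inverts the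
  sequence \<open>1 / (s;s)\<^sub>m\<close> under convolution, and at \<open>x = 1\<close> with \<open>y\<close> a power of \<open>s\<close>, where it gives
  the eigenvectors of the limiting chain.
\<close>

lemma qbinomial_theorem:
  fixes x y :: real
  assumes "0 < s" "s < 1"
  shows "(\<Sum>l\<le>m. qbinom s m l * ((-1) ^ l * s ^ (l * (l - 1) div 2)) * x ^ l * y ^ (m - l))
       = (\<Prod>i<m. y - x * s ^ i)"
proof (induction m)
  case (Suc m)
  define c where "c l = (-1) ^ l * s ^ (l * (l - 1) div 2)" for l :: nat
  have c_Suc: "c (Suc l) = - c l * s ^ l" for l
  proof -
    have "Suc l * (Suc l - 1) div 2 = l * (l - 1) div 2 + l"
      by (cases l) (auto simp: algebra_simps)
    then show ?thesis by (simp add: c_def power_add)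
  qed
  define f where "f m l = qbinom s m l * c l * x ^ l * y ^ (m - l)" for m l
  \<comment> \<open>Pascal's rule turns the left side for \<open>m + 1\<close> into the one for \<open>m\<close> times \<open>y - x s\<^sup>m\<close>\<close>
  have f_Suc: "f (Suc m) (Suc l) = y * f m (Suc l) - x * s ^ m * f m l" if "l \<le> m" for l
  proof -
    have "f (Suc m) (Suc l) = s ^ (m - l) * qbinom s m l * c (Suc l) * x ^ Suc l * y ^ (m - l)
        + qbinom s m (Suc l) * c (Suc l) * x ^ Suc l * y ^ (m - l)"
      unfolding f_def qbinom_pascal[OF assms] by (simp add: algebra_simps)
    also have "s ^ (m - l) * qbinom s m l * c (Suc l) * x ^ Suc l * y ^ (m - l)
       = - (x * (s ^ (m - l) * s ^ l) * f m l)"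
      unfolding f_def c_Suc by (simp add: algebra_simps)
    also have "s ^ (m - l) * s ^ l = s ^ m"
      using that by (simp flip: power_add)
    also have "qbinom s m (Suc l) * c (Suc l) * x ^ Suc l * y ^ (m - l) = y * f m (Suc l)"
    proof (cases "l = m")
      case False
      then have "m - l = Suc (m - Suc l)" using that by simp
      then show ?thesis by (simp add: f_def)
    qed (simp add: f_def qbinom_def)
    finally show ?thesis by simp
  qed
  have top: "f m (Suc m) = 0" by (simp add: f_def qbinom_def)
  have bot: "f (Suc m) 0 = y * f m 0" using assms by (simp add: f_def)
  have "(\<Sum>l\<le>Suc m. f (Suc m) l) = f (Suc m) 0 + (\<Sum>l\<le>m. f (Suc m) (Suc l))"
    by (rule sum.atMost_Suc_shift)
  also have "(\<Sum>l\<le>m. f (Suc m) (Suc l)) = (\<Sum>l\<le>m. y * f m (Suc l) - x * s ^ m * f m l)"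
    by (intro sum.cong refl f_Suc) simp
  also have "f (Suc m) 0 + \<dots> = y * (f m 0 + (\<Sum>l\<le>m. f m (Suc l))) - x * s ^ m * (\<Sum>l\<le>m. f m l)"
    by (simp add: bot sum_subtractf sum_distrib_left algebra_simps)
  also have "f m 0 + (\<Sum>l\<le>m. f m (Suc l)) = (\<Sum>l\<le>m. f m l)"
    unfolding sum.atMost_Suc_shift[symmetric] by (simp add: top)
  finally have "(\<Sum>l\<le>Suc m. f (Suc m) l) = (\<Sum>l\<le>m. f m l) * (y - x * s ^ m)"
    by (simp add: algebra_simps)
  then show ?case using Suc.IH by (simp add: f_def c_def)
qed (use assms in simp)

section \<open>The limiting chain of dimensions and its diagonalisation\<close>

text \<open>
  The limit for \<open>n \<rightarrow> \<infinity>\<close> of the probability that \<open>D\<^sup>-\<^sup>1 U\<close> has dimension \<open>b\<close>, for \<open>U\<close> of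
  dimension \<open>a\<close> and a uniform \<open>n \<times> n\<close> matrix \<open>D\<close>. The chain starts in dimension \<open>0\<close>, so that its first
  step produces the dimension of the kernel of the first diagonal block.
\<close>

definition limit_kernel :: "real \<Rightarrow> nat \<Rightarrow> nat \<Rightarrow> real" where
  "limit_kernel s a b = (if a \<le> b
     then qpoch_inf s s * (s ^ ((b - a) * b) / (qpoch s s (b - a) * qpoch s s b)) else 0)"

fun limit_chain :: "real \<Rightarrow> nat \<Rightarrow> nat \<Rightarrow> real" where
  "limit_chain s 0 b = of_bool (b = 0)"
| "limit_chain s (Suc k) b = (\<Sum>a\<le>b. limit_chain s k a * limit_kernel s a b)"

text \<open>
  The coefficients of Euler's expansion of \<open>(z;s)\<^sub>\<infinity>\<close> in powers of \<open>z\<close>; they are at once the coordinates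
  of the left eigenvectors of \<open>limit_kernel\<close> and the weights in Van Peski's mass function.
\<close>

definition alt_weight :: "real \<Rightarrow> nat \<Rightarrow> real" where
  "alt_weight s m = (-1) ^ m * s ^ (m * (m - 1) div 2) / qpoch s s m"

text \<open>
  The coefficient of \<open>z\<^sup>j\<close> in \<open>(z;s)\<^sub>\<infinity> \<cdot> 1 / (z;s)\<^sub>\<infinity> = 1\<close>. It expands the initial point mass
  at \<open>0\<close> in the eigenvectors below.
\<close>

lemma alt_weight_inverse:
  assumes "0 < s" "s < 1"
  shows "(\<Sum>m\<le>j. alt_weight s m / qpoch s s (j - m)) = of_bool (j = 0)"
proof -
  have "(\<Sum>m\<le>j. alt_weight s m / qpoch s s (j - m)) =
     (\<Sum>m\<le>j. (qbinom s j m * ((-1) ^ m * s ^ (m * (m - 1) div 2)) * 1 ^ m * 1 ^ (j - m)) / qpoch s s j)"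
    using qpoch_nonzero[OF assms] by (intro sum.cong refl) (simp add: alt_weight_def qbinom_def field_simps)
  also have "\<dots> = (\<Prod>i<j. 1 - 1 * s ^ i) / qpoch s s j"
    unfolding sum_divide_distrib[symmetric] qbinomial_theorem[OF assms] ..
  also have "\<dots> = of_bool (j = 0)"
    by (cases j) (auto simp: prod.lessThan_Suc_shift simp del: prod.lessThan_Suc)
  finally show ?thesis .
qed

text \<open>
  The row vector with entry \<open>alt_weight s l\<close> in column \<open>a + l\<close> (and \<open>0\<close> to the left of \<open>a\<close>) is an
  eigenvector. After clearing denominators the left side is the \<open>q\<close>-binomial sum with \<open>y = s\<^bsup>a+m\<^esup>\<close>, and the
  resulting product \<open>\<Prod>i<m. s\<^bsup>a+m\<^esup> - s\<^sup>i\<close> equals \<open>(-1)\<^sup>m s\<^bsup>m(m-1)/2\<^esup>\<close> times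
  \<open>(s;s)\<^bsub>a+m\<^esub> / (s;s)\<^bsub>a\<^esub>\<close>.
\<close>

lemma alt_weight_left_eigenvector:
  assumes "0 < s" "s < 1"
  shows "(\<Sum>l\<le>m. alt_weight s l * limit_kernel s (a + l) (a + m))
       = qpoch_inf s s / qpoch s s a * alt_weight s m"
proof -
  note nz = qpoch_nonzero[OF assms]
  have "(\<Sum>l\<le>m. alt_weight s l * limit_kernel s (a + l) (a + m)) =
     (\<Sum>l\<le>m. qpoch_inf s s / (qpoch s s (a + m) * qpoch s s m) *
       (qbinom s m l * ((-1) ^ l * s ^ (l * (l - 1) div 2)) * 1 ^ l * (s ^ (a + m)) ^ (m - l)))"
    using nz
    by (intro sum.cong refl)
       (auto simp: alt_weight_def limit_kernel_def qbinom_def field_simps simp flip: power_mult)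
  also have "\<dots> = qpoch_inf s s / (qpoch s s (a + m) * qpoch s s m) * (\<Prod>i<m. s ^ (a + m) - 1 * s ^ i)"
    unfolding sum_distrib_left[symmetric] qbinomial_theorem[OF assms] ..
  also have "(\<Prod>i<m. s ^ (a + m) - 1 * s ^ i) =
      (\<Prod>i<m. - (s ^ i)) * (\<Prod>i<m. 1 - s ^ (a + m - i))"
    unfolding prod.distrib[symmetric]
    by (intro prod.cong refl) (auto simp: algebra_simps simp flip: power_add)
  also have "(\<Prod>i<m. - (s ^ i)) = (-1) ^ m * s ^ (m * (m - 1) div 2)"
  proof (induction m)
    case (Suc m)
    have "Suc m * (Suc m - 1) div 2 = m * (m - 1) div 2 + m"
      by (cases m) (auto simp: algebra_simps)
    then show ?case using Suc by (simp add: power_add)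
  qed simp
  also have "(\<Prod>i<m. 1 - s ^ (a + m - i)) = qpoch s s (a + m) / qpoch s s a"
    using nz[of a] by (simp add: qpoch_shift)
  finally show ?thesis
    using nz by (simp add: alt_weight_def)
qed

text \<open>
  The initial point mass is the combination of the left eigenvectors with coefficients \<open>1 / (s;s)\<^sub>a\<close>, and
  each step multiplies the coefficient of the \<open>a\<close>-th one by its eigenvalue.
\<close>

theorem limit_chain_diagonal:
  assumes "0 < s" "s < 1"
  shows "limit_chain s k j =
    (\<Sum>a\<le>j. (qpoch_inf s s / qpoch s s a) ^ k / qpoch s s a * alt_weight s (j - a))"
proof (induction k arbitrary: j)
  case 0
  have "(\<Sum>a\<le>j. alt_weight s (j - a) / qpoch s s a) = (\<Sum>m\<le>j. alt_weight s m / qpoch s s (j - m))"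
    by (rule sum.reindex_bij_witness[of _ "\<lambda>m. j - m" "\<lambda>m. j - m"]) auto
  then show ?case using alt_weight_inverse[OF assms, of j] by simp
next
  case (Suc k)
  define e where "e a = (qpoch_inf s s / qpoch s s a) ^ k / qpoch s s a" for a
  have "limit_chain s (Suc k) j =
     (\<Sum>c\<le>j. \<Sum>a\<le>c. e a * alt_weight s (c - a) * limit_kernel s c j)"
    unfolding limit_chain.simps Suc e_def sum_distrib_right ..
  also have "\<dots> = (\<Sum>a\<le>j. \<Sum>c\<in>{a..j}. e a * alt_weight s (c - a) * limit_kernel s c j)"
    unfolding sum.Sigma[OF finite_atMost ballI[OF finite_atMost]]
      sum.Sigma[OF finite_atMost ballI[OF finite_atLeastAtMost]]
    by (rule sum.reindex_bij_witness[of _ "\<lambda>(a, c). (c, a)" "\<lambda>(c, a). (a, c)"]) auto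
  also have "\<dots> = (\<Sum>a\<le>j. e a * (\<Sum>l\<le>j - a. alt_weight s l * limit_kernel s (a + l) (a + (j - a))))"
  proof (intro sum.cong refl)
    fix a assume "a \<in> {..j}"
    then show "(\<Sum>c\<in>{a..j}. e a * alt_weight s (c - a) * limit_kernel s c j) =
        e a * (\<Sum>l\<le>j - a. alt_weight s l * limit_kernel s (a + l) (a + (j - a)))"
      unfolding sum_distrib_left
      by (intro sum.reindex_bij_witness[of _ "\<lambda>l. a + l" "\<lambda>c. c - a"]) auto
  qed
  also have "\<dots> = (\<Sum>a\<le>j. e a * (qpoch_inf s s / qpoch s s a * alt_weight s (j - a)))"
    unfolding alt_weight_left_eigenvector[OF assms] ..
  finally show ?case by (simp add: e_def mult_ac)
qed

lemma limit_kernel_nonneg: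
  assumes "0 < s" "s < 1"
  shows "0 \<le> limit_kernel s a b"
  using qpoch_pos[OF assms] qpoch_inf_pos[OF assms] assms
  by (auto simp: limit_kernel_def intro!: mult_nonneg_nonneg divide_nonneg_pos less_imp_le)

lemma limit_chain_nonneg:
  assumes "0 < s" "s < 1"
  shows "0 \<le> limit_chain s k b"
  by (induction k arbitrary: b)
     (auto intro!: sum_nonneg mult_nonneg_nonneg limit_kernel_nonneg assms)

lemma limit_chain_1: "limit_chain s (Suc 0) b = limit_kernel s 0 b"
proof -
  have "limit_chain s (Suc 0) b = (\<Sum>a\<le>b. if a = 0 then limit_kernel s a b else 0)"
    unfolding limit_chain.simps by (intro sum.cong) auto
  then show ?thesis by simp
qed

section \<open>The dimension of the preimage of a subspace: the law for finite n\<close>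

text \<open>
  The probability that \<open>D\<^sup>-\<^sup>1 U\<close> has dimension \<open>b\<close>, for a uniform \<open>n \<times> t\<close> matrix \<open>D\<close> and \<open>U\<close> of
  dimension \<open>a\<close>; equivalently, that a uniform \<open>(n - a) \<times> t\<close> matrix has rank \<open>t - b\<close>. If the rank \<open>t - b\<close>
  exceeds \<open>n - a\<close>, the product contains the factor \<open>1 - s\<^sup>0\<close>, which masks the truncated exponents.
\<close>

definition preimage_law :: "real \<Rightarrow> nat \<Rightarrow> nat \<Rightarrow> nat \<Rightarrow> nat \<Rightarrow> real" where
  "preimage_law s n t a b =
     qbinom s t b * s ^ (b * (n - a + b - t)) * (\<Prod>i<t - b. 1 - s ^ (n - a - i))"

lemma preimage_law_0:
  assumes "0 < s" "s < 1"
  shows "preimage_law s n 0 a b = of_bool (b = 0)"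
  using assms by (auto simp: preimage_law_def qbinom_def)

lemma preimage_law_Suc_0:
  assumes "0 < s" "s < 1" "a < n"
  shows "preimage_law s n (Suc t) a 0 = (1 - s ^ (n - a)) * preimage_law s n t (Suc a) 0"
  using assms by (simp add: preimage_law_def prod.lessThan_Suc_shift del: prod.lessThan_Suc)

text \<open>
  The recursion obtained by exposing the first column: it falls into \<open>U\<close> with probability \<open>s\<^bsup>n-a\<^esup>\<close>
  and then adds a dimension to the preimage; otherwise it enlarges \<open>U\<close> by a dimension. On the level of
  formulas it is Pascal's rule for \<open>qbinom\<close>.
\<close>

lemma preimage_law_Suc_Suc:
  assumes "0 < s" "s < 1"
  shows "preimage_law s n (Suc t) a (Suc b) =
     s ^ (n - a) * preimage_law s n t a b + (1 - s ^ (n - a)) * preimage_law s n t (Suc a) (Suc b)"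
proof (cases "b \<le> t")
  case False
  then show ?thesis by (simp add: preimage_law_def qbinom_def)
next
  case True
  define N d where "N = n - a" and "d = t - b"
  define p where "p = (\<Prod>i<d. 1 - s ^ (N - i))"
  have ex: "n - a + Suc b - Suc t = N - d" "n - a + b - t = N - d"
    using True by (auto simp: N_def d_def)
  have lhs: "preimage_law s n (Suc t) a (Suc b) = qbinom s (Suc t) (Suc b) * s ^ (Suc b * (N - d)) * p"
    unfolding preimage_law_def ex p_def by (simp add: N_def d_def)
  have fst: "preimage_law s n t a b = qbinom s t b * s ^ (b * (N - d)) * p"
    unfolding preimage_law_def ex p_def by (simp add: N_def d_def)
  have snd: "(1 - s ^ N) * preimage_law s n t (Suc a) (Suc b) =
       qbinom s t (Suc b) * s ^ (Suc b * (N - d)) * p"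
  proof (cases "d = 0 \<or> N = 0")
    case True
    moreover have "p = 0" if "N = 0" "d \<noteq> 0"
      unfolding p_def using that by (intro prod_zero) (auto intro!: bexI[of _ 0])
    moreover have "qbinom s t (Suc b) = 0" if "d = 0"
      using that by (simp add: qbinom_def d_def)
    ultimately show ?thesis by (cases "d = 0") (auto simp: preimage_law_def)
  next
    case False
    then obtain d' where d': "d = Suc d'" by (auto simp: gr0_conv_Suc)
    have e: "t - Suc b = d'" "n - Suc a = N - 1" using d' by (auto simp: d_def N_def)
    have f: "N - 1 + Suc b - t = N - d" using False True by (auto simp: d_def)
    have "p = (1 - s ^ N) * (\<Prod>i<d'. 1 - s ^ (N - 1 - i))"
      unfolding p_def d' by (simp add: prod.lessThan_Suc_shift del: prod.lessThan_Suc)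
    then show ?thesis unfolding preimage_law_def e f by simp
  qed
  \<comment> \<open>for \<open>d > N\<close> the exponent \<open>N - d\<close> is truncated, but then \<open>p\<close> vanishes\<close>
  have pow: "s ^ d * s ^ (N - d) * p = s ^ N * p"
  proof (cases "d \<le> N")
    case False
    then have "p = 0" unfolding p_def by (intro prod_zero) (auto intro!: bexI[of _ N])
    then show ?thesis by simp
  qed (simp flip: power_add)
  have "preimage_law s n (Suc t) a (Suc b) =
      qbinom s t b * s ^ (b * (N - d)) * (s ^ d * s ^ (N - d) * p)
      + qbinom s t (Suc b) * s ^ (Suc b * (N - d)) * p"
  proof -
    have "s ^ (Suc b * (N - d)) = s ^ (b * (N - d)) * s ^ (N - d)"
      by (simp add: power_add)
    then show ?thesis
      unfolding lhs qbinom_pascal[OF assms] d_def[symmetric] by (simp only: ring_distribs mult_ac)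
  qed
  then show ?thesis
    unfolding pow N_def[symmetric] snd fst by (simp add: algebra_simps)
qed

lemma preimage_law_square:
  assumes "0 < s" "s < 1" "a \<le> n" "b \<le> n"
  shows "preimage_law s n n a b = (if a \<le> b then
     s ^ ((b - a) * b) * qpoch s s n * qpoch s s (n - a) /
       (qpoch s s b * qpoch s s (n - b) * qpoch s s (b - a)) else 0)"
proof (cases "a \<le> b")
  case True
  have "n - a = b - a + (n - b)" using True assms by simp
  then have "qpoch s s (n - a) = qpoch s s (b - a) * (\<Prod>i<n - b. 1 - s ^ (n - a - i))"
    by (metis qpoch_shift)
  moreover have "n - a + b - n = b - a" using assms by simp
  ultimately show ?thesis
    using True assms(4) qpoch_nonzero[OF assms(1,2)]
    by (simp add: preimage_law_def qbinom_def field_simps)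
next
  case False
  have "(\<Prod>i<n - b. 1 - s ^ (n - a - i)) = 0"
    using False assms by (intro prod_zero) (auto intro!: bexI[of _ "n - a"])
  then show ?thesis using False by (simp add: preimage_law_def)
qed

lemma geometric_tail_le:
  fixes s :: real assumes "0 < s" "s \<le> 1/2"
  shows "1 - s ^ m \<le> 1 - s ^ m * (s / (1 - s))"
proof -
  have "s / (1 - s) \<le> 1" using assms by simp
  then have "s ^ m * (s / (1 - s)) \<le> s ^ m * 1" using assms by (intro mult_left_mono) auto
  then show ?thesis by simp
qed

text \<open>
  The two bounds compare the exact law with its limit. The error in the lower one depends only on the final
  state \<open>b\<close>; as the limiting chain is monotone, this keeps the loss uniform along a whole trajectory.
\<close>

lemma preimage_law_ge:
  fixes s :: real assumes "0 < s" "s \<le> 1/2" "a \<le> n" "b \<le> n"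
  shows "limit_kernel s a b * (1 - s ^ (n - b)) \<le> preimage_law s n n a b"
proof (cases "a \<le> b")
  case True
  have s: "0 < s" "s < 1" using assms by auto
  note pos = qpoch_pos[OF s]
  have "qpoch s s (n - b) * (1 - s ^ (n - b)) \<le> qpoch s s (n - b) * (1 - s ^ (n - b) * (s / (1 - s)))"
    using geometric_tail_le[OF assms(1,2)] pos[of "n - b"] by (intro mult_left_mono) auto
  also have "\<dots> \<le> qpoch s s (n - a)"
    using True assms by (intro qpoch_tail_ge s) auto
  finally have "1 - s ^ (n - b) \<le> qpoch s s (n - a) / qpoch s s (n - b)"
    using pos[of "n - b"] by (simp add: pos_le_divide_eq mult.commute)
  then have "qpoch_inf s s * (1 - s ^ (n - b)) \<le> qpoch s s n * (qpoch s s (n - a) / qpoch s s (n - b))"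
    using qpoch_inf_le_qpoch[OF s, of n] pos[of n] s
    by (intro mult_mono) (auto intro!: power_le_one)
  then have "s ^ ((b - a) * b) / (qpoch s s b * qpoch s s (b - a)) * (qpoch_inf s s * (1 - s ^ (n - b)))
    \<le> s ^ ((b - a) * b) / (qpoch s s b * qpoch s s (b - a)) *
        (qpoch s s n * (qpoch s s (n - a) / qpoch s s (n - b)))"
    using pos s by (intro mult_left_mono divide_nonneg_pos mult_pos_pos) auto
  then show ?thesis
    using True assms by (simp add: preimage_law_square[OF s] limit_kernel_def mult_ac)
next
  case False
  then show ?thesis using assms by (simp add: preimage_law_square limit_kernel_def)
qed

lemma preimage_law_le:
  fixes s :: real assumes "0 < s" "s \<le> 1/2" "a \<le> n" "b \<le> n"
  shows "preimage_law s n n a b * (1 - s ^ n) \<le> limit_kernel s a b"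
proof (cases "a \<le> b")
  case True
  have s: "0 < s" "s < 1" using assms by auto
  note pos = qpoch_pos[OF s]
  have "qpoch s s n * (1 - s ^ n) \<le> qpoch s s n * (1 - s ^ n * (s / (1 - s)))"
    using geometric_tail_le[OF assms(1,2)] pos[of n] by (intro mult_left_mono) auto
  also have "\<dots> \<le> qpoch_inf s s" by (rule qpoch_inf_tail_ge[OF s])
  finally have 1: "qpoch s s n * (1 - s ^ n) \<le> qpoch_inf s s" .
  have 2: "qpoch s s (n - a) / qpoch s s (n - b) \<le> 1"
    using qpoch_antimono[OF s, of "n - b" "n - a"] True pos[of "n - b"] by simp
  have "(qpoch s s (n - a) / qpoch s s (n - b)) * (qpoch s s n * (1 - s ^ n)) \<le> 1 * qpoch_inf s s"
    using 1 2 pos s by (intro mult_mono) (auto intro!: power_le_one divide_nonneg_pos mult_nonneg_nonneg less_imp_le[OF pos]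
        less_imp_le[OF qpoch_inf_pos[OF s]])
  then have "s ^ ((b - a) * b) / (qpoch s s b * qpoch s s (b - a)) *
      ((qpoch s s (n - a) / qpoch s s (n - b)) * (qpoch s s n * (1 - s ^ n)))
    \<le> s ^ ((b - a) * b) / (qpoch s s b * qpoch s s (b - a)) * (1 * qpoch_inf s s)"
    using pos s by (intro mult_left_mono divide_nonneg_pos mult_pos_pos) auto
  then show ?thesis
    using True assms by (simp add: preimage_law_square[OF s] limit_kernel_def mult_ac)
next
  case False
  then show ?thesis using assms by (simp add: preimage_law_square limit_kernel_def)
qed

section \<open>The limiting chain as a sum over increments\<close>

text \<open>
  A trajectory from \<open>0\<close> to \<open>j\<close> is determined by its increments \<open>r\<^sub>1, \<dots>, r\<^sub>K\<close>, and the exponent of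
  the step into \<open>r\<^sub>1 + \<dots> + r\<^sub>i\<close> is \<open>r\<^sub>i\<close> times that state.
\<close>

lemma limit_chain_eq_sum_over_increments:
  "limit_chain s K j =
    (\<Sum>r | r \<in> {1..K} \<rightarrow>\<^sub>E (UNIV :: nat set) \<and> (\<Sum>i=1..K. r i) = j.
       qpoch_inf s s ^ K *
       (\<Prod>i=1..K. s ^ (r i * (\<Sum>l=1..i. r l)) /
          (qpoch s s (r i) * qpoch s s (\<Sum>l=1..i. r l))))"
proof (induction K arbitrary: j)
  case 0
  have "{r. r \<in> {1..0::nat} \<rightarrow>\<^sub>E (UNIV :: nat set) \<and> (\<Sum>i=1..0. r i) = j} =
      (if j = 0 then {\<lambda>_. undefined} else {})" by auto
  then show ?case by simp
next
  case (Suc K)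
  define S where "S K j = {r. r \<in> {1..K} \<rightarrow>\<^sub>E (UNIV :: nat set) \<and> (\<Sum>i=1..K. r i) = j}" for K j :: nat
  define w where "w r i = s ^ (r i * (\<Sum>l=1..i. r l)) /
          (qpoch s s (r i) * qpoch s s (\<Sum>l=1..i. r l))" for r :: "nat \<Rightarrow> nat" and i
  have fin: "finite (S K j)" for K j :: nat
  proof (rule finite_subset)
    show "S K j \<subseteq> {1..K} \<rightarrow>\<^sub>E {..j}"
    proof
      fix r assume "r \<in> S K j"
      then have r: "r \<in> {1..K} \<rightarrow>\<^sub>E UNIV" "(\<Sum>i=1..K. r i) = j" by (auto simp: S_def)
      have "r i \<le> j" if "i \<in> {1..K}" for i
        unfolding r(2)[symmetric] by (rule member_le_sum[OF that]) auto
      then show "r \<in> {1..K} \<rightarrow>\<^sub>E {..j}" using r(1) by (auto simp: PiE_iff)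
    qed
  qed (auto intro: finite_PiE)
  have w_upd: "w (r(Suc K := x)) i = w r i" if "i \<in> {1..K}" for r x i
  proof -
    have "(\<Sum>l=1..i. (r(Suc K := x)) l) = (\<Sum>l=1..i. r l)"
      using that by (intro sum.cong) auto
    then show ?thesis using that by (simp add: w_def)
  qed
  have "limit_chain s (Suc K) j =
      (\<Sum>a\<le>j. \<Sum>r\<in>S K a. qpoch_inf s s ^ K * (\<Prod>i=1..K. w r i) * limit_kernel s a j)"
    unfolding limit_chain.simps Suc S_def w_def sum_distrib_right ..
  also have "\<dots> = (\<Sum>(a, r)\<in>(SIGMA a:{..j}. S K a).
      qpoch_inf s s ^ K * (\<Prod>i=1..K. w r i) * limit_kernel s a j)"
    by (rule sum.Sigma) (auto intro: fin)
  also have "\<dots> = (\<Sum>r\<in>S (Suc K) j. qpoch_inf s s ^ Suc K * (\<Prod>i=1..Suc K. w r i))"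
  proof (rule sum.reindex_bij_witness[of _ "\<lambda>r. (\<Sum>i=1..K. r i, r(Suc K := undefined))"
        "\<lambda>(a, r). r(Suc K := j - a)"])
    fix x assume "x \<in> (SIGMA a:{..j}. S K a)"
    then obtain a r where x: "x = (a, r)" "a \<le> j" "r \<in> {1..K} \<rightarrow>\<^sub>E UNIV" "(\<Sum>i=1..K. r i) = a"
      by (auto simp: S_def)
    have r_top: "r (Suc K) = undefined" using x(3) by (auto simp: PiE_iff extensional_def)
    have part: "(\<Sum>i=1..K. (r(Suc K := j - a)) i) = a"
      unfolding x(4)[symmetric] by (intro sum.cong) auto
    then have tot: "(\<Sum>i=1..Suc K. (r(Suc K := j - a)) i) = j" using x(2) by simp
    show "(\<Sum>i=1..K. (case x of (a, r) \<Rightarrow> r(Suc K := j - a)) i,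
        (case x of (a, r) \<Rightarrow> r(Suc K := j - a))(Suc K := undefined)) = x"
      using part r_top by (auto simp: x(1) fun_eq_iff)
    show "(case x of (a, r) \<Rightarrow> r(Suc K := j - a)) \<in> S (Suc K) j"
      using tot x(3) by (auto simp: x(1) S_def PiE_iff extensional_def)
    have "w (r(Suc K := j - a)) (Suc K) =
        s ^ ((j - a) * j) / (qpoch s s (j - a) * qpoch s s j)"
      unfolding w_def tot by simp
    moreover have "(\<Prod>i=1..K. w (r(Suc K := j - a)) i) = (\<Prod>i=1..K. w r i)"
      by (intro prod.cong refl w_upd) auto
    ultimately show "qpoch_inf s s ^ Suc K *
        (\<Prod>i=1..Suc K. w (case x of (a, r) \<Rightarrow> r(Suc K := j - a)) i) =
      (case x of (a, r) \<Rightarrow> qpoch_inf s s ^ K * (\<Prod>i=1..K. w r i) * limit_kernel s a j)"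
      using x(2) by (simp add: x(1) limit_kernel_def mult_ac)
  next
    fix r assume r: "r \<in> S (Suc K) j"
    then have sum: "(\<Sum>i=1..K. r i) + r (Suc K) = j" by (simp add: S_def)
    then show "(case (\<Sum>i=1..K. r i, r(Suc K := undefined)) of
        (a, r) \<Rightarrow> r(Suc K := j - a)) = r" by auto
    have "(\<Sum>i=1..K. (r(Suc K := undefined)) i) = (\<Sum>i=1..K. r i)"
      by (intro sum.cong) auto
    then show "(\<Sum>i=1..K. r i, r(Suc K := undefined)) \<in> (SIGMA a:{..j}. S K a)"
      using r sum by (auto simp: S_def PiE_iff extensional_def)
  qed
  finally show ?case by (simp add: S_def w_def)
qed

section \<open>Convergence of the limiting chain to Van Peski's distribution\<close>

lemma euler_tail_le_exp:
  fixes s :: real assumes "0 < s" "s < 1"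
  shows "qpoch_inf s s / qpoch s s a \<le> exp (- (s ^ a * (s / (1 - s))))"
proof -
  note pos = qpoch_pos[OF assms]
  have "qpoch s s (a + d) \<le> qpoch s s a * exp (- (s ^ a * s * (\<Sum>i<d. s ^ i)))" for d
  proof (induction d)
    case (Suc d)
    have "1 - s ^ Suc (a + d) \<le> exp (- (s ^ Suc (a + d)))"
      using exp_ge_add_one_self[of "- (s ^ Suc (a + d))"] by simp
    then have "qpoch s s (a + d) * (1 - s ^ Suc (a + d)) \<le>
       qpoch s s a * exp (- (s ^ a * s * (\<Sum>i<d. s ^ i))) * exp (- (s ^ Suc (a + d)))"
      using Suc less_imp_le[OF pos] power_le_one[of s "Suc (a + d)"] assms
      by (intro mult_mono) (auto simp del: power_Suc)
    also have "\<dots> = qpoch s s a * exp (- (s ^ a * s * (\<Sum>i<Suc d. s ^ i)))"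
      by (simp add: algebra_simps power_add flip: exp_add)
    finally show ?case by (simp add: qpoch_Suc)
  qed simp
  moreover have "(\<lambda>d. qpoch s s (a + d)) \<longlonglongrightarrow> qpoch_inf s s"
    using LIMSEQ_ignore_initial_segment[OF qpoch_LIMSEQ[OF assms], of a] by (simp add: add.commute)
  moreover have "(\<lambda>d. qpoch s s a * exp (- (s ^ a * s * (\<Sum>i<d. s ^ i)))) \<longlonglongrightarrow>
      qpoch s s a * exp (- (s ^ a * s * (1 / (1 - s))))"
    using geometric_sums[of s] assms unfolding sums_def by (intro tendsto_intros) auto
  ultimately have "qpoch_inf s s \<le> qpoch s s a * exp (- (s ^ a * s * (1 / (1 - s))))"
    by (intro LIMSEQ_le) auto
  then show ?thesis using pos[of a] by (simp add: pos_divide_le_eq mult.commute)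
qed

lemma euler_tail_ge:
  fixes s :: real assumes "0 < s" "s < 1"
  shows "1 - s ^ a * (s / (1 - s)) \<le> qpoch_inf s s / qpoch s s a"
  using qpoch_inf_tail_ge[OF assms, of a] qpoch_pos[OF assms, of a]
  by (simp add: pos_le_divide_eq mult.commute)

text \<open>
  Both estimates of the eigenvalue \<open>\<lambda>\<^sub>J\<close> above have the form \<open>1 - y + O(y\<^sup>2)\<close> with \<open>y = s\<^sup>J s / (1 - s)\<close>,
  so that \<open>\<lambda>\<^sub>J\<^sup>k\<close> is close to \<open>exp (- k y)\<close> as soon as \<open>k y\<close> converges and \<open>y\<close> vanishes.
\<close>

lemma euler_tail_power_tendsto:
  fixes s c :: real
  assumes "0 < s" "s < 1"
    and J: "filterlim J at_top sequentially"
    and lim: "(\<lambda>i. real (k i) * s ^ J i) \<longlonglongrightarrow> c"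
  shows "(\<lambda>i. (qpoch_inf s s / qpoch s s (J i)) ^ k i) \<longlonglongrightarrow> exp (- (c * (s / (1 - s))))"
proof -
  define y where "y i = s ^ J i * (s / (1 - s))" for i
  have pow0: "(\<lambda>i. s ^ J i) \<longlonglongrightarrow> 0"
    by (rule filterlim_compose[OF LIMSEQ_power_zero J]) (use assms in simp)
  have y0: "y \<longlonglongrightarrow> 0"
    unfolding y_def using tendsto_mult_right[OF pow0, of "s / (1 - s)"] by simp
  have ky: "(\<lambda>i. real (k i) * y i) \<longlonglongrightarrow> c * (s / (1 - s))"
    unfolding y_def using tendsto_mult_right[OF lim, of "s / (1 - s)"] by (simp add: mult.assoc)
  have up: "(\<lambda>i. exp (- (real (k i) * y i))) \<longlonglongrightarrow> exp (- (c * (s / (1 - s))))"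
    by (intro tendsto_intros ky)
  have "(\<lambda>i. exp (- (real (k i) * y i) - 2 * (real (k i) * y i) * y i))
      \<longlonglongrightarrow> exp (- (c * (s / (1 - s))) - 2 * (c * (s / (1 - s))) * 0)"
    by (intro tendsto_intros ky y0)
  then have lo: "(\<lambda>i. exp (- (real (k i) * y i) - 2 * (real (k i) * y i) * y i))
      \<longlonglongrightarrow> exp (- (c * (s / (1 - s))))" by simp
  have small: "eventually (\<lambda>i. y i < 1 / 2) sequentially"
    using y0 by (rule order_tendstoD) simp
  show ?thesis
  proof (rule tendsto_sandwich[OF _ _ lo up])
    show "eventually (\<lambda>i. exp (- (real (k i) * y i) - 2 * (real (k i) * y i) * y i)
        \<le> (qpoch_inf s s / qpoch s s (J i)) ^ k i) sequentially"
      using small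
    proof eventually_elim
      case (elim i)
      have "0 \<le> y i" using assms by (simp add: y_def)
      then have "- y i - 2 * (y i)\<^sup>2 \<le> ln (1 - y i)"
        using elim by (intro ln_one_minus_pos_lower_bound) auto
      then have "exp (- y i - 2 * (y i)\<^sup>2) \<le> 1 - y i"
        using elim by (subst (asm) ln_ge_iff) auto
      also have "\<dots> \<le> qpoch_inf s s / qpoch s s (J i)"
        unfolding y_def by (rule euler_tail_ge[OF assms(1,2)])
      finally have "exp (- y i - 2 * (y i)\<^sup>2) ^ k i \<le> (qpoch_inf s s / qpoch s s (J i)) ^ k i"
        by (intro power_mono) auto
      also have "exp (- y i - 2 * (y i)\<^sup>2) ^ k i
          = exp (- (real (k i) * y i) - 2 * (real (k i) * y i) * y i)"
        by (simp add: algebra_simps power2_eq_square flip: exp_of_nat_mult)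
      finally show ?case .
    qed
    show "eventually (\<lambda>i. (qpoch_inf s s / qpoch s s (J i)) ^ k i \<le> exp (- (real (k i) * y i)))
        sequentially"
    proof (rule always_eventually, rule allI)
      fix i
      have "(qpoch_inf s s / qpoch s s (J i)) ^ k i \<le> exp (- y i) ^ k i"
        unfolding y_def using euler_tail_le_exp[OF assms(1,2)]
          qpoch_pos[OF assms(1,2)] qpoch_inf_pos[OF assms(1,2)]
        by (intro power_mono) (auto intro: divide_nonneg_pos less_imp_le)
      also have "\<dots> = exp (- (real (k i) * y i))"
        by (simp flip: exp_of_nat_mult)
      finally show "(qpoch_inf s s / qpoch s s (J i)) ^ k i \<le> exp (- (real (k i) * y i))" .
    qed
  qed
qed

lemma summable_alt_weight:
  assumes "0 < s" "s < 1"
  shows "summable (\<lambda>m. \<bar>alt_weight s m\<bar>)"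
proof (rule summable_comparison_test)
  note pos = qpoch_pos[OF assms] and ipos = qpoch_inf_pos[OF assms]
  have "\<bar>alt_weight s m\<bar> \<le> s ^ (m - 1) / qpoch_inf s s" for m
  proof -
    have "m - 1 \<le> m * (m - 1) div 2"
      by (cases "m \<le> 1") (auto simp: le_Suc_eq less_eq_div_iff_mult_less_eq)
    then have "s ^ (m * (m - 1) div 2) \<le> s ^ (m - 1)"
      using assms by (intro power_decreasing) auto
    then have "s ^ (m * (m - 1) div 2) / qpoch s s m \<le> s ^ (m - 1) / qpoch_inf s s"
      using ipos qpoch_inf_le_qpoch[OF assms, of m] assms by (intro frac_le) auto
    then show ?thesis
      using pos[of m] assms by (simp add: alt_weight_def abs_mult power_abs)
  qed
  then show "\<exists>N. \<forall>n\<ge>N. norm \<bar>alt_weight s n\<bar> \<le> s ^ (n - 1) / qpoch_inf s s" by auto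
  have "summable (\<lambda>m. s ^ (Suc m - 1))" using assms by simp
  then show "summable (\<lambda>m. s ^ (m - 1) / qpoch_inf s s)"
    by (intro summable_divide) (rule summable_Suc_iff[THEN iffD1])
qed

text \<open>
  In \<open>limit_chain_diagonal\<close>, indexed by the distance \<open>m = j - a\<close> to the final state, each summand converges
  by the preceding lemma. The eigenvalue powers lie between \<open>0\<close> and \<open>1\<close>, so the summands are dominated by a
  multiple of \<open>\<bar>alt_weight s m\<bar>\<close>, and Tannery's theorem exchanges limit and sum.
\<close>

theorem limit_chain_tendsto_van_peski:
  fixes s chi :: real and x :: int
  assumes s: "0 < s" "s < 1"
    and J: "filterlim J at_top sequentially"
    and lim: "(\<lambda>i. real (k i) * s ^ J i * (s / (1 - s))) \<longlonglongrightarrow> chi * s powi x"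
  shows "(\<lambda>i. limit_chain s (k i) (J i)) \<longlonglongrightarrow> van_peski_mass s chi x"
proof -
  note pos = qpoch_pos[OF s] and ipos = qpoch_inf_pos[OF s]
  define e where "e a i = (qpoch_inf s s / qpoch s s a) ^ k i / qpoch s s a" for a i
  define t where "t m i = (if m \<le> J i then e (J i - m) i * alt_weight s m else 0)" for m i
  define u where "u m = exp (- chi * s powi (x - int m)) / qpoch_inf s s * alt_weight s m" for m
  have sum_t: "limit_chain s (k i) (J i) = (\<Sum>m. t m i)" for i
  proof -
    have "limit_chain s (k i) (J i) = (\<Sum>a\<le>J i. e a i * alt_weight s (J i - a))"
      by (simp add: limit_chain_diagonal[OF s] e_def)
    also have "\<dots> = (\<Sum>m\<le>J i. t m i)"
      by (rule sum.reindex_bij_witness[of _ "\<lambda>m. J i - m" "\<lambda>m. J i - m"]) (auto simp: t_def)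
    also have "\<dots> = (\<Sum>m. t m i)"
      by (rule suminf_finite[symmetric]) (auto simp: t_def)
    finally show ?thesis .
  qed
  have t_lim: "(\<lambda>i. t m i) \<longlonglongrightarrow> u m" for m
  proof -
    have Jm: "filterlim (\<lambda>i. J i - m) at_top sequentially"
      unfolding filterlim_at_top
    proof
      fix Z
      show "eventually (\<lambda>i. Z \<le> J i - m) sequentially"
        using J[unfolded filterlim_at_top, rule_format, of "Z + m"] by eventually_elim simp
    qed
    have ev: "eventually (\<lambda>i. m \<le> J i) sequentially"
      using J[unfolded filterlim_at_top] by blast
    define c where "c = chi * s powi (x - int m) * ((1 - s) / s)"
    have "(\<lambda>i. real (k i) * s ^ (J i - m)) \<longlonglongrightarrow> c"
    proof (rule Lim_transform_eventually)
      have "(\<lambda>i. real (k i) * s ^ J i * (s / (1 - s)) * (((1 - s) / s) / s ^ m)) \<longlonglongrightarrow>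
          chi * s powi x * (((1 - s) / s) / s ^ m)"
        by (intro tendsto_mult_right lim)
      also have "chi * s powi x * (((1 - s) / s) / s ^ m) = c"
        using s by (simp add: c_def power_int_diff)
      finally show "(\<lambda>i. real (k i) * s ^ J i * (s / (1 - s)) * (((1 - s) / s) / s ^ m)) \<longlonglongrightarrow> c" .
      show "eventually (\<lambda>i. real (k i) * s ^ J i * (s / (1 - s)) * (((1 - s) / s) / s ^ m)
          = real (k i) * s ^ (J i - m)) sequentially"
        using ev by eventually_elim (use s in \<open>simp add: power_diff\<close>)
    qed
    from euler_tail_power_tendsto[OF s Jm this]
    have "(\<lambda>i. (qpoch_inf s s / qpoch s s (J i - m)) ^ k i) \<longlonglongrightarrow> exp (- chi * s powi (x - int m))"
      using s by (simp add: c_def)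
    moreover have "(\<lambda>i. qpoch s s (J i - m)) \<longlonglongrightarrow> qpoch_inf s s"
      by (rule filterlim_compose[OF qpoch_LIMSEQ[OF s] Jm])
    ultimately have "(\<lambda>i. e (J i - m) i * alt_weight s m) \<longlonglongrightarrow> u m"
      unfolding e_def u_def using ipos by (intro tendsto_intros) auto
    then show ?thesis
      by (rule Lim_transform_eventually) (use ev in \<open>eventually_elim, simp add: t_def\<close>)
  qed
  have t_bound: "norm (t m i) \<le> \<bar>alt_weight s m\<bar> / qpoch_inf s s" for m i
  proof -
    have "0 \<le> e a i \<and> e a i \<le> 1 / qpoch_inf s s" for a
    proof
      show "0 \<le> e a i" using pos[of a] ipos by (simp add: e_def)
      have "(qpoch_inf s s / qpoch s s a) ^ k i \<le> 1"
        using pos[of a] ipos qpoch_inf_le_qpoch[OF s, of a] by (intro power_le_one) auto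
      then show "e a i \<le> 1 / qpoch_inf s s"
        unfolding e_def using ipos qpoch_inf_le_qpoch[OF s, of a] by (intro frac_le) auto
    qed
    then have "\<bar>e (J i - m) i\<bar> * \<bar>alt_weight s m\<bar> \<le> 1 / qpoch_inf s s * \<bar>alt_weight s m\<bar>"
      by (intro mult_right_mono) auto
    then show ?thesis using ipos by (simp add: t_def abs_mult)
  qed
  have tannery: "eventually (\<lambda>i. summable (\<lambda>m. norm (t m i))) sequentially \<and>
      summable (\<lambda>m. norm (u m)) \<and> (\<lambda>i. \<Sum>m. t m i) \<longlonglongrightarrow> (\<Sum>m. u m)"
  proof (rule tannerys_theorem)
    show "eventually (\<lambda>(m, i). norm (t m i) \<le> \<bar>alt_weight s m\<bar> / qpoch_inf s s)
        (sequentially \<times>\<^sub>F sequentially)"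
      using t_bound by (auto intro!: always_eventually)
  qed (use t_lim summable_alt_weight[OF s] in \<open>auto intro: summable_divide\<close>)
  have u_sum: "(\<Sum>m. u m) = van_peski_mass s chi x"
  proof -
    have "summable (\<lambda>m. exp (- chi * s powi (x - int m)) * alt_weight s m)" 
    proof -
      have "summable u" using tannery by (auto intro: summable_norm_cancel)
      from summable_mult[OF this, of "qpoch_inf s s"] show ?thesis
        using ipos by (simp add: u_def)
    qed
    then show ?thesis
      unfolding van_peski_mass_def u_def alt_weight_def
      by (subst suminf_mult[symmetric]) (auto simp: mult_ac)
  qed
  then show ?thesis using tannery by (simp add: sum_t)
qed

section \<open>Averages over finite sets, vectors and matrices\<close>

definition mean :: "'b set \<Rightarrow> ('b \<Rightarrow> real) \<Rightarrow> real" where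
  "mean S f = (\<Sum>x\<in>S. f x) / real (card S)"

lemma mean_mono: "(\<And>x. x \<in> S \<Longrightarrow> f x \<le> g x) \<Longrightarrow> mean S f \<le> mean S g"
  by (simp add: mean_def divide_right_mono sum_mono)

lemma mean_cong: "(\<And>x. x \<in> S \<Longrightarrow> f x = g x) \<Longrightarrow> mean S f = mean S g"
  by (simp add: mean_def)

lemma mean_const: "finite S \<Longrightarrow> S \<noteq> {} \<Longrightarrow> mean S (\<lambda>_. c) = c"
  by (simp add: mean_def)

lemma mean_cmult: "mean S (\<lambda>x. c * f x) = c * mean S f"
  by (simp add: mean_def sum_distrib_left)

lemma mean_mult_right: "mean S (\<lambda>x. f x * c) = mean S f * c"
  by (simp add: mean_def sum_distrib_right)

lemma mean_add: "mean S (\<lambda>x. f x + g x) = mean S f + mean S g"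
  by (simp add: mean_def sum.distrib add_divide_distrib)

lemma mean_sum: "mean S (\<lambda>x. \<Sum>i\<in>I. f i x) = (\<Sum>i\<in>I. mean S (f i))"
  unfolding mean_def by (subst sum.swap) (simp add: sum_divide_distrib)

lemma mean_nonneg: "(\<And>x. x \<in> S \<Longrightarrow> 0 \<le> f x) \<Longrightarrow> 0 \<le> mean S f"
  by (simp add: mean_def sum_nonneg)

lemma mean_of_bool: "finite S \<Longrightarrow> mean S (\<lambda>x. of_bool (P x)) = real (card {x \<in> S. P x}) / real (card S)"
  by (simp add: mean_def Collect_conj_eq)

lemma mean_bij_betw: "bij_betw g S T \<Longrightarrow> mean T f = mean S (\<lambda>x. f (g x))"
  by (simp add: mean_def bij_betw_same_card sum.reindex_bij_betw)

lemma mean_Times: "mean (S \<times> T) f = mean S (\<lambda>x. mean T (\<lambda>y. f (x, y)))"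
  unfolding mean_def
  by (simp add: sum.cartesian_product card_cartesian_product sum_divide_distrib mult.commute
      case_prod_beta)

lemma mean_swap: "mean S (\<lambda>x. mean T (\<lambda>y. f x y)) = mean T (\<lambda>y. mean S (\<lambda>x. f x y))"
  unfolding mean_def sum_divide_distrib by (subst sum.swap) (simp add: mult.commute)

lemma card_carrier_vec: "card (carrier_vec n :: 'a::finite vec set) = CARD('a) ^ n"
  and finite_carrier_vec: "finite (carrier_vec n :: 'a::finite vec set)"
proof -
  have "bij_betw (\<lambda>f. vec n f) ({..<n} \<rightarrow>\<^sub>E (UNIV :: 'a set)) (carrier_vec n)"
  proof (rule bij_betwI[where g = "\<lambda>v. restrict (\<lambda>i. v $ i) {..<n}"])
    fix f assume f: "f \<in> {..<n} \<rightarrow>\<^sub>E (UNIV :: 'a set)"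
    then show "restrict (\<lambda>i. vec n f $ i) {..<n} = f"
      by (auto simp: fun_eq_iff restrict_def PiE_iff extensional_def)
  qed auto
  from bij_betw_same_card[OF this] bij_betw_finite[OF this]
  show "card (carrier_vec n :: 'a vec set) = CARD('a) ^ n"
    and "finite (carrier_vec n :: 'a vec set)"
    by (auto simp: card_PiE intro: finite_PiE)
qed

lemma card_field_gt_1: "1 < CARD('a::{field,finite})"
proof -
  have "card {0, 1 :: 'a} \<le> CARD('a)" by (rule card_mono) auto
  then show ?thesis by simp
qed

lemma inverse_card_field:
  fixes s :: real
  assumes "s = 1 / real CARD('a::{field,finite})"
  shows "0 < s" "s \<le> 1 / 2" "s < 1"
  using card_field_gt_1[where 'a = 'a] by (auto simp: assms field_simps)

text \<open>
  Prepends a column; a uniform matrix with \<open>t + 1\<close> columns is a uniform column followed by a uniform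
  matrix with \<open>t\<close> columns.
\<close>

definition cons_col :: "'a vec \<Rightarrow> 'a mat \<Rightarrow> 'a mat" where
  "cons_col v D = mat (dim_row D) (Suc (dim_col D)) (\<lambda>(i, j). case j of 0 \<Rightarrow> v $ i | Suc j \<Rightarrow> D $$ (i, j))"

lemma carrier_vec_nonempty: "carrier_vec n \<noteq> {}"
  using vec_carrier by blast

lemma bij_betw_cons_col:
  "bij_betw (\<lambda>(v, D). cons_col v D) (carrier_vec n \<times> carrier_mat n t) (carrier_mat n (Suc t))"
proof (rule bij_betwI[where g = "\<lambda>D. (vec n (\<lambda>i. D $$ (i, 0)), mat n t (\<lambda>(i, j). D $$ (i, Suc j)))"])
  fix D :: "'a mat" assume "D \<in> carrier_mat n (Suc t)"
  then show "(case (vec n (\<lambda>i. D $$ (i, 0)), mat n t (\<lambda>(i, j). D $$ (i, Suc j))) of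
      (v, D) \<Rightarrow> cons_col v D) = D"
    by (auto simp: cons_col_def intro!: eq_matI split: nat.split)
next
  show "(\<lambda>(v, D). cons_col v D) \<in> carrier_vec n \<times> carrier_mat n t \<rightarrow> carrier_mat n (Suc t)"
    by (auto simp: cons_col_def)
  show "(\<lambda>D. (vec n (\<lambda>i. D $$ (i, 0)), mat n t (\<lambda>(i, j). D $$ (i, Suc j))))
      \<in> carrier_mat n (Suc t) \<rightarrow> carrier_vec n \<times> carrier_mat n t"
    by auto
next
  fix x :: "'a vec \<times> 'a mat" assume "x \<in> carrier_vec n \<times> carrier_mat n t"
  then obtain v D where x: "x = (v, D)" "v \<in> carrier_vec n" "D \<in> carrier_mat n t" by auto
  have "vec n (\<lambda>i. cons_col v D $$ (i, 0)) = v"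
    using x by (intro eq_vecI) (auto simp: cons_col_def)
  moreover have "mat n t (\<lambda>(i, j). cons_col v D $$ (i, Suc j)) = D"
    using x by (intro eq_matI) (auto simp: cons_col_def)
  ultimately show "(vec n (\<lambda>i. (case x of (v, D) \<Rightarrow> cons_col v D) $$ (i, 0)),
      mat n t (\<lambda>(i, j). (case x of (v, D) \<Rightarrow> cons_col v D) $$ (i, Suc j))) = x"
    by (simp add: x(1))
qed

lemma finite_carrier_mat: "finite (carrier_mat n t :: 'a::finite mat set)"
proof (induction t)
  case 0
  have "carrier_mat n 0 \<subseteq> {mat n 0 (\<lambda>_. undefined :: 'a)}" by (auto intro!: eq_matI)
  then show ?case by (rule finite_subset) simp
next
  case (Suc t)
  then show ?case
    using bij_betw_finite[OF bij_betw_cons_col[of n t, where 'a = 'a]] finite_carrier_vec by blast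
qed

lemma carrier_mat_nonempty: "carrier_mat n t \<noteq> {}"
  using mat_carrier by blast

lemma cons_col_mult_vec:
  fixes v :: "'a::comm_ring_1 vec"
  assumes "v \<in> carrier_vec n" "D \<in> carrier_mat n t" "x \<in> carrier_vec t"
  shows "cons_col v D *\<^sub>v vCons c x = c \<cdot>\<^sub>v v + D *\<^sub>v x"
proof (rule eq_vecI)
  fix i assume "i < dim_vec (c \<cdot>\<^sub>v v + D *\<^sub>v x)"
  then have i: "i < n" using assms by auto
  have "row (cons_col v D) i = vCons (v $ i) (row D i)"
    using i assms by (intro eq_vecI) (auto simp: cons_col_def vec_index_vCons split: nat.split)
  then show "(cons_col v D *\<^sub>v vCons c x) $ i = (c \<cdot>\<^sub>v v + D *\<^sub>v x) $ i"
    using i assms by (simp add: cons_col_def)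
qed (use assms in \<open>simp add: cons_col_def\<close>)

section \<open>Preimages of subspaces under uniform matrices\<close>

definition subspace_of :: "nat \<Rightarrow> 'a::field vec set \<Rightarrow> bool" where
  "subspace_of n U \<longleftrightarrow> U \<subseteq> carrier_vec n \<and> 0\<^sub>v n \<in> U \<and>
     (\<forall>u\<in>U. \<forall>v\<in>U. u + v \<in> U) \<and> (\<forall>c. \<forall>u\<in>U. c \<cdot>\<^sub>v u \<in> U)"

lemma subspace_of_minus:
  assumes "subspace_of n U" "u \<in> U" "v \<in> U"
  shows "u - v \<in> U"
proof -
  have "u \<in> carrier_vec n" "v \<in> carrier_vec n" using assms by (auto simp: subspace_of_def)
  then have "u - v = u + (-1) \<cdot>\<^sub>v v" by (intro eq_vecI) auto
  then show ?thesis using assms by (simp add: subspace_of_def)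
qed

definition preimage_space :: "'a::field mat \<Rightarrow> 'a vec set \<Rightarrow> 'a vec set" where
  "preimage_space D U = {x \<in> carrier_vec (dim_col D). D *\<^sub>v x \<in> U}"

lemma subspace_of_preimage:
  assumes "D \<in> carrier_mat n t" "subspace_of n U"
  shows "subspace_of t (preimage_space D U)"
proof -
  have D0: "D *\<^sub>v 0\<^sub>v t = 0\<^sub>v n" using assms(1) by (intro eq_vecI) auto
  have "dim_col D = t" using assms(1) by simp
  with assms(2) show ?thesis
    by (simp add: subspace_of_def preimage_space_def D0 mult_add_distrib_mat_vec[OF assms(1)]
        mult_mat_vec[OF assms(1)] subset_iff)
qed

lemma subspace_of_image:
  assumes B: "B \<in> carrier_mat n t" and W: "subspace_of t W"
  shows "subspace_of n ((*\<^sub>v) B ` W)"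
  unfolding subspace_of_def
proof (intro conjI ballI allI)
  have W': "W \<subseteq> carrier_vec t" using W by (simp add: subspace_of_def)
  show "(*\<^sub>v) B ` W \<subseteq> carrier_vec n" using B W' by auto
  have "0\<^sub>v n = B *\<^sub>v 0\<^sub>v t" using B by (intro eq_vecI) auto
  then show "0\<^sub>v n \<in> (*\<^sub>v) B ` W"
    by (rule image_eqI) (use W in \<open>simp add: subspace_of_def\<close>)
  fix x assume "x \<in> (*\<^sub>v) B ` W"
  then obtain u where x: "x = B *\<^sub>v u" "u \<in> W" by blast
  then have u: "u \<in> carrier_vec t" using W' by blast
  show "c \<cdot>\<^sub>v x \<in> (*\<^sub>v) B ` W" for c
    unfolding x(1) mult_mat_vec[OF B u, symmetric]
    using W x(2) by (intro imageI) (simp add: subspace_of_def)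
  fix y assume "y \<in> (*\<^sub>v) B ` W"
  then obtain v where y: "y = B *\<^sub>v v" "v \<in> W" by blast
  then have v: "v \<in> carrier_vec t" using W' by blast
  show "x + y \<in> (*\<^sub>v) B ` W"
    unfolding x(1) y(1) mult_add_distrib_mat_vec[OF B u v, symmetric]
    using W x(2) y(2) by (intro imageI) (simp add: subspace_of_def)
qed

definition adjoin :: "'a::field vec set \<Rightarrow> 'a vec \<Rightarrow> 'a vec set" where
  "adjoin U v = (\<lambda>(u, c). u + c \<cdot>\<^sub>v v) ` (U \<times> UNIV)"

lemma adjoinI: "u \<in> U \<Longrightarrow> x = u + c \<cdot>\<^sub>v v \<Longrightarrow> x \<in> adjoin U v"
  unfolding adjoin_def by (rule image_eqI[of _ _ "(u, c)"]) auto

lemma adjoinE: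
  assumes "x \<in> adjoin U v"
  obtains u c where "u \<in> U" "x = u + c \<cdot>\<^sub>v v"
  using assms unfolding adjoin_def by auto

lemma subspace_of_adjoin:
  assumes U: "subspace_of n U" and v: "v \<in> carrier_vec n"
  shows "subspace_of n (adjoin U v)"
  unfolding subspace_of_def
proof (intro conjI ballI allI)
  have U': "U \<subseteq> carrier_vec n" "0\<^sub>v n \<in> U" using U by (auto simp: subspace_of_def)
  show "adjoin U v \<subseteq> carrier_vec n" using U' v by (auto simp: adjoin_def)
  have "0\<^sub>v n = 0\<^sub>v n + 0 \<cdot>\<^sub>v v" using v by (intro eq_vecI) auto
  then show "0\<^sub>v n \<in> adjoin U v" by (rule adjoinI[OF U'(2)])
  fix x assume "x \<in> adjoin U v"
  then obtain u c where x: "x = u + c \<cdot>\<^sub>v v" "u \<in> U" by (rule adjoinE)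
  have uc: "u \<in> carrier_vec n" using x U' by auto
  show "d \<cdot>\<^sub>v x \<in> adjoin U v" for d
  proof -
    have "d \<cdot>\<^sub>v x = d \<cdot>\<^sub>v u + (d * c) \<cdot>\<^sub>v v"
      unfolding x(1) using uc v by (intro eq_vecI) (auto simp: algebra_simps)
    then show ?thesis by (rule adjoinI[rotated]) (use U x(2) in \<open>simp add: subspace_of_def\<close>)
  qed
  fix y assume "y \<in> adjoin U v"
  then obtain u' c' where y: "y = u' + c' \<cdot>\<^sub>v v" "u' \<in> U" by (rule adjoinE)
  have "u' \<in> carrier_vec n" using y U' by auto
  then have "x + y = (u + u') + (c + c') \<cdot>\<^sub>v v"
    using v uc unfolding x(1) y(1) by (intro eq_vecI) (auto simp: algebra_simps)
  then show "x + y \<in> adjoin U v"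
    by (rule adjoinI[rotated]) (use U x(2) y(2) in \<open>simp add: subspace_of_def\<close>)
qed

text \<open>
  A line in a direction \<open>v\<close> outside \<open>U\<close> meets \<open>U\<close> in at most one point, as the difference of two
  such points would be a nonzero multiple of \<open>v\<close>.
\<close>

lemma line_meets_subspace_once:
  assumes U: "subspace_of n U" and v: "v \<in> carrier_vec n" "v \<notin> U"
    and w: "w \<in> carrier_vec n" "w + c \<cdot>\<^sub>v v \<in> U" "w + d \<cdot>\<^sub>v v \<in> U"
  shows "c = d"
proof (rule ccontr)
  assume "c \<noteq> d"
  have "(1 / (c - d)) \<cdot>\<^sub>v ((w + c \<cdot>\<^sub>v v) - (w + d \<cdot>\<^sub>v v)) \<in> U"
    using subspace_of_minus[OF U w(2,3)] U by (auto simp: subspace_of_def)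
  also have "(1 / (c - d)) \<cdot>\<^sub>v ((w + c \<cdot>\<^sub>v v) - (w + d \<cdot>\<^sub>v v)) = v"
    using v w(1) \<open>c \<noteq> d\<close> by (intro eq_vecI) (auto simp: field_simps)
  finally show False using v(2) by simp
qed

lemma card_adjoin:
  fixes U :: "'a::{field,finite} vec set"
  assumes U: "subspace_of n U" and v: "v \<in> carrier_vec n" "v \<notin> U"
  shows "card (adjoin U v) = CARD('a) * card U"
proof -
  have U': "U \<subseteq> carrier_vec n" using U by (simp add: subspace_of_def)
  have "inj_on (\<lambda>(u, c). u + c \<cdot>\<^sub>v v) (U \<times> UNIV)"
  proof (rule inj_onI, clarify)
    fix u c u' c' assume u: "u \<in> U" "u' \<in> U" and eq: "u + c \<cdot>\<^sub>v v = u' + c' \<cdot>\<^sub>v v"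
    have cu: "u \<in> carrier_vec n" "u' \<in> carrier_vec n" using u U' by auto
    have idx: "u $ i + c * v $ i = u' $ i + c' * v $ i" if "i < n" for i
      using arg_cong[OF eq, of "\<lambda>x. x $ i"] that cu v by simp
    have "0\<^sub>v n + (c - c') \<cdot>\<^sub>v v = u' - u"
      using cu v idx by (intro eq_vecI) (auto simp: algebra_simps)
    moreover have "0\<^sub>v n + 0 \<cdot>\<^sub>v v = 0\<^sub>v n" using v by (intro eq_vecI) auto
    ultimately have "c - c' = 0"
      using subspace_of_minus[OF U u(2,1)] U
      by (intro line_meets_subspace_once[OF U v zero_carrier_vec]) (auto simp: subspace_of_def)
    moreover from this have "u = u'" using cu idx by (intro eq_vecI) auto
    ultimately show "u = u' \<and> c = c'" by simp
  qed
  then show ?thesis by (simp add: adjoin_def card_image card_cartesian_product)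
qed

lemma preimage_space_cons_col:
  assumes "v \<in> carrier_vec n" "D \<in> carrier_mat n t"
  shows "preimage_space (cons_col v D) U =
    (\<lambda>(c, x). vCons c x) ` {(c, x). x \<in> carrier_vec t \<and> D *\<^sub>v x + c \<cdot>\<^sub>v v \<in> U}"
proof -
  have comm: "c \<cdot>\<^sub>v v + D *\<^sub>v x = D *\<^sub>v x + c \<cdot>\<^sub>v v" if "x \<in> carrier_vec t" for c x
    using assms that by (intro comm_add_vec[of _ n]) auto
  show ?thesis
  proof (intro equalityI subsetI)
    fix y assume y: "y \<in> preimage_space (cons_col v D) U"
    then have "y \<in> carrier_vec (Suc t)" using assms by (auto simp: preimage_space_def cons_col_def)
    then have "y = vCons (y $ 0) (vec t (\<lambda>i. y $ Suc i))"
      by (intro eq_vecI) (auto simp: vec_index_vCons)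
    then obtain c x where yx: "y = vCons c x" "x \<in> carrier_vec t"
      using that vec_carrier by blast
    then show "y \<in> (\<lambda>(c, x). vCons c x) ` {(c, x). x \<in> carrier_vec t \<and> D *\<^sub>v x + c \<cdot>\<^sub>v v \<in> U}"
      using y cons_col_mult_vec[OF assms yx(2), of c] comm[OF yx(2)]
      by (intro image_eqI[of _ _ "(c, x)"]) (auto simp: preimage_space_def)
  next
    fix y assume "y \<in> (\<lambda>(c, x). vCons c x) ` {(c, x). x \<in> carrier_vec t \<and> D *\<^sub>v x + c \<cdot>\<^sub>v v \<in> U}"
    then obtain c x where yx: "y = vCons c x" "x \<in> carrier_vec t" "D *\<^sub>v x + c \<cdot>\<^sub>v v \<in> U" by auto
    then show "y \<in> preimage_space (cons_col v D) U"
      using assms cons_col_mult_vec[OF assms yx(2), of c] comm[OF yx(2)]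
      by (simp add: preimage_space_def) (simp add: cons_col_def)
  qed
qed

text \<open>
  A new column \<open>v\<close> affects the preimage of \<open>U\<close> in one of two ways. If \<open>v\<close> lies in \<open>U\<close>, its
  coefficient is free. Otherwise \<open>D x + c v \<in> U\<close> can be solved for \<open>c\<close> iff \<open>D x\<close> lies in the span of
  \<open>U\<close> and \<open>v\<close>, and then in only one way.
\<close>

lemma card_preimage_cons_col_in:
  fixes U :: "'a::{field,finite} vec set"
  assumes U: "subspace_of n U" and D: "D \<in> carrier_mat n t" and v: "v \<in> U"
  shows "card (preimage_space (cons_col v D) U) = CARD('a) * card (preimage_space D U)"
proof -
  have U': "U \<subseteq> carrier_vec n" using U by (simp add: subspace_of_def)
  have vc: "v \<in> carrier_vec n" using v U' by auto
  have "D *\<^sub>v x + c \<cdot>\<^sub>v v \<in> U \<longleftrightarrow> D *\<^sub>v x \<in> U" if x: "x \<in> carrier_vec t" for c x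
  proof
    assume "D *\<^sub>v x + c \<cdot>\<^sub>v v \<in> U"
    then have "(D *\<^sub>v x + c \<cdot>\<^sub>v v) - c \<cdot>\<^sub>v v \<in> U"
      using U v by (intro subspace_of_minus[OF U]) (auto simp: subspace_of_def)
    also have "(D *\<^sub>v x + c \<cdot>\<^sub>v v) - c \<cdot>\<^sub>v v = D *\<^sub>v x"
      using D x vc by (intro eq_vecI) auto
    finally show "D *\<^sub>v x \<in> U" .
  qed (use U v in \<open>auto simp: subspace_of_def\<close>)
  then have "{(c, x). x \<in> carrier_vec t \<and> D *\<^sub>v x + c \<cdot>\<^sub>v v \<in> U} = UNIV \<times> preimage_space D U"
    using D by (auto simp: preimage_space_def)
  then have "preimage_space (cons_col v D) U = (\<lambda>(c, x). vCons c x) ` (UNIV \<times> preimage_space D U)"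
    by (simp add: preimage_space_cons_col[OF vc D])
  moreover have "inj_on (\<lambda>(c, x). vCons c x) (UNIV \<times> preimage_space D U)"
    by (auto simp: inj_on_def)
  ultimately show ?thesis by (simp add: card_image card_cartesian_product)
qed

lemma card_preimage_cons_col_notin:
  fixes U :: "'a::{field,finite} vec set"
  assumes U: "subspace_of n U" and D: "D \<in> carrier_mat n t"
    and v: "v \<in> carrier_vec n" "v \<notin> U"
  shows "card (preimage_space (cons_col v D) U) = card (preimage_space D (adjoin U v))"
proof -
  let ?P = "{(c, x). x \<in> carrier_vec t \<and> D *\<^sub>v x + c \<cdot>\<^sub>v v \<in> U}"
  have U': "U \<subseteq> carrier_vec n" using U by (simp add: subspace_of_def)
  have "card (preimage_space (cons_col v D) U) = card ?P"
    unfolding preimage_space_cons_col[OF v(1) D] by (intro card_image) (auto simp: inj_on_def)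
  also have "inj_on snd ?P"
  proof (rule inj_onI)
    fix p p' assume p: "p \<in> ?P" "p' \<in> ?P" "snd p = snd p'"
    then have "D *\<^sub>v snd p \<in> carrier_vec n" "D *\<^sub>v snd p + fst p \<cdot>\<^sub>v v \<in> U"
      "D *\<^sub>v snd p + fst p' \<cdot>\<^sub>v v \<in> U"
      using D by (auto intro: mult_mat_vec_carrier)
    then have "fst p = fst p'" by (rule line_meets_subspace_once[OF U v])
    then show "p = p'" using p(3) by (simp add: prod_eq_iff)
  qed
  then have "card ?P = card (snd ` ?P)" by (rule card_image[symmetric])
  also have "snd ` ?P = preimage_space D (adjoin U v)"
  proof (intro equalityI subsetI)
    fix x assume "x \<in> snd ` ?P"
    then obtain c where x: "x \<in> carrier_vec t" "D *\<^sub>v x + c \<cdot>\<^sub>v v \<in> U" by auto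
    have "D *\<^sub>v x = (D *\<^sub>v x + c \<cdot>\<^sub>v v) + (- c) \<cdot>\<^sub>v v"
      using D x(1) v by (intro eq_vecI) auto
    then have "D *\<^sub>v x \<in> adjoin U v" by (rule adjoinI[OF x(2)])
    then show "x \<in> preimage_space D (adjoin U v)" using x(1) D by (simp add: preimage_space_def)
  next
    fix x assume "x \<in> preimage_space D (adjoin U v)"
    then obtain u c where x: "x \<in> carrier_vec t" "D *\<^sub>v x = u + c \<cdot>\<^sub>v v" "u \<in> U"
      using D by (auto simp: preimage_space_def elim!: adjoinE)
    have "D *\<^sub>v x + (- c) \<cdot>\<^sub>v v = u"
      unfolding x(2) using U' x(3) v by (intro eq_vecI) auto
    then have "(- c, x) \<in> ?P" using x by simp
    then show "x \<in> snd ` ?P" by (rule image_eqI[rotated]) simp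
  qed
  finally show ?thesis .
qed

text \<open>
  Dimensions of subspaces are expressed by cardinalities throughout; the same case distinction shows that
  the cardinalities that occur are powers of \<open>q\<close>.
\<close>

lemma card_preimage_space_power:
  fixes U :: "'a::{field,finite} vec set"
  assumes "subspace_of n U" "D \<in> carrier_mat n t"
  shows "\<exists>b\<le>t. card (preimage_space D U) = CARD('a) ^ b"
  using assms
proof (induction t arbitrary: D U)
  case 0
  have "preimage_space D U = {0\<^sub>v 0}"
  proof -
    have "D *\<^sub>v 0\<^sub>v 0 = 0\<^sub>v n" using 0 by (intro eq_vecI) (auto simp: scalar_prod_def)
    then show ?thesis using 0 by (auto simp: preimage_space_def subspace_of_def)
  qed
  then show ?case by simp
next
  case (Suc t)
  obtain v D' where D: "D = cons_col v D'" "v \<in> carrier_vec n" "D' \<in> carrier_mat n t"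
    using bij_betw_imp_surj_on[OF bij_betw_cons_col[of n t]] Suc.prems(2) by force
  show ?case
  proof (cases "v \<in> U")
    case True
    obtain b where "b \<le> t" "card (preimage_space D' U) = CARD('a) ^ b"
      using Suc.IH[OF Suc.prems(1) D(3)] by blast
    then show ?thesis
      using card_preimage_cons_col_in[OF Suc.prems(1) D(3) True]
      by (intro exI[of _ "Suc b"]) (simp add: D(1))
  next
    case False
    then show ?thesis
      using Suc.IH[OF subspace_of_adjoin[OF Suc.prems(1) D(2)] D(3)]
        card_preimage_cons_col_notin[OF Suc.prems(1) D(3,2) False]
      by (auto simp: D(1) intro: le_SucI)
  qed
qed

text \<open>
  Induction on the number of columns, simultaneously for all \<open>U\<close>: after the first column is exposed, the
  remaining matrix is uniform, and it meets either \<open>U\<close> or the span of \<open>U\<close> and the first column.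
\<close>

theorem mean_card_preimage_space:
  fixes U :: "'a::{field,finite} vec set"
  defines "q \<equiv> CARD('a)"
  assumes "subspace_of n U" "card U = q ^ a"
  shows "mean (carrier_mat n t) (\<lambda>D. of_bool (card (preimage_space D U) = q ^ b))
       = preimage_law (1 / real q) n t a b"
  using assms(2,3)
proof (induction t arbitrary: U a b)
  case 0
  have q: "1 < q" using card_field_gt_1[where 'a = 'a] unfolding q_def by simp
  have "preimage_space D U = {0\<^sub>v 0}" if "D \<in> carrier_mat n 0" for D
  proof -
    have "D *\<^sub>v 0\<^sub>v 0 = 0\<^sub>v n" using that by (intro eq_vecI) (auto simp: scalar_prod_def)
    then show ?thesis using 0 that by (auto simp: preimage_space_def subspace_of_def)
  qed
  moreover have "1 = q ^ b \<longleftrightarrow> b = 0"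
    using q one_less_power[of q b] by (cases "b = 0") auto
  ultimately have "mean (carrier_mat n 0) (\<lambda>D. of_bool (card (preimage_space D U) = q ^ b))
      = mean (carrier_mat n 0 :: 'a mat set) (\<lambda>D. of_bool (b = 0))"
    by (intro mean_cong) simp
  then show ?case
    using q by (simp add: mean_const finite_carrier_mat carrier_mat_nonempty preimage_law_0)
next
  case (Suc t)
  have q: "1 < q" using card_field_gt_1[where 'a = 'a] unfolding q_def by simp
  note U = Suc.prems
  have UV: "U \<subseteq> carrier_vec n" using U(1) by (simp add: subspace_of_def)
  have "q ^ a \<le> q ^ n"
    using card_mono[OF finite_carrier_vec UV] U(2) by (simp add: card_carrier_vec q_def)
  then have an: "a \<le> n" by (rule power_le_imp_le_exp[OF q])
  let ?s = "1 / real q" and ?V = "carrier_vec n :: 'a vec set"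
  have frac: "real (card U) / real (card ?V) = ?s ^ (n - a)"
    using q an by (simp add: U(2) card_carrier_vec power_diff power_divide flip: q_def)
  have "mean (carrier_mat n (Suc t)) (\<lambda>D. of_bool (card (preimage_space D U) = q ^ b))
      = mean ?V (\<lambda>v. mean (carrier_mat n t) (\<lambda>D. of_bool (card (preimage_space (cons_col v D) U) = q ^ b)))"
    by (subst mean_bij_betw[OF bij_betw_cons_col]) (simp add: mean_Times)
  also have "\<dots> = mean ?V (\<lambda>v. of_bool (v \<in> U) * (if b = 0 then 0 else preimage_law ?s n t a (b - 1))
       + (1 - of_bool (v \<in> U)) * preimage_law ?s n t (Suc a) b)"
  proof (rule mean_cong)
    fix v assume v: "v \<in> ?V"
    show "mean (carrier_mat n t) (\<lambda>D. of_bool (card (preimage_space (cons_col v D) U) = q ^ b)) =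
       of_bool (v \<in> U) * (if b = 0 then 0 else preimage_law ?s n t a (b - 1))
       + (1 - of_bool (v \<in> U)) * preimage_law ?s n t (Suc a) b"
    proof (cases "v \<in> U")
      case True
      have "mean (carrier_mat n t) (\<lambda>D. of_bool (card (preimage_space (cons_col v D) U) = q ^ b))
          = mean (carrier_mat n t) (\<lambda>D. of_bool (q * card (preimage_space D U) = q ^ b))"
        using card_preimage_cons_col_in[OF U(1) _ True] by (intro mean_cong) (simp add: q_def)
      also have "\<dots> = (if b = 0 then 0 else preimage_law ?s n t a (b - 1))"
      proof (cases b)
        case 0
        then show ?thesis using q
          by (simp add: mean_const finite_carrier_mat carrier_mat_nonempty)
      next
        case (Suc b')
        then show ?thesis using q Suc.IH[OF U, of b'] by simp
      qed
      finally show ?thesis using True by simp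
    next
      case False
      have "mean (carrier_mat n t) (\<lambda>D. of_bool (card (preimage_space (cons_col v D) U) = q ^ b))
          = mean (carrier_mat n t) (\<lambda>D. of_bool (card (preimage_space D (adjoin U v)) = q ^ b))"
        using card_preimage_cons_col_notin[OF U(1) _ v False] by (intro mean_cong) simp
      also have "\<dots> = preimage_law ?s n t (Suc a) b"
        using card_adjoin[OF U(1) v False] U(2)
        by (intro Suc.IH subspace_of_adjoin[OF U(1) v]) (simp add: q_def)
      finally show ?thesis using False by simp
    qed
  qed
  also have "\<dots> = ?s ^ (n - a) * (if b = 0 then 0 else preimage_law ?s n t a (b - 1))
       + (1 - ?s ^ (n - a)) * preimage_law ?s n t (Suc a) b"
  proof -
    have "{v \<in> ?V. v \<in> U} = U" using UV by auto
    then have "mean ?V (\<lambda>v. of_bool (v \<in> U)) = ?s ^ (n - a)"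
      unfolding mean_of_bool[OF finite_carrier_vec] frac[symmetric] by simp
    moreover from this have "mean ?V (\<lambda>v. 1 - of_bool (v \<in> U)) = 1 - ?s ^ (n - a)"
      using mean_add[of ?V "\<lambda>v. 1 - of_bool (v \<in> U)" "\<lambda>v. of_bool (v \<in> U)"]
        mean_const[of ?V 1] by (simp add: finite_carrier_vec carrier_vec_nonempty)
    ultimately show ?thesis by (simp add: mean_add mean_mult_right)
  qed
  also have "\<dots> = preimage_law ?s n (Suc t) a b"
  proof (cases b)
    case 0
    show ?thesis
    proof (cases "a < n")
      case True
      then show ?thesis using q 0 by (simp add: preimage_law_Suc_0)
    next
      case False
      then show ?thesis using an 0 by (simp add: preimage_law_def prod.lessThan_Suc_shift del: prod.lessThan_Suc)
    qed
  next
    case (Suc b')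
    then show ?thesis using q by (simp add: preimage_law_Suc_Suc)
  qed
  finally show ?case .
qed

section \<open>First moments\<close>

text \<open>
  The image of a fixed nonzero vector under a uniform matrix is uniform: the column belonging to a nonzero
  coordinate already makes it so, whatever the other columns are.
\<close>

lemma mean_uniform_image:
  fixes x :: "'a::{field,finite} vec"
  assumes "x \<in> carrier_vec t" "x \<noteq> 0\<^sub>v t" "Y \<subseteq> carrier_vec n"
  shows "mean (carrier_mat n t) (\<lambda>B. of_bool (B *\<^sub>v x \<in> Y)) = real (card Y) / real (CARD('a) ^ n)"
  using assms(1,2)
proof (induction t arbitrary: x)
  case (Suc t)
  let ?V = "carrier_vec n :: 'a vec set"
  define c x' where "c = x $ 0" and "x' = vec t (\<lambda>i. x $ Suc i)"
  have x': "x' \<in> carrier_vec t" by (simp add: x'_def)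
  have x: "x = vCons c x'"
    using Suc.prems by (intro eq_vecI) (auto simp: c_def x'_def vec_index_vCons)
  have "mean (carrier_mat n (Suc t)) (\<lambda>B. of_bool (B *\<^sub>v x \<in> Y))
      = mean (?V \<times> carrier_mat n t) (\<lambda>(v, D). of_bool (c \<cdot>\<^sub>v v + D *\<^sub>v x' \<in> Y))"
    by (subst mean_bij_betw[OF bij_betw_cons_col], rule mean_cong)
       (auto simp: x cons_col_mult_vec[OF _ _ x'])
  also have "\<dots> = real (card Y) / real (CARD('a) ^ n)"
  proof (cases "c = 0")
    case True
    have "x' \<noteq> 0\<^sub>v t" using Suc.prems(2) True by (auto simp: x zero_vec_Suc)
    note IH = Suc.IH[OF x' this]
    have "mean (?V \<times> carrier_mat n t) (\<lambda>(v, D). of_bool (c \<cdot>\<^sub>v v + D *\<^sub>v x' \<in> Y))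
       = mean ?V (\<lambda>v. mean (carrier_mat n t) (\<lambda>D. of_bool (D *\<^sub>v x' \<in> Y)))"
      unfolding mean_Times
    proof (intro mean_cong)
      fix v :: "'a vec" and D :: "'a mat" assume v: "v \<in> ?V" and D: "D \<in> carrier_mat n t"
      have "c \<cdot>\<^sub>v v + D *\<^sub>v x' = D *\<^sub>v x'" 
        using v D True by (intro eq_vecI) auto
      then show "(case (v, D) of (v, D) \<Rightarrow> of_bool (c \<cdot>\<^sub>v v + D *\<^sub>v x' \<in> Y)) =
        (of_bool (D *\<^sub>v x' \<in> Y) :: real)" by simp
    qed
    then show ?thesis unfolding IH by (simp add: mean_const finite_carrier_vec carrier_vec_nonempty)
  next
    case False
    have "mean ?V (\<lambda>v. of_bool (c \<cdot>\<^sub>v v + w \<in> Y)) = real (card Y) / real (CARD('a) ^ n)"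
      if w: "w \<in> ?V" for w
    proof -
      have "bij_betw (\<lambda>v. c \<cdot>\<^sub>v v + w) ?V ?V"
      proof (rule bij_betwI[where g = "\<lambda>u. (1 / c) \<cdot>\<^sub>v (u - w)"])
        fix v :: "'a vec" assume v: "v \<in> ?V"
        show "(1 / c) \<cdot>\<^sub>v (c \<cdot>\<^sub>v v + w - w) = v"
          using v w False by (intro eq_vecI) auto
        show "c \<cdot>\<^sub>v ((1 / c) \<cdot>\<^sub>v (v - w)) + w = v"
          using v w False by (intro eq_vecI) auto
      qed (use w in auto)
      from mean_bij_betw[OF this, of "\<lambda>u. of_bool (u \<in> Y)"]
      have "mean ?V (\<lambda>v. of_bool (c \<cdot>\<^sub>v v + w \<in> Y)) = mean ?V (\<lambda>u. of_bool (u \<in> Y))" by simp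
      also have "{u \<in> ?V. u \<in> Y} = Y" using assms(3) by auto
      then have "mean ?V (\<lambda>u. of_bool (u \<in> Y)) = real (card Y) / real (CARD('a) ^ n)"
        unfolding mean_of_bool[OF finite_carrier_vec] by (simp add: card_carrier_vec)
      finally show ?thesis .
    qed
    then have "mean (carrier_mat n t) (\<lambda>D. mean ?V (\<lambda>v. of_bool (c \<cdot>\<^sub>v v + D *\<^sub>v x' \<in> Y)))
       = mean (carrier_mat n t :: 'a mat set) (\<lambda>D. real (card Y) / real (CARD('a) ^ n))"
      by (intro mean_cong) (metis mult_mat_vec_carrier x')
    moreover have "mean (?V \<times> carrier_mat n t) f = mean (carrier_mat n t) (\<lambda>D. mean ?V (\<lambda>v. f (v, D)))"
      for f :: "'a vec \<times> 'a mat \<Rightarrow> real"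
      unfolding mean_Times by (rule mean_swap)
    ultimately show ?thesis
      by (simp add: mean_const finite_carrier_mat carrier_mat_nonempty)
  qed
  finally show ?case .
next
  case 0
  then have "x = 0\<^sub>v 0" by (intro eq_vecI) auto
  then show ?case using 0 by simp
qed

text \<open>
  Linearity of expectation: the zero vector always lies in the preimage, and each of the fewer than \<open>q\<^sup>n\<close>
  other vectors does so with probability \<open>card U / q\<^sup>n\<close>.
\<close>

lemma mean_card_preimage_le:
  fixes U :: "'a::{field,finite} vec set"
  assumes "subspace_of n U"
  shows "mean (carrier_mat n n) (\<lambda>D. real (card (preimage_space D U))) \<le> 1 + real (card U)"
proof -
  let ?V = "carrier_vec n :: 'a vec set" and ?q = "real (CARD('a) ^ n)"
  have U: "U \<subseteq> ?V" using assms by (simp add: subspace_of_def)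
  have q: "0 < ?q" by simp
  have "mean (carrier_mat n n) (\<lambda>D. real (card (preimage_space D U)))
      = mean (carrier_mat n n) (\<lambda>D. \<Sum>x\<in>?V. of_bool (D *\<^sub>v x \<in> U))"
    by (intro mean_cong) (auto simp: preimage_space_def finite_carrier_vec Collect_conj_eq)
  also have "\<dots> = (\<Sum>x\<in>?V. mean (carrier_mat n n) (\<lambda>D. of_bool (D *\<^sub>v x \<in> U)))"
    by (rule mean_sum)
  also have "\<dots> \<le> (\<Sum>x\<in>?V. of_bool (x = 0\<^sub>v n) + real (card U) / ?q)"
  proof (rule sum_mono)
    fix x assume x: "x \<in> ?V"
    show "mean (carrier_mat n n) (\<lambda>D. of_bool (D *\<^sub>v x \<in> U)) \<le> of_bool (x = 0\<^sub>v n) + real (card U) / ?q"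
    proof (cases "x = 0\<^sub>v n")
      case True
      have "mean (carrier_mat n n) (\<lambda>D. of_bool (D *\<^sub>v x \<in> U)) \<le> mean (carrier_mat n n :: 'a mat set) (\<lambda>_. 1)"
        by (intro mean_mono) auto
      then show ?thesis using True q
        by (simp add: mean_const finite_carrier_mat carrier_mat_nonempty add_increasing2)
    next
      case False
      then show ?thesis using mean_uniform_image[OF x False U] by simp
    qed
  qed
  also have "\<dots> = 1 + real (card U)"
    using q by (simp add: sum.distrib card_carrier_vec finite_carrier_vec)
  finally show ?thesis .
qed

lemma not_inj_on_kernel_vector:
  fixes B :: "'a::field mat"
  assumes B: "B \<in> carrier_mat n t" and W: "subspace_of t W" and not_inj: "\<not> inj_on ((*\<^sub>v) B) W"
  obtains x where "x \<in> W" "x \<noteq> 0\<^sub>v t" "B *\<^sub>v x = 0\<^sub>v n"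
proof -
  have W': "W \<subseteq> carrier_vec t" using W by (simp add: subspace_of_def)
  obtain u v where uv: "u \<in> W" "v \<in> W" "B *\<^sub>v u = B *\<^sub>v v" "u \<noteq> v"
    using not_inj by (auto simp: inj_on_def)
  have c: "u \<in> carrier_vec t" "v \<in> carrier_vec t" using uv W' by auto
  have "u - v \<noteq> 0\<^sub>v t"
  proof
    assume eq: "u - v = 0\<^sub>v t"
    have "u $ i = v $ i" if "i < t" for i
      using arg_cong[OF eq, of "\<lambda>x. x $ i"] c that by simp
    then show False using uv(4) c by (auto intro!: eq_vecI)
  qed
  moreover have "B *\<^sub>v (u - v) = B *\<^sub>v u - B *\<^sub>v v"
    by (rule mult_minus_distrib_mat_vec[OF B c])
  then have "B *\<^sub>v (u - v) = 0\<^sub>v n" unfolding uv(3) using B c by simp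
  ultimately show ?thesis using that subspace_of_minus[OF W uv(1,2)] by blast
qed

text \<open>
  Union bound over the nonzero vectors of \<open>W\<close>, each of which is mapped to zero with probability
  \<open>1 / q\<^sup>n\<close>.
\<close>

lemma mean_not_inj_on_le:
  fixes W :: "'a::{field,finite} vec set"
  assumes W: "subspace_of t W"
  shows "mean (carrier_mat n t) (\<lambda>B. of_bool (\<not> inj_on ((*\<^sub>v) B) W)) \<le> real (card W) / real (CARD('a) ^ n)"
proof -
  have W': "W \<subseteq> carrier_vec t" using W by (simp add: subspace_of_def)
  have fin: "finite W" using W' finite_carrier_vec by (rule finite_subset)
  have "mean (carrier_mat n t) (\<lambda>B. of_bool (\<not> inj_on ((*\<^sub>v) B) W))
      \<le> mean (carrier_mat n t) (\<lambda>B. \<Sum>x\<in>W - {0\<^sub>v t}. of_bool (B *\<^sub>v x \<in> {0\<^sub>v n}))"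
  proof (rule mean_mono)
    fix B :: "'a mat" assume B: "B \<in> carrier_mat n t"
    show "of_bool (\<not> inj_on ((*\<^sub>v) B) W) \<le> (\<Sum>x\<in>W - {0\<^sub>v t}. of_bool (B *\<^sub>v x \<in> {0\<^sub>v n}) :: real)"
    proof (cases "inj_on ((*\<^sub>v) B) W")
      case False
      then obtain x where "x \<in> W" "x \<noteq> 0\<^sub>v t" "B *\<^sub>v x = 0\<^sub>v n"
        using not_inj_on_kernel_vector[OF B W] by blast
      then have "1 \<le> (\<Sum>x\<in>W - {0\<^sub>v t}. of_bool (B *\<^sub>v x \<in> {0\<^sub>v n}) :: real)"
        using member_le_sum[of x "W - {0\<^sub>v t}" "\<lambda>x. of_bool (B *\<^sub>v x \<in> {0\<^sub>v n}) :: real"] fin by simp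
      then show ?thesis using False by simp
    qed (auto intro!: sum_nonneg)
  qed
  also have "\<dots> = (\<Sum>x\<in>W - {0\<^sub>v t}. 1 / real (CARD('a) ^ n))"
    unfolding mean_sum
  proof (rule sum.cong[OF refl])
    fix x assume "x \<in> W - {0\<^sub>v t}"
    then have "x \<in> carrier_vec t" "x \<noteq> 0\<^sub>v t" using W' by auto
    then show "mean (carrier_mat n t) (\<lambda>B. of_bool (B *\<^sub>v x \<in> {0\<^sub>v n})) = 1 / real (CARD('a) ^ n)"
      using mean_uniform_image[of x t "{0\<^sub>v n}" n] by simp
  qed
  also have "\<dots> \<le> real (card W) / real (CARD('a) ^ n)"
    using card_Diff1_le[of W "0\<^sub>v t"] by (simp add: divide_right_mono)
  finally show ?thesis .
qed

section \<open>The last block of a kernel vector\<close>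

text \<open>
  A list of blocks is ordered from the bottom of the matrix to its top,
  \<open>[D\<^sub>k, B\<^sub>k, \<dots>, D\<^sub>2, B\<^sub>2, D\<^sub>1]\<close>, so that recursion on the list is recursion on \<open>k\<close>. The set
  \<open>last_blocks\<close> consists of the values at block \<open>k\<close> of the solutions of
  \<open>D\<^sub>1 x\<^sub>1 = 0\<close>, \<open>D\<^sub>i x\<^sub>i = B\<^sub>i x\<^sub>i\<^sub>-\<^sub>1\<close>. The sign in the kernel equations is dropped, as the sets
  involved are subspaces.
\<close>

fun last_blocks :: "nat \<Rightarrow> 'a::field mat list \<Rightarrow> 'a vec set" where
  "last_blocks n [] = {0\<^sub>v n}"
| "last_blocks n [D] = preimage_space D {0\<^sub>v n}"
| "last_blocks n (D # B # Ms) = preimage_space D ((*\<^sub>v) B ` last_blocks n Ms)"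

fun generic :: "nat \<Rightarrow> 'a::field mat list \<Rightarrow> bool" where
  "generic n (D # B # Ms) \<longleftrightarrow> generic n Ms \<and> inj_on ((*\<^sub>v) B) (last_blocks n Ms)"
| "generic n _ \<longleftrightarrow> True"

definition block_lists :: "nat \<Rightarrow> nat \<Rightarrow> 'a mat list set" where
  "block_lists n l = {Ms. set Ms \<subseteq> carrier_mat n n \<and> length Ms = l}"

lemma finite_block_lists: "finite (block_lists n l :: 'a::finite mat list set)"
  unfolding block_lists_def by (rule finite_lists_length_eq[OF finite_carrier_mat])

lemma block_lists_nonempty: "block_lists n l \<noteq> {}"
proof -
  have "replicate l (mat n n (\<lambda>_. undefined)) \<in> block_lists n l" by (auto simp: block_lists_def)
  then show ?thesis by blast
qed

lemma mean_block_lists_Suc: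
  "mean (block_lists n (Suc l)) f =
   mean (block_lists n l) (\<lambda>Ms. mean (carrier_mat n n) (\<lambda>M. f (M # Ms)))"
proof -
  have "bij_betw (\<lambda>(Ms, M). M # Ms) (block_lists n l \<times> carrier_mat n n) (block_lists n (Suc l))"
    by (rule bij_betwI[where g = "\<lambda>Ms. (tl Ms, hd Ms)"]) (auto simp: block_lists_def length_Suc_conv)
  from mean_bij_betw[OF this] show ?thesis by (simp add: mean_Times)
qed

lemma subspace_of_zero: "subspace_of n {0\<^sub>v n}"
  by (auto simp: subspace_of_def)

lemma subspace_of_last_blocks:
  "set Ms \<subseteq> carrier_mat n n \<Longrightarrow> subspace_of n (last_blocks n Ms)"
  by (induction n Ms rule: last_blocks.induct)
     (auto intro!: subspace_of_preimage subspace_of_image subspace_of_zero)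

lemma card_last_blocks:
  fixes Ms :: "'a::{field,finite} mat list"
  assumes "set Ms \<subseteq> carrier_mat n n"
  shows "\<exists>a\<le>n. card (last_blocks n Ms) = CARD('a) ^ a"
proof (cases "(n, Ms)" rule: last_blocks.cases)
  case (2 n D)
  then show ?thesis
    using card_preimage_space_power[OF subspace_of_zero] assms by auto
next
  case (3 n D B Ms)
  then show ?thesis
    using card_preimage_space_power[OF subspace_of_image[OF _ subspace_of_last_blocks]] assms by auto
qed auto

text \<open>
  The probability that \<open>2 l + 1\<close> independent uniform blocks, which make up a corner of \<open>l + 1\<close> block rows,
  are generic and leave a space of dimension \<open>b\<close> for the last block.
\<close>

definition generic_dim_prob :: "'a::{field,finite} itself \<Rightarrow> nat \<Rightarrow> nat \<Rightarrow> nat \<Rightarrow> real" where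
  "generic_dim_prob _ n l b = mean (block_lists n (2 * l + 1) :: 'a mat list set)
     (\<lambda>Ms. of_bool (generic n Ms \<and> card (last_blocks n Ms) = CARD('a) ^ b))"

lemma generic_dim_prob_0:
  "generic_dim_prob TYPE('a::{field,finite}) n 0 b = preimage_law (1 / real CARD('a)) n n 0 b"
proof -
  have "generic_dim_prob TYPE('a) n 0 b = mean (carrier_mat n n :: 'a mat set)
      (\<lambda>D. of_bool (card (preimage_space D {0\<^sub>v n}) = CARD('a) ^ b))"
    by (simp add: generic_dim_prob_def mean_block_lists_Suc)
       (simp add: block_lists_def mean_def)
  then show ?thesis
    using mean_card_preimage_space[OF subspace_of_zero, where 'a = 'a and a = 0] by simp
qed

text \<open>
  Given a generic configuration whose last block ranges over a space \<open>W\<close> of dimension \<open>a\<close>, the next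
  off-diagonal block \<open>B\<close> is injective on \<open>W\<close> with a probability between \<open>1 - s\<^bsup>n-a\<^esup>\<close> and \<open>1\<close>; if it
  is, \<open>B W\<close> has dimension \<open>a\<close> again, and the next diagonal block contributes the law of a preimage.
\<close>

lemma generic_dim_prob_Suc:
  fixes n b :: nat
  defines "s \<equiv> 1 / real CARD('a::{field,finite})"
  assumes "b \<le> n"
  shows "generic_dim_prob TYPE('a) n (Suc l) b
      \<le> (\<Sum>a\<le>b. generic_dim_prob TYPE('a) n l a * preimage_law s n n a b)" (is ?le)
    and "(\<Sum>a\<le>b. generic_dim_prob TYPE('a) n l a * ((1 - s ^ (n - a)) * preimage_law s n n a b))
      \<le> generic_dim_prob TYPE('a) n (Suc l) b" (is ?ge)
proof -
  let ?Mat = "carrier_mat n n :: 'a mat set" and ?L = "block_lists n (2 * l + 1) :: 'a mat list set"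
  define q where "q = CARD('a)"
  have q: "1 < q" using card_field_gt_1[where 'a = 'a] by (simp add: q_def)
  have s: "0 < s" "s < 1" using q by (auto simp: s_def q_def)
  define inj_frac where "inj_frac Ms = mean ?Mat (\<lambda>B. of_bool (inj_on ((*\<^sub>v) B) (last_blocks n Ms)))"
    for Ms
  have inj_le: "inj_frac Ms \<le> 1" and inj_nonneg: "0 \<le> inj_frac Ms" for Ms
  proof -
    have "inj_frac Ms \<le> mean ?Mat (\<lambda>_. 1)" unfolding inj_frac_def by (intro mean_mono) auto
    then show "inj_frac Ms \<le> 1" by (simp add: mean_const finite_carrier_mat carrier_mat_nonempty)
    show "0 \<le> inj_frac Ms" unfolding inj_frac_def by (intro mean_nonneg) auto
  qed
  have inj_ge: "1 - s ^ (n - a) \<le> inj_frac Ms"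
    if "Ms \<in> ?L" "card (last_blocks n Ms) = q ^ a" "a \<le> n" for Ms a
  proof -
    have sub: "subspace_of n (last_blocks n Ms)"
      using that by (intro subspace_of_last_blocks) (auto simp: block_lists_def)
    have "1 = mean ?Mat (\<lambda>B. of_bool (inj_on ((*\<^sub>v) B) (last_blocks n Ms))
        + of_bool (\<not> inj_on ((*\<^sub>v) B) (last_blocks n Ms)))"
      using mean_const[OF finite_carrier_mat carrier_mat_nonempty, of n n "1::real"]
      by (subst mean_cong[of _ _ "\<lambda>_. 1"]) (auto simp: mean_const finite_carrier_mat carrier_mat_nonempty)
    also have "\<dots> = inj_frac Ms + mean ?Mat (\<lambda>B. of_bool (\<not> inj_on ((*\<^sub>v) B) (last_blocks n Ms)))"
      unfolding mean_add inj_frac_def ..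
    also have "\<dots> \<le> inj_frac Ms + real (card (last_blocks n Ms)) / real (q ^ n)"
      unfolding q_def by (intro add_left_mono mean_not_inj_on_le[OF sub])
    also have "real (card (last_blocks n Ms)) / real (q ^ n) = s ^ (n - a)"
      using q that by (simp add: s_def power_diff power_divide flip: q_def)
    finally show ?thesis by simp
  qed
  define law where "law a = preimage_law s n n a b" for a
  have law_nonneg: "0 \<le> law a" if "a \<le> b" for a
    using that assms(2) s qpoch_pos[OF s]
    by (auto simp: law_def preimage_law_square less_imp_le intro!: divide_nonneg_pos mult_nonneg_nonneg mult_pos_pos)
  have step: "generic_dim_prob TYPE('a) n (Suc l) b = mean ?L (\<lambda>Ms.
      \<Sum>a\<le>b. of_bool (generic n Ms \<and> card (last_blocks n Ms) = q ^ a) * (inj_frac Ms * law a))"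
  proof -
    have "generic_dim_prob TYPE('a) n (Suc l) b = mean ?L (\<lambda>Ms. mean ?Mat (\<lambda>B. mean ?Mat (\<lambda>D.
        of_bool (generic n Ms \<and> inj_on ((*\<^sub>v) B) (last_blocks n Ms) \<and>
          card (preimage_space D ((*\<^sub>v) B ` last_blocks n Ms)) = q ^ b))))"
      unfolding generic_dim_prob_def by (simp add: mean_block_lists_Suc q_def)
    also have "\<dots> = mean ?L (\<lambda>Ms. \<Sum>a\<le>b. of_bool (generic n Ms \<and> card (last_blocks n Ms) = q ^ a)
        * (inj_frac Ms * law a))"
    proof (rule mean_cong)
      fix Ms :: "'a mat list" assume Ms: "Ms \<in> ?L"
      then have carr: "set Ms \<subseteq> carrier_mat n n" by (simp add: block_lists_def)
      obtain a where a: "a \<le> n" "card (last_blocks n Ms) = q ^ a"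
        using card_last_blocks[OF carr] by (auto simp: q_def)
      have law0: "law a = 0" if "b < a"
        using that a assms(2) by (simp add: law_def preimage_law_square[OF s])
      have uniq: "card (last_blocks n Ms) = q ^ a' \<longleftrightarrow> a' = a" for a'
        using q by (auto simp: a(2))
      have "mean ?Mat (\<lambda>B. mean ?Mat (\<lambda>D. of_bool (generic n Ms \<and> inj_on ((*\<^sub>v) B) (last_blocks n Ms) \<and>
          card (preimage_space D ((*\<^sub>v) B ` last_blocks n Ms)) = q ^ b)))
        = mean ?Mat (\<lambda>B. of_bool (generic n Ms) * (of_bool (inj_on ((*\<^sub>v) B) (last_blocks n Ms)) * law a))"
      proof (rule mean_cong)
        fix B :: "'a mat" assume B: "B \<in> ?Mat"
        show "mean ?Mat (\<lambda>D. of_bool (generic n Ms \<and> inj_on ((*\<^sub>v) B) (last_blocks n Ms) \<and>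
          card (preimage_space D ((*\<^sub>v) B ` last_blocks n Ms)) = q ^ b))
          = of_bool (generic n Ms) * (of_bool (inj_on ((*\<^sub>v) B) (last_blocks n Ms)) * law a)"
        proof (cases "generic n Ms \<and> inj_on ((*\<^sub>v) B) (last_blocks n Ms)")
          case True
          have "card ((*\<^sub>v) B ` last_blocks n Ms) = q ^ a"
            using True a(2) by (simp add: card_image)
          then show ?thesis
            using True mean_card_preimage_space[OF subspace_of_image[OF B subspace_of_last_blocks[OF carr]]]
            by (simp add: law_def s_def q_def)
        next
          case False
          then show ?thesis by (auto simp: mean_def)
        qed
      qed
      also have "\<dots> = of_bool (generic n Ms) * (inj_frac Ms * law a)"
        unfolding mean_cmult mean_mult_right inj_frac_def ..
      also have "\<dots> = (\<Sum>a\<le>b. of_bool (generic n Ms \<and> card (last_blocks n Ms) = q ^ a) * (inj_frac Ms * law a))"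
      proof -
        have "(\<Sum>a'\<le>b. of_bool (generic n Ms \<and> card (last_blocks n Ms) = q ^ a') * (inj_frac Ms * law a'))
           = (\<Sum>a'\<le>b. if a' = a then of_bool (generic n Ms) * (inj_frac Ms * law a) else 0)"
          by (intro sum.cong refl) (auto simp: uniq)
        then show ?thesis using law0 by (auto simp: not_le)
      qed
      finally show "mean ?Mat (\<lambda>B. mean ?Mat (\<lambda>D. of_bool (generic n Ms \<and> inj_on ((*\<^sub>v) B) (last_blocks n Ms) \<and>
          card (preimage_space D ((*\<^sub>v) B ` last_blocks n Ms)) = q ^ b)))
        = (\<Sum>a\<le>b. of_bool (generic n Ms \<and> card (last_blocks n Ms) = q ^ a) * (inj_frac Ms * law a))" .
    qed
    finally show ?thesis .
  qed
  have prob: "(\<Sum>a\<le>b. generic_dim_prob TYPE('a) n l a * c a) =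
      mean ?L (\<lambda>Ms. \<Sum>a\<le>b. of_bool (generic n Ms \<and> card (last_blocks n Ms) = q ^ a) * c a)" for c
    unfolding mean_sum mean_mult_right generic_dim_prob_def q_def ..
  show ?le
    unfolding step law_def[symmetric] prob
    by (intro mean_mono sum_mono mult_left_mono) (auto intro!: mult_left_le_one_le law_nonneg inj_le inj_nonneg)
  show ?ge
    unfolding step law_def[symmetric] prob
  proof (intro mean_mono sum_mono)
    fix Ms a assume "Ms \<in> ?L" "a \<in> {..b}"
    then show "of_bool (generic n Ms \<and> card (last_blocks n Ms) = q ^ a) * ((1 - s ^ (n - a)) * law a)
       \<le> of_bool (generic n Ms \<and> card (last_blocks n Ms) = q ^ a) * (inj_frac Ms * law a)"
      using inj_ge[of Ms a] law_nonneg[of a] assms(2) by (auto intro!: mult_right_mono)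
  qed
qed

lemma generic_dim_prob_nonneg: "0 \<le> generic_dim_prob TYPE('a::{field,finite}) n l b"
  unfolding generic_dim_prob_def by (intro mean_nonneg) simp

lemma generic_dim_prob_le_1: "generic_dim_prob TYPE('a::{field,finite}) n l b \<le> 1"
proof -
  have "generic_dim_prob TYPE('a) n l b \<le> mean (block_lists n (2 * l + 1) :: 'a mat list set) (\<lambda>_. 1)"
    unfolding generic_dim_prob_def by (intro mean_mono) simp
  then show ?thesis by (simp add: mean_const finite_block_lists block_lists_nonempty)
qed

section \<open>Comparison with the limiting chain\<close>

text \<open>
  Each step costs one factor for injectivity and one for passing to the limiting kernel. All states visited
  on the way to \<open>b\<close> are at most \<open>b \<le> j\<close>, hence every one of these factors is at least \<open>1 - s\<^bsup>n-j\<^esup>\<close>.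
\<close>

theorem generic_dim_prob_ge:
  fixes n j :: nat
  defines "s \<equiv> 1 / real CARD('a::{field,finite})"
  assumes "b \<le> j" "j \<le> n"
  shows "limit_chain s (Suc l) b * (1 - s ^ (n - j)) ^ (2 * Suc l) \<le> generic_dim_prob TYPE('a) n l b"
  using assms(2)
proof (induction l arbitrary: b)
  note s = inverse_card_field[OF s_def[THEN meta_eq_to_obj_eq]]
  let ?c = "1 - s ^ (n - j)"
  have c: "0 \<le> ?c" "?c \<le> 1" using s by (auto intro: power_le_one)
  have c_le: "?c \<le> 1 - s ^ (n - a)" if "a \<le> j" for a
    using s that by (auto intro!: power_decreasing)
  {
    case 0
    have "limit_kernel s 0 b * ?c ^ 2 \<le> limit_kernel s 0 b * (1 - s ^ (n - b))"
    proof (rule mult_left_mono)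
      have "?c ^ 2 \<le> ?c" using c by (simp add: power2_eq_square mult_left_le_one_le)
      also have "\<dots> \<le> 1 - s ^ (n - b)" by (rule c_le[OF 0])
      finally show "?c ^ 2 \<le> 1 - s ^ (n - b)" .
    qed (rule limit_kernel_nonneg[OF s(1,3)])
    also have "\<dots> \<le> preimage_law s n n 0 b"
      using 0 assms(3) s by (intro preimage_law_ge) auto
    finally show ?case
      unfolding limit_chain_1 generic_dim_prob_0 s_def[symmetric] by simp
  next
    case (Suc l)
    have "limit_chain s (Suc (Suc l)) b * ?c ^ (2 * Suc (Suc l))
        = (\<Sum>a\<le>b. limit_chain s (Suc l) a * ?c ^ (2 * Suc l) * (?c * (limit_kernel s a b * ?c)))"
    proof -
      have "?c ^ (2 * Suc (Suc l)) = ?c ^ (2 * Suc l) * (?c * ?c)" by simp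
      then show ?thesis
        unfolding limit_chain.simps(2)[of s "Suc l" b]
        by (simp only: sum_distrib_right) (intro sum.cong refl, simp only: mult_ac)
    qed
    also have "\<dots> \<le> (\<Sum>a\<le>b. generic_dim_prob TYPE('a) n l a * ((1 - s ^ (n - a)) * preimage_law s n n a b))"
    proof (rule sum_mono)
      fix a assume "a \<in> {..b}"
      then have a: "a \<le> b" "a \<le> j" "a \<le> n" "b \<le> n" using Suc.prems assms(3) by auto
      have "limit_kernel s a b * ?c \<le> limit_kernel s a b * (1 - s ^ (n - b))"
        by (intro mult_left_mono c_le[OF Suc.prems] limit_kernel_nonneg[OF s(1,3)])
      also have "\<dots> \<le> preimage_law s n n a b" by (rule preimage_law_ge[OF s(1,2) a(3,4)])
      finally have 1: "?c * (limit_kernel s a b * ?c) \<le> (1 - s ^ (n - a)) * preimage_law s n n a b"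
        using c c_le[OF a(2)] limit_kernel_nonneg[OF s(1,3), of a b] by (intro mult_mono) auto
      show "limit_chain s (Suc l) a * ?c ^ (2 * Suc l) * (?c * (limit_kernel s a b * ?c))
          \<le> generic_dim_prob TYPE('a) n l a * ((1 - s ^ (n - a)) * preimage_law s n n a b)"
        by (intro mult_mono[OF Suc.IH[OF a(2)] 1 generic_dim_prob_nonneg]
            mult_nonneg_nonneg c(1) limit_kernel_nonneg[OF s(1,3)])
    qed
    also have "\<dots> \<le> generic_dim_prob TYPE('a) n (Suc l) b"
      using Suc.prems assms(3) unfolding s_def by (intro generic_dim_prob_Suc(2)) simp
    finally show ?case .
  }
qed

text \<open>
  Here injectivity costs nothing, and \<open>1 - s\<^sup>n\<close> bounds the error of passing to the limiting kernel in
  every state.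
\<close>

theorem generic_dim_prob_le:
  fixes n b :: nat
  defines "s \<equiv> 1 / real CARD('a::{field,finite})"
  assumes "b \<le> n"
  shows "generic_dim_prob TYPE('a) n l b * (1 - s ^ n) ^ Suc l \<le> limit_chain s (Suc l) b"
  using assms(2)
proof (induction l arbitrary: b)
  note s = inverse_card_field[OF s_def[THEN meta_eq_to_obj_eq]]
  let ?c = "1 - s ^ n"
  have c: "0 \<le> ?c" using s by (auto intro: power_le_one)
  {
    case 0
    then show ?case
      unfolding limit_chain_1 generic_dim_prob_0 s_def[symmetric]
      using preimage_law_le[OF s(1,2), of 0 n b] by simp
  next
    case (Suc l)
    have "generic_dim_prob TYPE('a) n (Suc l) b * ?c ^ Suc (Suc l)
        \<le> (\<Sum>a\<le>b. generic_dim_prob TYPE('a) n l a * preimage_law s n n a b) * ?c ^ Suc (Suc l)"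
      using c Suc.prems unfolding s_def by (intro mult_right_mono generic_dim_prob_Suc(1)) auto
    also have "\<dots> = (\<Sum>a\<le>b. (generic_dim_prob TYPE('a) n l a * ?c ^ Suc l) * (preimage_law s n n a b * ?c))"
      by (simp only: sum_distrib_right power_Suc) (intro sum.cong refl, simp only: mult_ac)
    also have "\<dots> \<le> (\<Sum>a\<le>b. limit_chain s (Suc l) a * limit_kernel s a b)"
    proof (rule sum_mono)
      fix a assume "a \<in> {..b}"
      then have a: "a \<le> b" "a \<le> n" using Suc.prems by auto
      have "(generic_dim_prob TYPE('a) n l a * ?c ^ Suc l) * (preimage_law s n n a b * ?c)
          \<le> (generic_dim_prob TYPE('a) n l a * ?c ^ Suc l) * limit_kernel s a b"
        using c generic_dim_prob_nonneg[where 'a = 'a]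
        by (intro mult_left_mono preimage_law_le[OF s(1,2) a(2) Suc.prems]) auto
      also have "\<dots> \<le> limit_chain s (Suc l) a * limit_kernel s a b"
        by (intro mult_right_mono Suc.IH[OF a(2)] limit_kernel_nonneg[OF s(1,3)])
      finally show "(generic_dim_prob TYPE('a) n l a * ?c ^ Suc l) * (preimage_law s n n a b * ?c)
          \<le> limit_chain s (Suc l) a * limit_kernel s a b" .
    qed
    finally show ?case by simp
  }
qed

text \<open>
  A block row adds at most one to the mean size, because the image of a set is no larger than the set.
\<close>

lemma mean_card_last_blocks_le:
  "mean (block_lists n (2 * l + 1) :: 'a::{field,finite} mat list set)
     (\<lambda>Ms. real (card (last_blocks n Ms))) \<le> real l + 2"
proof (induction l)
  case 0
  have "mean (block_lists n 1 :: 'a mat list set) (\<lambda>Ms. real (card (last_blocks n Ms)))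
     = mean (carrier_mat n n :: 'a mat set) (\<lambda>D. real (card (preimage_space D {0\<^sub>v n})))"
    unfolding One_nat_def mean_block_lists_Suc by (simp add: block_lists_def mean_def)
  also have "\<dots> \<le> 1 + real (card {0\<^sub>v n :: 'a vec})"
    by (rule mean_card_preimage_le[OF subspace_of_zero])
  finally show ?case by simp
next
  case (Suc l)
  let ?Mat = "carrier_mat n n :: 'a mat set" and ?L = "block_lists n (2 * l + 1) :: 'a mat list set"
  have "mean (block_lists n (2 * Suc l + 1) :: 'a mat list set) (\<lambda>Ms. real (card (last_blocks n Ms)))
     = mean ?L (\<lambda>Ms. mean ?Mat (\<lambda>B. mean ?Mat (\<lambda>D.
         real (card (preimage_space D ((*\<^sub>v) B ` last_blocks n Ms))))))"
    by (simp add: mean_block_lists_Suc)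
  also have "\<dots> \<le> mean ?L (\<lambda>Ms. mean ?Mat (\<lambda>B. 1 + real (card (last_blocks n Ms))))"
  proof (intro mean_mono)
    fix Ms :: "'a mat list" and B assume Ms: "Ms \<in> ?L" and B: "B \<in> ?Mat"
    have sub: "subspace_of n (last_blocks n Ms)"
      using Ms by (intro subspace_of_last_blocks) (simp add: block_lists_def)
    then have "finite (last_blocks n Ms)"
      unfolding subspace_of_def using finite_carrier_vec finite_subset by blast
    then have "card ((*\<^sub>v) B ` last_blocks n Ms) \<le> card (last_blocks n Ms)" by (rule card_image_le)
    then show "mean ?Mat (\<lambda>D. real (card (preimage_space D ((*\<^sub>v) B ` last_blocks n Ms))))
        \<le> 1 + real (card (last_blocks n Ms))"
      using mean_card_preimage_le[OF subspace_of_image[OF B sub]] by linarith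
  qed
  also have "\<dots> = 1 + mean ?L (\<lambda>Ms. real (card (last_blocks n Ms)))"
    by (simp add: mean_const finite_carrier_mat carrier_mat_nonempty mean_add finite_block_lists block_lists_nonempty)
  finally show ?case using Suc by simp
qed

text \<open>
  In block row \<open>i + 1\<close> genericity is lost with probability at most \<open>s\<^sup>n\<close> times the mean size of the space
  of last blocks, which is at most \<open>i + 1\<close>. The losses add up to at most \<open>(l + 1)\<^sup>2 s\<^sup>n\<close>.
\<close>

lemma mean_not_generic_le:
  fixes n :: nat
  defines "s \<equiv> 1 / real CARD('a::{field,finite})"
  shows "mean (block_lists n (2 * l + 1) :: 'a mat list set) (\<lambda>Ms. of_bool (\<not> generic n Ms))
    \<le> (real l + 1)\<^sup>2 * s ^ n"
proof (induction l)
  note s = inverse_card_field[OF s_def[THEN meta_eq_to_obj_eq]]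
  {
    case 0
    have "generic n Ms" if "Ms \<in> block_lists n 1" for Ms :: "'a mat list"
      using that by (auto simp: block_lists_def length_Suc_conv)
    then have "mean (block_lists n 1 :: 'a mat list set) (\<lambda>Ms. of_bool (\<not> generic n Ms)) = 0"
      by (simp add: mean_def)
    then show ?case using s by simp
  next
    case (Suc l)
    let ?Mat = "carrier_mat n n :: 'a mat set" and ?L = "block_lists n (2 * l + 1) :: 'a mat list set"
    have "mean (block_lists n (2 * Suc l + 1) :: 'a mat list set) (\<lambda>Ms. of_bool (\<not> generic n Ms))
      = mean ?L (\<lambda>Ms. mean ?Mat (\<lambda>B. of_bool (\<not> (generic n Ms \<and> inj_on ((*\<^sub>v) B) (last_blocks n Ms)))))"
      by (simp add: mean_block_lists_Suc mean_const finite_carrier_mat carrier_mat_nonempty)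
    also have "\<dots> \<le> mean ?L (\<lambda>Ms. of_bool (\<not> generic n Ms) + real (card (last_blocks n Ms)) * s ^ n)"
    proof (rule mean_mono)
      fix Ms :: "'a mat list" assume Ms: "Ms \<in> ?L"
      have sub: "subspace_of n (last_blocks n Ms)"
        using Ms by (intro subspace_of_last_blocks) (simp add: block_lists_def)
      have "mean ?Mat (\<lambda>B. of_bool (\<not> (generic n Ms \<and> inj_on ((*\<^sub>v) B) (last_blocks n Ms))))
         \<le> mean ?Mat (\<lambda>B. of_bool (\<not> generic n Ms) + of_bool (\<not> inj_on ((*\<^sub>v) B) (last_blocks n Ms)))"
        by (rule mean_mono) auto
      also have "\<dots> = of_bool (\<not> generic n Ms) + mean ?Mat (\<lambda>B. of_bool (\<not> inj_on ((*\<^sub>v) B) (last_blocks n Ms)))"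
        unfolding mean_add by (simp add: mean_const finite_carrier_mat carrier_mat_nonempty)
      also have "\<dots> \<le> of_bool (\<not> generic n Ms) + real (card (last_blocks n Ms)) * s ^ n"
        using mean_not_inj_on_le[OF sub, of n] by (simp add: s_def power_divide)
      finally show "mean ?Mat (\<lambda>B. of_bool (\<not> (generic n Ms \<and> inj_on ((*\<^sub>v) B) (last_blocks n Ms))))
        \<le> of_bool (\<not> generic n Ms) + real (card (last_blocks n Ms)) * s ^ n" .
    qed
    also have "\<dots> = mean ?L (\<lambda>Ms. of_bool (\<not> generic n Ms)) + mean ?L (\<lambda>Ms. real (card (last_blocks n Ms))) * s ^ n"
      by (simp only: mean_add mean_mult_right)
    also have "\<dots> \<le> (real l + 1)\<^sup>2 * s ^ n + (real l + 2) * s ^ n"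
      using s by (intro add_mono Suc.IH mult_right_mono mean_card_last_blocks_le) auto
    also have "\<dots> \<le> (real (Suc l) + 1)\<^sup>2 * s ^ n"
    proof -
      have "(real l + 1)\<^sup>2 + (real l + 2) \<le> (real (Suc l) + 1)\<^sup>2"
        by (simp add: power2_eq_square algebra_simps)
      then have "((real l + 1)\<^sup>2 + (real l + 2)) * s ^ n \<le> (real (Suc l) + 1)\<^sup>2 * s ^ n"
        using s by (intro mult_right_mono) auto
      then show ?thesis by (simp add: algebra_simps)
    qed
    finally show ?case .
  }
qed

section \<open>The kernel of the block bidiagonal corner\<close>

text \<open>
  A basis of the kernel exhibits it as a space of coefficient functions on the basis.
\<close>

lemma card_mat_kernel:
  fixes A :: "'a::{field,finite} mat"
  assumes A: "A \<in> carrier_mat nr nc"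
  shows "card (mat_kernel A) = CARD('a) ^ kernel_dim A"
proof -
  interpret kernel nr nc A by unfold_locales (rule A)
  have fin: "finite (mat_kernel A)"
    using mat_kernel_carrier[OF A] finite_carrier_vec by (rule finite_subset)
  have "Ker.fin_dim"
    unfolding Ker.fin_dim_def
  proof (intro exI conjI)
    show "span (mat_kernel A) = mat_kernel A"
      using Ker.in_own_span[of "mat_kernel A"] Ker.span_is_subset2[of "mat_kernel A"] by auto
  qed (use fin in auto)
  then obtain S where S: "finite S" "basis S" using Ker.finite_basis_exists by blast
  have SK: "S \<subseteq> mat_kernel A" using S(2) by (simp add: Ker.basis_def)
  have uniq: "\<exists>!a. a \<in> S \<rightarrow>\<^sub>E UNIV \<and> lincomb a S = v" if "v \<in> mat_kernel A" for v
    using Ker.basis_criterion[OF S(1)] SK S(2) that by auto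
  have "bij_betw (\<lambda>a. lincomb a S) (S \<rightarrow>\<^sub>E (UNIV :: 'a set)) (mat_kernel A)"
  proof (rule bij_betw_imageI)
    have cl: "lincomb a S \<in> mat_kernel A" for a
      by (rule Ker.lincomb_closed[OF SK]) auto
    show "inj_on (\<lambda>a. lincomb a S) (S \<rightarrow>\<^sub>E (UNIV :: 'a set))"
      using uniq cl by (metis (no_types, lifting) inj_onI)
    show "(\<lambda>a. lincomb a S) ` (S \<rightarrow>\<^sub>E (UNIV :: 'a set)) = mat_kernel A"
      using uniq cl by (auto simp: image_iff) metis
  qed
  from bij_betw_same_card[OF this] have "card (mat_kernel A) = CARD('a) ^ card S"
    using S(1) by (simp add: card_PiE)
  then show ?thesis using Ker.dim_basis[OF S] by simp
qed

definition vec_block :: "nat \<Rightarrow> 'a vec \<Rightarrow> nat \<Rightarrow> 'a vec" where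
  "vec_block n x i = vec n (\<lambda>a. x $ (i * n + a))"

text \<open>
  The equation of block row \<open>i + 1\<close> for a vector given by its blocks. Blocks of vectors are numbered from
  \<open>0\<close>, blocks of the matrix from \<open>1\<close>.
\<close>

definition row_equation :: "nat \<Rightarrow> (nat \<Rightarrow> nat \<Rightarrow> 'a::field mat) \<Rightarrow> (nat \<Rightarrow> 'a vec) \<Rightarrow> nat \<Rightarrow> bool" where
  "row_equation n A f i \<longleftrightarrow>
     A (i + 1) (i + 1) *\<^sub>v f i + (if i = 0 then 0\<^sub>v n else A (i + 1) i *\<^sub>v f (i - 1)) = 0\<^sub>v n"

definition block_kernel :: "nat \<Rightarrow> nat \<Rightarrow> (nat \<Rightarrow> nat \<Rightarrow> 'a::field mat) \<Rightarrow> (nat \<Rightarrow> 'a vec) set" where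
  "block_kernel n k A = {f \<in> {..<k} \<rightarrow>\<^sub>E carrier_vec n. \<forall>i<k. row_equation n A f i}"

definition bidiagonal :: "nat \<Rightarrow> (nat \<Rightarrow> nat \<Rightarrow> 'a::field mat) \<Rightarrow> bool" where
  "bidiagonal n A \<longleftrightarrow> (\<forall>i\<ge>1. \<forall>j\<ge>1. A i j \<in> carrier_mat n n \<and> (j \<noteq> i \<and> j + 1 \<noteq> i \<longrightarrow> A i j = 0\<^sub>m n n))"

text \<open>
  The sum over all columns is grouped by blocks, of which only two are nonzero. In block row \<open>0\<close> there is
  only one, and \<open>{i, i - 1}\<close> is a singleton by truncated subtraction.
\<close>

lemma corner_mult_vec_index:
  fixes A :: "nat \<Rightarrow> nat \<Rightarrow> 'w \<Rightarrow> 'a::field mat"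
  assumes A: "bidiagonal n (\<lambda>i j. A i j \<omega>)" and x: "x \<in> carrier_vec (k * n)"
    and i: "i < k" and a: "a < n"
  shows "(corner_matrix n k A \<omega> *\<^sub>v x) $ (i * n + a) =
    (A (i + 1) (i + 1) \<omega> *\<^sub>v vec_block n x i +
      (if i = 0 then 0\<^sub>v n else A (i + 1) i \<omega> *\<^sub>v vec_block n x (i - 1))) $ a"
proof -
  let ?C = "corner_matrix n k A \<omega>"
  define g where "g j = (A (i + 1) (j + 1) \<omega> *\<^sub>v vec_block n x j) $ a" for j
  have carr: "A (Suc i) (Suc j) \<omega> \<in> carrier_mat n n" for j
    using A by (simp add: bidiagonal_def)
  have "(i + 1) * n \<le> k * n" using i by (intro mult_le_mono1) simp
  then have r: "i * n + a < k * n" using a by simp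
  have "(?C *\<^sub>v x) $ (i * n + a) = (\<Sum>c<k * n. ?C $$ (i * n + a, c) * x $ c)"
    using r x by (simp add: corner_matrix_def scalar_prod_def lessThan_atLeast0)
  also have "\<dots> = (\<Sum>j<k. \<Sum>c\<in>{j * n..<j * n + n}. ?C $$ (i * n + a, c) * x $ c)"
    by (rule sum.nat_group[symmetric])
  also have "\<dots> = (\<Sum>j<k. g j)"
  proof (rule sum.cong[OF refl])
    fix j assume "j \<in> {..<k}"
    then have "(j + 1) * n \<le> k * n" by (intro mult_le_mono1) simp
    then have jr: "j * n + b < k * n" if "b < n" for b using that by simp
    have "(\<Sum>c\<in>{j * n..<j * n + n}. ?C $$ (i * n + a, c) * x $ c)
        = (\<Sum>b\<in>{0..<n}. ?C $$ (i * n + a, j * n + b) * x $ (j * n + b))"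
      by (rule sum.reindex_bij_witness[of _ "\<lambda>b. j * n + b" "\<lambda>c. c - j * n"]) auto
    also have "\<dots> = (\<Sum>b\<in>{0..<n}. A (i + 1) (j + 1) \<omega> $$ (a, b) * vec_block n x j $ b)"
      using r jr a by (intro sum.cong refl) (simp add: corner_matrix_def vec_block_def)
    also have "\<dots> = g j"
      using carr[of j] a by (simp add: g_def scalar_prod_def vec_block_def)
    finally show "(\<Sum>c\<in>{j * n..<j * n + n}. ?C $$ (i * n + a, c) * x $ c) = g j" .
  qed
  also have "\<dots> = (\<Sum>j\<in>{i, i - 1}. g j)"
  proof (rule sum.mono_neutral_right)
    show "\<forall>j\<in>{..<k} - {i, i - 1}. g j = 0"
    proof
      fix j assume "j \<in> {..<k} - {i, i - 1}"
      then have "A (i + 1) (j + 1) \<omega> = 0\<^sub>m n n" using A by (auto simp: bidiagonal_def)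
      then show "g j = 0" using a by (simp add: g_def vec_block_def)
    qed
  qed (use i in auto)
  also have "\<dots> = (A (i + 1) (i + 1) \<omega> *\<^sub>v vec_block n x i +
      (if i = 0 then 0\<^sub>v n else A (i + 1) i \<omega> *\<^sub>v vec_block n x (i - 1))) $ a"
    using carr[of "i - 1"] a by (cases i) (auto simp: g_def)
  finally show ?thesis .
qed

lemma mat_kernel_corner_iff:
  fixes A :: "nat \<Rightarrow> nat \<Rightarrow> 'w \<Rightarrow> 'a::field mat"
  assumes A: "bidiagonal n (\<lambda>i j. A i j \<omega>)"
  shows "x \<in> mat_kernel (corner_matrix n k A \<omega>) \<longleftrightarrow>
    x \<in> carrier_vec (k * n) \<and> (\<forall>i<k. row_equation n (\<lambda>i j. A i j \<omega>) (vec_block n x) i)"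
proof -
  let ?C = "corner_matrix n k A \<omega>"
  have C: "?C \<in> carrier_mat (k * n) (k * n)" by (simp add: corner_matrix_def)
  have "?C *\<^sub>v x = 0\<^sub>v (k * n) \<longleftrightarrow> (\<forall>i<k. row_equation n (\<lambda>i j. A i j \<omega>) (vec_block n x) i)"
    if x: "x \<in> carrier_vec (k * n)"
  proof -
    let ?R = "\<lambda>i. A (i + 1) (i + 1) \<omega> *\<^sub>v vec_block n x i +
      (if i = 0 then 0\<^sub>v n else A (i + 1) i \<omega> *\<^sub>v vec_block n x (i - 1))"
    have dim: "dim_vec (?R i) = n" for i
      using A by (cases i) (auto simp: bidiagonal_def)
    have idx: "i * n + a < k * n" if "i < k" "a < n" for i a
    proof -
      have "(i + 1) * n \<le> k * n" using that(1) by (intro mult_le_mono1) simp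
      then show ?thesis using that(2) by simp
    qed
    have "?C *\<^sub>v x = 0\<^sub>v (k * n) \<longleftrightarrow> (\<forall>r<k * n. (?C *\<^sub>v x) $ r = 0)"
    proof
      assume "?C *\<^sub>v x = 0\<^sub>v (k * n)"
      then show "\<forall>r<k * n. (?C *\<^sub>v x) $ r = 0" by (metis index_zero_vec(1))
    next
      assume "\<forall>r<k * n. (?C *\<^sub>v x) $ r = 0"
      then show "?C *\<^sub>v x = 0\<^sub>v (k * n)" using C by (intro eq_vecI) auto
    qed
    also have "\<dots> \<longleftrightarrow> (\<forall>i<k. \<forall>a<n. (?C *\<^sub>v x) $ (i * n + a) = 0)"
    proof (intro iffI allI impI)
      fix r assume H: "\<forall>i<k. \<forall>a<n. (?C *\<^sub>v x) $ (i * n + a) = 0" and r: "r < k * n"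
      then have "0 < n" by (cases n) auto
      then have "r div n < k" "r mod n < n" using r by (auto simp: less_mult_imp_div_less)
      then show "(?C *\<^sub>v x) $ r = 0" using H by (metis div_mult_mod_eq)
    qed (use idx in blast)
    also have "\<dots> \<longleftrightarrow> (\<forall>i<k. \<forall>a<n. ?R i $ a = 0)"
    proof -
      have "(?C *\<^sub>v x) $ (i * n + a) = ?R i $ a" if "i < k" "a < n" for i a
        by (rule corner_mult_vec_index[where A = A and \<omega> = \<omega>, OF A x that])
      then show ?thesis by metis
    qed
    also have "\<dots> \<longleftrightarrow> (\<forall>i<k. row_equation n (\<lambda>i j. A i j \<omega>) (vec_block n x) i)"
    proof -
      have "(\<forall>a<n. ?R i $ a = 0) \<longleftrightarrow> ?R i = 0\<^sub>v n" for i
        using dim[of i] by (metis eq_vecI index_zero_vec)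
      then show ?thesis by (simp only: row_equation_def)
    qed
    finally show ?thesis .
  qed
  then show ?thesis using mat_kernel[OF C] by auto
qed

lemma card_mat_kernel_corner:
  fixes A :: "nat \<Rightarrow> nat \<Rightarrow> 'w \<Rightarrow> 'a::field mat"
  assumes A: "bidiagonal n (\<lambda>i j. A i j \<omega>)"
  shows "card (mat_kernel (corner_matrix n k A \<omega>)) = card (block_kernel n k (\<lambda>i j. A i j \<omega>))"
proof (rule bij_betw_same_card)
  let ?A = "\<lambda>i j. A i j \<omega>"
  have row_cong: "row_equation n ?A f i \<longleftrightarrow> row_equation n ?A g i"
    if "i < k" "\<And>i. i < k \<Longrightarrow> f i = g i" for f g i
    using that by (auto simp: row_equation_def)
  define glue where "glue f = vec (k * n) (\<lambda>c. f (c div n) $ (c mod n))" for f :: "nat \<Rightarrow> 'a vec"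
  have idx: "i * n + a < k * n" if "i < k" "a < n" for i a
  proof -
    have "(i + 1) * n \<le> k * n" using that(1) by (intro mult_le_mono1) simp
    then show ?thesis using that(2) by simp
  qed
  have block_glue: "vec_block n (glue f) i = f i" if "i < k" "f i \<in> carrier_vec n" for f i
    using that idx by (intro eq_vecI) (auto simp: vec_block_def glue_def)
  have glue_block: "glue (restrict (vec_block n x) {..<k}) = x" if "x \<in> carrier_vec (k * n)" for x
  proof (rule eq_vecI)
    fix c assume "c < dim_vec x"
    then have c: "c < k * n" using that by simp
    then have "0 < n" by (cases n) auto
    then have "c div n < k" "c mod n < n" using c by (auto simp: less_mult_imp_div_less)
    then show "glue (restrict (vec_block n x) {..<k}) $ c = x $ c"
      using c by (simp add: glue_def vec_block_def)
  qed (use that in \<open>simp add: glue_def\<close>)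
  show "bij_betw (\<lambda>x. restrict (vec_block n x) {..<k})
      (mat_kernel (corner_matrix n k A \<omega>)) (block_kernel n k ?A)"
  proof (rule bij_betwI[where g = glue])
    show "(\<lambda>x. restrict (vec_block n x) {..<k}) \<in> mat_kernel (corner_matrix n k A \<omega>) \<rightarrow> block_kernel n k ?A"
    proof
      fix x assume "x \<in> mat_kernel (corner_matrix n k A \<omega>)"
      then have "row_equation n ?A (vec_block n x) i" if "i < k" for i
        using that by (simp add: mat_kernel_corner_iff[where A = A and \<omega> = \<omega>, OF A])
      then have "row_equation n ?A (restrict (vec_block n x) {..<k}) i" if "i < k" for i
        using that row_cong[of i "vec_block n x" "restrict (vec_block n x) {..<k}"] by simp
      then show "restrict (vec_block n x) {..<k} \<in> block_kernel n k ?A"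
        by (auto simp: block_kernel_def vec_block_def)
    qed
    show "glue \<in> block_kernel n k ?A \<rightarrow> mat_kernel (corner_matrix n k A \<omega>)"
    proof
      fix f assume f: "f \<in> block_kernel n k ?A"
      have "vec_block n (glue f) i = f i" if "i < k" for i
        using f that by (intro block_glue) (auto simp: block_kernel_def PiE_iff)
      then have "row_equation n ?A (vec_block n (glue f)) i" if "i < k" for i
        using f that row_cong[of i "vec_block n (glue f)" f] by (simp add: block_kernel_def)
      then show "glue f \<in> mat_kernel (corner_matrix n k A \<omega>)"
        by (simp add: mat_kernel_corner_iff[where A = A and \<omega> = \<omega>, OF A]) (simp add: glue_def)
    qed
    show "glue (restrict (vec_block n x) {..<k}) = x" if "x \<in> mat_kernel (corner_matrix n k A \<omega>)" for x
      using that by (intro glue_block) (simp add: mat_kernel_corner_iff[where A = A and \<omega> = \<omega>, OF A])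
    show "restrict (vec_block n (glue f)) {..<k} = f" if "f \<in> block_kernel n k ?A" for f
    proof
      fix i
      show "restrict (vec_block n (glue f)) {..<k} i = f i"
        using that block_glue[of i f] by (auto simp: block_kernel_def PiE_iff extensional_def restrict_def)
    qed
  qed
qed

text \<open>
  The positions of the blocks in the first \<open>l + 1\<close> block rows, in the order required by
  \<open>last_blocks\<close>.
\<close>

fun block_path :: "nat \<Rightarrow> (nat \<times> nat) list" where
  "block_path 0 = [(1, 1)]"
| "block_path (Suc l) = (l + 2, l + 2) # (l + 2, l + 1) # block_path l"

lemma add_eq_zero_vec_iff:
  fixes u v :: "'a::field vec"
  assumes "u \<in> carrier_vec n" "v \<in> carrier_vec n"
  shows "u + v = 0\<^sub>v n \<longleftrightarrow> u = (-1) \<cdot>\<^sub>v v"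
proof
  assume eq: "u + v = 0\<^sub>v n"
  have "u $ i + v $ i = 0" if "i < n" for i
    using arg_cong[OF eq, of "\<lambda>x. x $ i"] assms that by simp
  then show "u = (-1) \<cdot>\<^sub>v v" using assms by (intro eq_vecI) (auto simp: eq_neg_iff_add_eq_0)
next
  assume "u = (-1) \<cdot>\<^sub>v v"
  then show "u + v = 0\<^sub>v n" using assms by (intro eq_vecI) auto
qed

text \<open>
  In a generic configuration a kernel vector can be recovered from its last block \<open>y\<close>: the last row
  equation determines \<open>B x\<close> for the previous block \<open>x\<close>, injectivity of \<open>B\<close> determines \<open>x\<close>, and
  the argument continues upwards.
\<close>

lemma bij_betw_last_block:
  fixes A :: "nat \<Rightarrow> nat \<Rightarrow> 'a::field mat"
  assumes A: "bidiagonal n A" and gen: "generic n (map (\<lambda>(i, j). A i j) (block_path l))"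
  shows "bij_betw (\<lambda>f. f l) (block_kernel n (Suc l) A) (last_blocks n (map (\<lambda>(i, j). A i j) (block_path l)))"
  using gen
proof (induction l)
  case 0
  have D: "A 1 1 \<in> carrier_mat n n" using A by (simp add: bidiagonal_def)
  have row: "row_equation n A f 0 \<longleftrightarrow> A 1 1 *\<^sub>v f 0 = 0\<^sub>v n" for f
  proof -
    have "A 1 1 *\<^sub>v f 0 + 0\<^sub>v n = A 1 1 *\<^sub>v f 0" using D by (intro right_zero_vec carrier_vecI) simp
    then show ?thesis by (simp add: row_equation_def)
  qed
  show ?case
  proof (rule bij_betwI[where g = "\<lambda>y. restrict (\<lambda>_. y) {..<Suc 0}"])
    show "(\<lambda>f. f 0) \<in> block_kernel n (Suc 0) A \<rightarrow> last_blocks n (map (\<lambda>(i, j). A i j) (block_path 0))"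
      using D by (auto simp: block_kernel_def row preimage_space_def PiE_iff)
    show "(\<lambda>y. restrict (\<lambda>_. y) {..<Suc 0}) \<in> last_blocks n (map (\<lambda>(i, j). A i j) (block_path 0)) \<rightarrow> block_kernel n (Suc 0) A"
      using D by (auto simp: block_kernel_def row preimage_space_def)
    show "restrict (\<lambda>_. f 0) {..<Suc 0} = f" if "f \<in> block_kernel n (Suc 0) A" for f
      using that by (auto simp: block_kernel_def fun_eq_iff PiE_iff extensional_def)
  qed auto
next
  case (Suc l)
  let ?D = "A (l + 2) (l + 2)" and ?B = "A (l + 2) (l + 1)"
  define W where "W = last_blocks n (map (\<lambda>(i, j). A i j) (block_path l))"
  have D: "?D \<in> carrier_mat n n" and B: "?B \<in> carrier_mat n n" using A by (auto simp: bidiagonal_def)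
  have gen: "generic n (map (\<lambda>(i, j). A i j) (block_path l))" and inj: "inj_on ((*\<^sub>v) ?B) W"
    using Suc.prems by (auto simp: W_def)
  note IH = Suc.IH[OF gen, folded W_def]
  have path: "set (block_path l) \<subseteq> {(i, j). 1 \<le> i \<and> 1 \<le> j}" for l
    by (induction l) auto
  have W: "subspace_of n W"
    unfolding W_def using A path[of l] by (intro subspace_of_last_blocks) (auto simp: bidiagonal_def)
  have W': "W \<subseteq> carrier_vec n" using W by (simp add: subspace_of_def)
  have target: "last_blocks n (map (\<lambda>(i, j). A i j) (block_path (Suc l))) = preimage_space ?D ((*\<^sub>v) ?B ` W)"
    by (simp add: W_def)
  have row_cong: "row_equation n A f i \<longleftrightarrow> row_equation n A g i"
    if "i < Suc l" "\<And>i. i < Suc l \<Longrightarrow> f i = g i" for f g i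
    using that by (auto simp: row_equation_def)
  have neg: "(-1) \<cdot>\<^sub>v (?B *\<^sub>v w) = ?B *\<^sub>v ((-1) \<cdot>\<^sub>v w)" if "w \<in> W" for w
    using mult_mat_vec[OF B, of w "-1"] that W' by auto
  have neg_neg: "(-1) \<cdot>\<^sub>v ((-1) \<cdot>\<^sub>v w) = w" for w :: "'a vec" by (intro eq_vecI) auto
  have negW: "(-1) \<cdot>\<^sub>v w \<in> W" if "w \<in> W" for w using W that by (simp add: subspace_of_def)
  have kernel_Suc: "f \<in> block_kernel n (Suc (Suc l)) A \<longleftrightarrow>
      f \<in> {..<Suc (Suc l)} \<rightarrow>\<^sub>E carrier_vec n \<and> restrict f {..<Suc l} \<in> block_kernel n (Suc l) A \<and>
      ?D *\<^sub>v f (Suc l) = (-1) \<cdot>\<^sub>v (?B *\<^sub>v f l)" for f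
  proof (cases "f \<in> {..<Suc (Suc l)} \<rightarrow>\<^sub>E carrier_vec n")
    case True
    have "row_equation n A f (Suc l) \<longleftrightarrow> ?D *\<^sub>v f (Suc l) = (-1) \<cdot>\<^sub>v (?B *\<^sub>v f l)"
      using add_eq_zero_vec_iff[of "?D *\<^sub>v f (Suc l)" n "?B *\<^sub>v f l"] D B
      by (simp add: row_equation_def carrier_vecI)
    moreover have "(\<forall>i<Suc l. row_equation n A f i) \<longleftrightarrow> (\<forall>i<Suc l. row_equation n A (restrict f {..<Suc l}) i)"
      using row_cong[of _ f "restrict f {..<Suc l}"] by simp
    moreover have "restrict f {..<Suc l} \<in> {..<Suc l} \<rightarrow>\<^sub>E carrier_vec n"
      using True by (auto simp: PiE_iff)
    ultimately show ?thesis
      using True unfolding block_kernel_def by (auto simp: less_Suc_eq)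
  qed (simp add: block_kernel_def)
  have last_in: "f l \<in> W" if "f \<in> block_kernel n (Suc (Suc l)) A" for f
    using bij_betw_apply[OF IH, of "restrict f {..<Suc l}"] that by (simp add: kernel_Suc)
  show ?case
    unfolding target
  proof (rule bij_betw_imageI)
    show "inj_on (\<lambda>f. f (Suc l)) (block_kernel n (Suc (Suc l)) A)"
    proof (rule inj_onI)
      fix f g assume f: "f \<in> block_kernel n (Suc (Suc l)) A" and g: "g \<in> block_kernel n (Suc (Suc l)) A"
        and eq: "f (Suc l) = g (Suc l)"
      have "(-1) \<cdot>\<^sub>v ((-1) \<cdot>\<^sub>v (?B *\<^sub>v f l)) = (-1) \<cdot>\<^sub>v ((-1) \<cdot>\<^sub>v (?B *\<^sub>v g l))"
        using f g eq by (simp add: kernel_Suc)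
      then have "f l = g l"
        unfolding neg_neg using inj last_in[OF f] last_in[OF g] by (auto dest: inj_onD)
      then have "restrict f {..<Suc l} l = restrict g {..<Suc l} l" by simp
      then have restr: "restrict f {..<Suc l} = restrict g {..<Suc l}"
        by (rule inj_onD[OF bij_betw_imp_inj_on[OF IH]]) (use f g in \<open>simp_all only: kernel_Suc\<close>)
      have "f i = g i" if "i < Suc (Suc l)" for i
      proof (cases "i = Suc l")
        case False
        then have "i \<in> {..<Suc l}" using that by auto
        then show ?thesis using fun_cong[OF restr, of i] by simp
      qed (use eq in simp)
      moreover have "f i = g i" if "\<not> i < Suc (Suc l)" for i
        using f g that by (auto simp: kernel_Suc PiE_iff extensional_def)
      ultimately show "f = g" by blast
    qed
    show "(\<lambda>f. f (Suc l)) ` block_kernel n (Suc (Suc l)) A = preimage_space ?D ((*\<^sub>v) ?B ` W)"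
    proof (intro equalityI subsetI)
      fix y assume "y \<in> (\<lambda>f. f (Suc l)) ` block_kernel n (Suc (Suc l)) A"
      then obtain f where f: "f \<in> block_kernel n (Suc (Suc l)) A" "y = f (Suc l)" by blast
      then have "?D *\<^sub>v y = ?B *\<^sub>v ((-1) \<cdot>\<^sub>v f l)" using neg[OF last_in[OF f(1)]] by (simp add: kernel_Suc)
      then have "?D *\<^sub>v y \<in> (*\<^sub>v) ?B ` W" using negW[OF last_in[OF f(1)]] by blast
      moreover have "y \<in> carrier_vec n" using f by (auto simp: kernel_Suc PiE_iff)
      ultimately show "y \<in> preimage_space ?D ((*\<^sub>v) ?B ` W)" using D by (simp add: preimage_space_def)
    next
      fix y assume "y \<in> preimage_space ?D ((*\<^sub>v) ?B ` W)"
      then obtain w where y: "y \<in> carrier_vec n" and w: "w \<in> W" "?D *\<^sub>v y = ?B *\<^sub>v w"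
        using D by (auto simp: preimage_space_def)
      have "(-1) \<cdot>\<^sub>v w \<in> (\<lambda>f. f l) ` block_kernel n (Suc l) A"
        unfolding bij_betw_imp_surj_on[OF IH] by (rule negW[OF w(1)])
      then obtain f where f: "f \<in> block_kernel n (Suc l) A" "f l = (-1) \<cdot>\<^sub>v w" by force
      let ?g = "f(Suc l := y)"
      have fP: "f \<in> {..<Suc l} \<rightarrow>\<^sub>E carrier_vec n" using f(1) by (simp add: block_kernel_def)
      have "restrict ?g {..<Suc l} = f"
        using fP by (auto simp: fun_eq_iff PiE_iff extensional_def)
      moreover have "?g \<in> {..<Suc (Suc l)} \<rightarrow>\<^sub>E carrier_vec n"
        using fP y by (auto simp: PiE_iff extensional_def less_Suc_eq)
      moreover have "?D *\<^sub>v ?g (Suc l) = (-1) \<cdot>\<^sub>v (?B *\<^sub>v ?g l)"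
        using w f(2) neg[OF negW[OF w(1)]] by (simp add: neg_neg)
      ultimately have "?g \<in> block_kernel n (Suc (Suc l)) A" using f(1) by (simp add: kernel_Suc)
      then show "y \<in> (\<lambda>f. f (Suc l)) ` block_kernel n (Suc (Suc l)) A"
        by (rule image_eqI[rotated]) simp
    qed
  qed
qed

lemma card_kernel_corner_generic:
  fixes A :: "nat \<Rightarrow> nat \<Rightarrow> 'w \<Rightarrow> 'a::{field,finite} mat"
  assumes "bidiagonal n (\<lambda>i j. A i j \<omega>)" "generic n (map (\<lambda>(i, j). A i j \<omega>) (block_path l))"
  shows "CARD('a) ^ kernel_dim (corner_matrix n (Suc l) A \<omega>) =
    card (last_blocks n (map (\<lambda>(i, j). A i j \<omega>) (block_path l)))"
proof -
  have "corner_matrix n (Suc l) A \<omega> \<in> carrier_mat (Suc l * n) (Suc l * n)"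
    by (simp add: corner_matrix_def)
  from card_mat_kernel[OF this] show ?thesis
    using card_mat_kernel_corner[of n A \<omega> "Suc l"] bij_betw_same_card[OF bij_betw_last_block] assms by metis
qed

section \<open>Passage to the probability space\<close>

text \<open>
  All value lists are equally likely, so the probability of an event that depends on finitely many of the
  variables is a proportion of value lists.
\<close>

lemma (in prob_space) uniform_indep_vars_map:
  assumes indep: "indep_vars (\<lambda>_. count_space Z) X I" and Z: "finite Z"
    and unif: "\<And>p. p \<in> I \<Longrightarrow> distr M (count_space Z) (X p) = uniform_count_measure Z"
    and ps: "distinct ps" "set ps \<subseteq> I" "ps \<noteq> []"
  shows "{\<omega> \<in> space M. P (map (\<lambda>p. X p \<omega>) ps)} \<in> events" (is ?meas)
    and "prob {\<omega> \<in> space M. P (map (\<lambda>p. X p \<omega>) ps)} =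
      mean {zs. set zs \<subseteq> Z \<and> length zs = length ps} (\<lambda>zs. of_bool (P zs))" (is ?prob)
proof -
  let ?L = "{zs. set zs \<subseteq> Z \<and> length zs = length ps}"
  define E where "E zs = {\<omega> \<in> space M. map (\<lambda>p. X p \<omega>) ps = zs}" for zs
  have rv: "X p \<in> measurable M (count_space Z)" if "p \<in> set ps" for p
    using indep that ps by (auto simp: indep_vars_def2)
  have XZ: "X p \<omega> \<in> Z" if "p \<in> set ps" "\<omega> \<in> space M" for p \<omega>
    using measurable_space[OF rv[OF that(1)] that(2)] by simp
  have E: "E zs \<in> events" "prob (E zs) = (1 / real (card Z)) ^ length ps" if zs: "zs \<in> ?L" for zs
  proof -
    define z where "z p = the (map_of (zip ps zs) p)" for p
    have zs_eq: "map z ps = zs"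
    proof (rule nth_equalityI)
      fix i assume "i < length (map z ps)"
      then show "map z ps ! i = zs ! i"
        using zs ps(1) by (simp add: z_def map_of_zip_nth)
    qed (use zs in simp)
    then have zZ: "z p \<in> Z" if "p \<in> set ps" for p
      using zs that by (auto simp flip: zs_eq)
    have E_eq: "E zs = (\<Inter>p\<in>set ps. X p -` {z p} \<inter> space M)"
      using ps(3) by (auto simp: E_def zs_eq[symmetric])
    show "E zs \<in> events"
      unfolding E_eq using rv zZ ps(3)
      by (intro sets.finite_INT measurable_sets[of _ M "count_space Z"]) auto
    have "prob (E zs) = (\<Prod>p\<in>set ps. prob (X p -` {z p} \<inter> space M))"
      unfolding E_eq using ps zZ by (intro indep_varsD[OF indep]) auto
    also have "\<dots> = (\<Prod>p\<in>set ps. 1 / real (card Z))"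
    proof (rule prod.cong[OF refl])
      fix p assume p: "p \<in> set ps"
      have "prob (X p -` {z p} \<inter> space M) = measure (distr M (count_space Z) (X p)) {z p}"
        using zZ[OF p] by (intro measure_distr[symmetric] rv[OF p]) auto
      also have "\<dots> = 1 / real (card Z)"
        using p ps zZ[OF p] Z by (simp add: unif subset_iff measure_uniform_count_measure)
      finally show "prob (X p -` {z p} \<inter> space M) = 1 / real (card Z)" .
    qed
    finally show "prob (E zs) = (1 / real (card Z)) ^ length ps"
      by (simp add: distinct_card[OF ps(1)])
  qed
  have finL: "finite ?L" using finite_lists_length_eq[OF Z] by simp
  have cardL: "card ?L = card Z ^ length ps" using card_lists_length_eq[OF Z] by simp
  have eq: "{\<omega> \<in> space M. P (map (\<lambda>p. X p \<omega>) ps)} = (\<Union>zs\<in>{zs \<in> ?L. P zs}. E zs)"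
    using XZ by (auto simp: E_def)
  have fin: "finite {zs \<in> ?L. P zs}" by (rule finite_subset[OF _ finL]) auto
  show ?meas unfolding eq by (intro sets.finite_UN fin E(1)) simp
  have "prob (\<Union>zs\<in>{zs \<in> ?L. P zs}. E zs) = (\<Sum>zs\<in>{zs \<in> ?L. P zs}. prob (E zs))"
    by (intro finite_measure_finite_Union fin image_subsetI E(1))
       (auto simp: disjoint_family_on_def E_def)
  also have "\<dots> = real (card {zs \<in> ?L. P zs}) * (1 / real (card Z)) ^ length ps"
    using E(2) by (simp add: sum.cong)
  also have "\<dots> = mean ?L (\<lambda>zs. of_bool (P zs))"
    unfolding mean_of_bool[OF finL] cardL by (simp add: power_divide)
  finally show ?prob unfolding eq .
qed

lemma set_block_path: "set (block_path l) = {(i, j) \<in> band_positions. i \<le> Suc l}"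
proof (induction l)
  case (Suc l)
  have "{(i, j) \<in> band_positions. i \<le> Suc (Suc l)} =
      {(l + 2, l + 2), (l + 2, l + 1)} \<union> {(i, j) \<in> band_positions. i \<le> Suc l}"
    by (auto simp: band_positions_def le_Suc_eq)
  then show ?case using Suc by auto
qed (auto simp: band_positions_def)

lemma distinct_block_path: "distinct (block_path l)" and length_block_path: "length (block_path l) = 2 * l + 1"
  by (induction l) (auto simp: set_block_path)

lemma corner_matrix_cong:
  assumes "\<And>i j. 1 \<le> i \<Longrightarrow> 1 \<le> j \<Longrightarrow> i \<le> k \<Longrightarrow> A i j \<omega> = A i j \<omega>'"
  shows "corner_matrix n k A \<omega> = corner_matrix n k A \<omega>'"
proof (rule eq_matI)
  fix a b assume "a < dim_row (corner_matrix n k A \<omega>')" "b < dim_col (corner_matrix n k A \<omega>')"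
  then have ab: "a < k * n" "b < k * n" by (auto simp: corner_matrix_def)
  then have "a div n + 1 \<le> k" by (metis Suc_eq_plus1 Suc_leI less_mult_imp_div_less)
  then show "corner_matrix n k A \<omega> $$ (a, b) = corner_matrix n k A \<omega>' $$ (a, b)"
    using ab assms[of "a div n + 1" "b div n + 1"] by (simp add: corner_matrix_def)
qed (auto simp: corner_matrix_def)

text \<open>
  On generic configurations the kernel dimension is the dimension of the space of last blocks, which gives
  the lower bound directly; the upper bound adds the probability of the other configurations. The constants
  come from Bernoulli's inequality.
\<close>

theorem kernel_dim_prob_bounds:
  fixes A :: "nat \<Rightarrow> nat \<Rightarrow> 'w \<Rightarrow> 'a::{field,finite} mat"
  defines "s \<equiv> 1 / real CARD('a)"
  assumes unif: "uniform_block_bidiagonal n M A" and k: "0 < k" and j: "j \<le> n"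
  defines "p \<equiv> measure M {\<omega> \<in> space M. kernel_dim (corner_matrix n k A \<omega>) = j}"
  shows "limit_chain s k j * (1 - 2 * (real k * s ^ (n - j))) \<le> p"
    and "p \<le> limit_chain s k j + 2 * ((real k)\<^sup>2 * s ^ n)"
proof -
  note s = inverse_card_field[OF s_def[THEN meta_eq_to_obj_eq]]
  define Z where "Z = (carrier_mat n n :: 'a mat set)"
  obtain l where kl: "k = Suc l" using k by (cases k) auto
  interpret prob_space M using unif by (simp add: uniform_block_bidiagonal_def)
  let ?X = "\<lambda>(i, j). A i j"
  have Z: "finite Z" unfolding Z_def by (rule finite_carrier_mat)
  have indep: "indep_vars (\<lambda>_. count_space Z) ?X band_positions"
    and distr: "\<And>p. p \<in> band_positions \<Longrightarrow> distr M (count_space Z) (?X p) = uniform_count_measure Z"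
    and off_band: "\<And>i j \<omega>. 1 \<le> i \<Longrightarrow> 1 \<le> j \<Longrightarrow> (i, j) \<notin> band_positions \<Longrightarrow> \<omega> \<in> space M \<Longrightarrow> A i j \<omega> = 0\<^sub>m n n"
    using unif by (auto simp: uniform_block_bidiagonal_def Z_def)
  define Ms where "Ms \<omega> = map (\<lambda>p. ?X p \<omega>) (block_path l)" for \<omega>
  have Ms_alt: "Ms \<omega> = map (\<lambda>(i, j). A i j \<omega>) (block_path l)" for \<omega>
    unfolding Ms_def by (rule map_cong) auto
  have path: "set (block_path l) \<subseteq> band_positions" "block_path l \<noteq> []"
    using length_block_path[of l] by (auto simp: set_block_path)
  note uniform = uniform_indep_vars_map[OF indep Z distr distinct_block_path path, folded Ms_def]
  have L: "{zs. set zs \<subseteq> Z \<and> length zs = length (block_path l)} = block_lists n (2 * l + 1)"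
    by (simp add: block_lists_def Z_def length_block_path)
  have bid: "bidiagonal n (\<lambda>i j. A i j \<omega>)" if \<omega>: "\<omega> \<in> space M" for \<omega>
  proof -
    have "A i j \<omega> \<in> carrier_mat n n" if "(i, j) \<in> band_positions" for i j
    proof -
      have "?X (i, j) \<in> measurable M (count_space Z)"
        using indep that by (auto simp: indep_vars_def2)
      from measurable_space[OF this \<omega>] show ?thesis by (simp add: Z_def)
    qed
    then show ?thesis
      unfolding bidiagonal_def using off_band[OF _ _ _ \<omega>]
      by (metis (mono_tags, lifting) band_positions_def case_prod_conv mem_Collect_eq zero_carrier_mat)
  qed
  define G where "G = {\<omega> \<in> space M. generic n (Ms \<omega>) \<and> card (last_blocks n (Ms \<omega>)) = CARD('a) ^ j}"
  define N where "N = {\<omega> \<in> space M. \<not> generic n (Ms \<omega>)}"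
  define E where "E = {\<omega> \<in> space M. kernel_dim (corner_matrix n k A \<omega>) = j}"
  have G: "G \<in> events" "prob G = generic_dim_prob TYPE('a) n l j"
    unfolding G_def generic_dim_prob_def
    using uniform[of "\<lambda>zs. generic n zs \<and> card (last_blocks n zs) = CARD('a) ^ j"] by (auto simp: L)
  have N: "N \<in> events" "prob N \<le> (real l + 1)\<^sup>2 * s ^ n"
    unfolding N_def s_def using uniform[of "\<lambda>zs. \<not> generic n zs"] mean_not_generic_le[of n l, where 'a = 'a]
    by (auto simp: L)
  \<comment> \<open>the corner is a function of the blocks along the path\<close>
  have corner_eq: "corner_matrix n k A \<omega> = corner_matrix n k A \<omega>'"
    if "\<omega> \<in> space M" "\<omega>' \<in> space M" "Ms \<omega> = Ms \<omega>'" for \<omega> \<omega>'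
  proof (rule corner_matrix_cong)
    fix i j :: nat assume ij: "1 \<le> i" "1 \<le> j" "i \<le> k"
    show "A i j \<omega> = A i j \<omega>'"
    proof (cases "(i, j) \<in> band_positions")
      case True
      then have "(i, j) \<in> set (block_path l)" using ij by (simp add: set_block_path kl)
      then show ?thesis using that(3) by (auto simp: Ms_def)
    qed (use off_band ij that in auto)
  qed
  have "E = {\<omega> \<in> space M. \<exists>\<omega>'\<in>space M. Ms \<omega>' = Ms \<omega> \<and> kernel_dim (corner_matrix n k A \<omega>') = j}"
  proof (intro equalityI subsetI)
    fix \<omega> assume "\<omega> \<in> {\<omega> \<in> space M. \<exists>\<omega>'\<in>space M. Ms \<omega>' = Ms \<omega> \<and> kernel_dim (corner_matrix n k A \<omega>') = j}"
    then obtain \<omega>' where "\<omega> \<in> space M" "\<omega>' \<in> space M" "Ms \<omega>' = Ms \<omega>"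
      "kernel_dim (corner_matrix n k A \<omega>') = j" by blast
    then show "\<omega> \<in> E" using corner_eq[of \<omega>' \<omega>] by (simp add: E_def)
  qed (auto simp: E_def)
  also have "\<dots> \<in> events"
    by (rule uniform(1)[of "\<lambda>zs. \<exists>\<omega>'\<in>space M. Ms \<omega>' = zs \<and> kernel_dim (corner_matrix n k A \<omega>') = j"])
  finally have E: "E \<in> events" .
  have key: "kernel_dim (corner_matrix n k A \<omega>) = j \<longleftrightarrow> card (last_blocks n (Ms \<omega>)) = CARD('a) ^ j"
    if "\<omega> \<in> space M" "generic n (Ms \<omega>)" for \<omega>
    using card_kernel_corner_generic[of n A \<omega> l] bid[OF that(1)] that(2) card_field_gt_1[where 'a = 'a]
    by (auto simp: Ms_alt kl)
  have GE: "G \<subseteq> E" and EGN: "E \<subseteq> G \<union> N" using key by (auto simp: G_def E_def N_def)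
  have p: "p = prob E" by (simp add: p_def E_def)
  have lower: "generic_dim_prob TYPE('a) n l j \<le> p"
    unfolding p G(2)[symmetric] by (rule finite_measure_mono[OF GE E])
  have upper: "p \<le> generic_dim_prob TYPE('a) n l j + (real k)\<^sup>2 * s ^ n"
  proof -
    have "prob E \<le> prob (G \<union> N)" using G N by (intro finite_measure_mono[OF EGN]) auto
    also have "\<dots> \<le> prob G + prob N" using G N by (intro measure_Un_le) auto
    finally show ?thesis using G N by (simp add: p kl add.commute)
  qed
  note nonneg = limit_chain_nonneg[OF s(1,3), of k j]
  have "1 - 2 * (real k * s ^ (n - j)) \<le> (1 - s ^ (n - j)) ^ (2 * k)"
    using Bernoulli_inequality[of "- (s ^ (n - j))" "2 * k"] s by (simp add: power_le_one)
  from mult_left_mono[OF this nonneg]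
  show "limit_chain s k j * (1 - 2 * (real k * s ^ (n - j))) \<le> p"
    using generic_dim_prob_ge[OF order_refl j, of l, where 'a = 'a] lower
    by (simp only: kl s_def)
  show "p \<le> limit_chain s k j + 2 * ((real k)\<^sup>2 * s ^ n)"
  proof -
    let ?g = "generic_dim_prob TYPE('a) n l j"
    have "1 - real k * s ^ n \<le> (1 - s ^ n) ^ k"
      using Bernoulli_inequality[of "- (s ^ n)" k] s by (simp add: power_le_one)
    then have "?g * (1 - real k * s ^ n) \<le> ?g * (1 - s ^ n) ^ k"
      by (intro mult_left_mono generic_dim_prob_nonneg)
    also have "\<dots> \<le> limit_chain s k j"
      unfolding s_def kl by (rule generic_dim_prob_le[OF j])
    finally have "?g \<le> limit_chain s k j + ?g * (real k * s ^ n)" by (simp add: algebra_simps)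
    also have "?g * (real k * s ^ n) \<le> 1 * ((real k)\<^sup>2 * s ^ n)"
      using s k by (intro mult_mono generic_dim_prob_le_1) (auto simp: power2_eq_square)
    finally show ?thesis using upper by simp
  qed
qed

section \<open>The limit theorems\<close>

lemma eventually_even_sequentially:
  "eventually P even_sequentially \<longleftrightarrow> eventually (\<lambda>n. even n \<longrightarrow> P n) sequentially"
  by (simp add: even_sequentially_def eventually_inf_principal)

lemma even_sequentially_le: "even_sequentially \<le> sequentially"
  by (simp add: even_sequentially_def)

lemma filterlim_even_subsequence:
  assumes "strict_mono ns" "\<And>i. even (ns i :: nat)"
  shows "filterlim ns even_sequentially sequentially"
  using filterlim_subseq[OF assms(1)] assms(2)
  by (simp add: even_sequentially_def filterlim_inf filterlim_principal)

theorem kernel_dim_prob_tendsto_fixed: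
  fixes A :: "nat \<Rightarrow> nat \<Rightarrow> nat \<Rightarrow> 'w \<Rightarrow> 'a::{field,finite} mat"
  defines "s \<equiv> 1 / real CARD('a)"
  assumes unif: "\<And>n. even n \<Longrightarrow> n > 0 \<Longrightarrow> uniform_block_bidiagonal n (M n) (A n)"
    and K: "0 < K"
  shows "((\<lambda>n. measure (M n) {\<omega> \<in> space (M n). kernel_dim (corner_matrix n K (A n) \<omega>) = j})
      \<longlongrightarrow> limit_chain s K j) even_sequentially"
proof -
  note s = inverse_card_field[OF s_def[THEN meta_eq_to_obj_eq]]
  have pow: "(\<lambda>n. s ^ n) \<longlonglongrightarrow> 0" using s by (intro LIMSEQ_power_zero) auto
  have "filterlim (\<lambda>n. n - j) at_top sequentially" by real_asymp
  then have pow_j: "(\<lambda>n. s ^ (n - j)) \<longlonglongrightarrow> 0" by (rule filterlim_compose[OF pow])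
  have large: "eventually (\<lambda>n. even n \<and> 0 < n \<and> j \<le> n) even_sequentially"
    unfolding eventually_even_sequentially
    using eventually_ge_at_top[of "Suc j"] by eventually_elim auto
  have "(\<lambda>n. limit_chain s K j * (1 - 2 * (real K * s ^ (n - j)))) \<longlonglongrightarrow> limit_chain s K j * (1 - 2 * (real K * 0))"
    by (intro tendsto_intros pow_j)
  then have lo: "((\<lambda>n. limit_chain s K j * (1 - 2 * (real K * s ^ (n - j)))) \<longlongrightarrow> limit_chain s K j) even_sequentially"
    by (intro tendsto_mono[OF even_sequentially_le]) simp
  have "(\<lambda>n. limit_chain s K j + 2 * ((real K)\<^sup>2 * s ^ n)) \<longlonglongrightarrow> limit_chain s K j + 2 * ((real K)\<^sup>2 * 0)"
    by (intro tendsto_intros pow)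
  then have up: "((\<lambda>n. limit_chain s K j + 2 * ((real K)\<^sup>2 * s ^ n)) \<longlongrightarrow> limit_chain s K j) even_sequentially"
    by (intro tendsto_mono[OF even_sequentially_le]) simp
  show ?thesis
  proof (rule tendsto_sandwich[OF _ _ lo up])
    show "eventually (\<lambda>n. limit_chain s K j * (1 - 2 * (real K * s ^ (n - j)))
      \<le> measure (M n) {\<omega> \<in> space (M n). kernel_dim (corner_matrix n K (A n) \<omega>) = j}) even_sequentially"
      using large by eventually_elim (auto simp: s_def intro!: kernel_dim_prob_bounds(1) unif K)
    show "eventually (\<lambda>n. measure (M n) {\<omega> \<in> space (M n). kernel_dim (corner_matrix n K (A n) \<omega>) = j}
      \<le> limit_chain s K j + 2 * ((real K)\<^sup>2 * s ^ n)) even_sequentially"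
      using large by eventually_elim (auto simp: s_def intro!: kernel_dim_prob_bounds(2) unif K)
  qed
qed

text \<open>
  With \<open>L = log\<^sub>q k\<close> this identifies the centring of the limit theorem: once \<open>frac (- L)\<close> is near its
  limit \<open>\<zeta>\<close>, the integer closest to \<open>L + \<zeta>\<close> is the least integer not below \<open>L\<close>.
\<close>

lemma round_eq_add_frac_minus:
  fixes L \<zeta> :: real
  assumes "\<bar>frac (- L) - \<zeta>\<bar> < 1 / 2"
  shows "real_of_int (round (L + \<zeta>)) = L + frac (- L)"
proof -
  have "L + frac (- L) = real_of_int (- \<lfloor>- L\<rfloor>)" by (simp add: frac_def)
  moreover have "round (L + \<zeta>) = - \<lfloor>- L\<rfloor>"
  proof (rule round_unique')
    show "\<bar>L + \<zeta> - real_of_int (- \<lfloor>- L\<rfloor>)\<bar> < 1 / 2"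
      using assms unfolding frac_def of_int_minus by linarith
  qed
  ultimately show ?thesis by simp
qed

text \<open>
  If \<open>J\<close> denotes the dimension in question, then \<open>k s\<^sup>J\<close> equals \<open>q\<^bsup>- f - j\<^esup>\<close> with
  \<open>f = frac (- log\<^sub>q k)\<close>. It converges, which is what the limit of the chain requires, and stays away from
  \<open>0\<close>, so that \<open>k s\<^bsup>n-J\<^esup>\<close> vanishes together with \<open>k\<^sup>2 s\<^sup>n\<close>.
\<close>

theorem kernel_dim_prob_tendsto_growing:
  fixes M :: "nat \<Rightarrow> 'w measure" and A :: "nat \<Rightarrow> nat \<Rightarrow> nat \<Rightarrow> 'w \<Rightarrow> 'a::{field,finite} mat"
    and k ns :: "nat \<Rightarrow> nat"
  defines "q \<equiv> real CARD('a)"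
  assumes unif: "\<And>i. uniform_block_bidiagonal (ns i) (M i) (A i)"
    and k_pos: "\<And>i. 0 < k i"
    and k_lim: "filterlim k at_top sequentially"
    and k_small: "(\<lambda>i. q powr (- real (ns i) / 2) * real (k i)) \<longlonglongrightarrow> 0"
    and frac_lim: "(\<lambda>i. frac (- log q (real (k i)))) \<longlonglongrightarrow> \<zeta>"
  shows "(\<lambda>i. measure (M i) {\<omega> \<in> space (M i).
      int (kernel_dim (corner_matrix (ns i) (k i) (A i) \<omega>)) - round (log q (real (k i)) + \<zeta>) = j})
    \<longlonglongrightarrow> van_peski_mass (1 / q) (q powr (- \<zeta>) / (q - 1)) j"
proof -
  define s where "s = 1 / real CARD('a)"
  note s = inverse_card_field[OF s_def]
  have q: "1 < q" using card_field_gt_1[where 'a = 'a] by (simp add: q_def)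
  have sq: "s = 1 / q" by (simp add: s_def q_def)
  have s_powr: "s ^ m = q powr (- real m)" for m
    using q by (simp add: sq powr_minus_divide powr_realpow power_divide)
  define f where "f i = frac (- log q (real (k i)))" for i
  define R where "R i = round (log q (real (k i)) + \<zeta>)" for i
  define J where "J i = nat (R i + j)" for i
  have f: "0 \<le> f i" "f i < 1" for i by (auto simp: f_def frac_lt_1)
  have k_real: "filterlim (\<lambda>i. real (k i)) at_top sequentially"
    by (rule filterlim_compose[OF filterlim_real_sequentially k_lim])
  have "eventually (\<lambda>i. dist (f i) \<zeta> < 1 / 2) sequentially"
    using frac_lim unfolding f_def by (rule tendstoD) simp
  then have R: "eventually (\<lambda>i. real_of_int (R i) = log q (real (k i)) + f i) sequentially"
    by eventually_elim (simp add: R_def f_def dist_real_def round_eq_add_frac_minus)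
  have log_lim: "filterlim (\<lambda>i. log q (real (k i))) at_top sequentially"
    using q by (intro filterlim_compose[OF _ k_real]) real_asymp
  have J_eq: "eventually (\<lambda>i. int (J i) = R i + j \<and> real (J i) = log q (real (k i)) + f i + real_of_int j) sequentially"
    using R log_lim[unfolded filterlim_at_top, rule_format, of "- real_of_int j"]
  proof eventually_elim
    case (elim i)
    then have "0 \<le> real_of_int (R i + j)" using f[of i] by simp
    then have "0 \<le> R i + j" by (simp only: of_int_0_le_iff)
    then show ?case using elim by (simp add: J_def)
  qed
  have J_lim: "filterlim J at_top sequentially"
    unfolding filterlim_at_top
  proof
    fix Z :: nat
    show "eventually (\<lambda>i. Z \<le> J i) sequentially"
      using J_eq log_lim[unfolded filterlim_at_top, rule_format, of "real Z - real_of_int j"]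
    proof eventually_elim
      case (elim i)
      then have "real Z \<le> real (J i)" using f[of i] by simp
      then show ?case by simp
    qed
  qed
  have kJ: "eventually (\<lambda>i. real (k i) * s ^ J i = q powr (- f i - real_of_int j)) sequentially"
    using J_eq
  proof eventually_elim
    case (elim i)
    have "real (k i) * s ^ J i = q powr (log q (real (k i))) * q powr (- (log q (real (k i)) + f i + real_of_int j))"
      using q k_pos[of i] elim by (simp add: s_powr)
    also have "\<dots> = q powr (- f i - real_of_int j)"
      by (simp flip: powr_add)
    finally show ?case .
  qed
  have f_lim: "(\<lambda>i. q powr (- f i - real_of_int j)) \<longlonglongrightarrow> q powr (- \<zeta> - real_of_int j)"
    using frac_lim q unfolding f_def by (intro tendsto_intros) auto
  have kJ_lim: "(\<lambda>i. real (k i) * s ^ J i) \<longlonglongrightarrow> q powr (- \<zeta> - real_of_int j)"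
    by (rule Lim_transform_eventually[OF f_lim]) (use kJ in eventually_elim, simp)
  have "(\<lambda>i. real (k i) * s ^ J i * (s / (1 - s))) \<longlonglongrightarrow> q powr (- \<zeta> - real_of_int j) * (s / (1 - s))"
    by (rule tendsto_mult_right[OF kJ_lim])
  also have "q powr (- \<zeta> - real_of_int j) * (s / (1 - s)) = q powr (- \<zeta>) / (q - 1) * s powi j"
    using q by (simp add: sq powr_diff powr_real_of_int' power_int_divide_distrib field_simps)
  finally have chain_lim: "(\<lambda>i. limit_chain s (k i) (J i)) \<longlonglongrightarrow> van_peski_mass s (q powr (- \<zeta>) / (q - 1)) j"
    using s by (intro limit_chain_tendsto_van_peski J_lim) auto

  \<comment> \<open>the errors: the square of the smallness hypothesis is \<open>k\<^sup>2 s\<^sup>n \<rightarrow> 0\<close>\<close>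
  have "(\<lambda>i. (q powr (- real (ns i) / 2) * real (k i))\<^sup>2) \<longlonglongrightarrow> 0\<^sup>2"
    by (intro tendsto_intros k_small)
  moreover have "(q powr (- real (ns i) / 2) * real (k i))\<^sup>2 = (real (k i))\<^sup>2 * s ^ ns i" for i
    by (simp add: power_mult_distrib s_powr power2_eq_square flip: powr_add)
  ultimately have k2_lim: "(\<lambda>i. (real (k i))\<^sup>2 * s ^ ns i) \<longlonglongrightarrow> 0"
    by (simp only: zero_power2)
  have kq: "(real (k i))\<^sup>2 * s ^ ns i * (1 / (real (k i) * s ^ J i)) = real (k i) * (s ^ ns i / s ^ J i)" for i
    using s k_pos[of i] by (simp add: power2_eq_square)
  have "(\<lambda>i. (real (k i))\<^sup>2 * s ^ ns i * (1 / (real (k i) * s ^ J i))) \<longlonglongrightarrow> 0 * (1 / q powr (- \<zeta> - real_of_int j))"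
    using q by (intro tendsto_intros k2_lim kJ_lim) auto
  then have ratio_lim: "(\<lambda>i. real (k i) * (s ^ ns i / s ^ J i)) \<longlonglongrightarrow> 0"
    unfolding kq mult_zero_left .
  have J_le: "eventually (\<lambda>i. J i \<le> ns i) sequentially"
    using order_tendstoD(2)[OF ratio_lim, of 1, simplified]
  proof eventually_elim
    case (elim i)
    show ?case
    proof (rule ccontr)
      assume "\<not> J i \<le> ns i"
      then have "s ^ J i \<le> s ^ ns i" using s by (intro power_decreasing) auto
      then have "1 \<le> s ^ ns i / s ^ J i" using s by simp
      then have "1 * 1 \<le> real (k i) * (s ^ ns i / s ^ J i)" using k_pos[of i] by (intro mult_mono) auto
      then show False using elim by simp
    qed
  qed
  have err_lim: "(\<lambda>i. real (k i) * s ^ (ns i - J i)) \<longlonglongrightarrow> 0"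
  proof (rule Lim_transform_eventually[OF ratio_lim])
    show "eventually (\<lambda>i. real (k i) * (s ^ ns i / s ^ J i) = real (k i) * s ^ (ns i - J i)) sequentially"
      using J_le by eventually_elim (use s in \<open>simp add: power_diff\<close>)
  qed
  let ?chain = "\<lambda>i. limit_chain s (k i) (J i)"
  let ?v = "van_peski_mass s (q powr (- \<zeta>) / (q - 1)) j"
  have "(\<lambda>i. ?chain i * (1 - 2 * (real (k i) * s ^ (ns i - J i)))) \<longlonglongrightarrow> ?v * (1 - 2 * 0)"
    by (intro tendsto_intros chain_lim err_lim)
  then have lo: "(\<lambda>i. ?chain i * (1 - 2 * (real (k i) * s ^ (ns i - J i)))) \<longlonglongrightarrow> ?v" by simp
  have "(\<lambda>i. ?chain i + 2 * ((real (k i))\<^sup>2 * s ^ ns i)) \<longlonglongrightarrow> ?v + 2 * 0"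
    by (intro tendsto_intros chain_lim k2_lim)
  then have up: "(\<lambda>i. ?chain i + 2 * ((real (k i))\<^sup>2 * s ^ ns i)) \<longlonglongrightarrow> ?v" by simp
  let ?p = "\<lambda>i. measure (M i) {\<omega> \<in> space (M i). kernel_dim (corner_matrix (ns i) (k i) (A i) \<omega>) = J i}"
  have "?p \<longlonglongrightarrow> ?v"
  proof (rule tendsto_sandwich[OF _ _ lo up])
    show "eventually (\<lambda>i. ?chain i * (1 - 2 * (real (k i) * s ^ (ns i - J i))) \<le> ?p i) sequentially"
      using J_le by eventually_elim (auto simp: s_def intro!: kernel_dim_prob_bounds(1) unif k_pos)
    show "eventually (\<lambda>i. ?p i \<le> ?chain i + 2 * ((real (k i))\<^sup>2 * s ^ ns i)) sequentially"
      using J_le by eventually_elim (auto simp: s_def intro!: kernel_dim_prob_bounds(2) unif k_pos)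
  qed
  then show ?thesis
    unfolding sq[symmetric]
  proof (rule Lim_transform_eventually)
    show "eventually (\<lambda>i. ?p i = measure (M i) {\<omega> \<in> space (M i).
      int (kernel_dim (corner_matrix (ns i) (k i) (A i) \<omega>)) - round (log q (real (k i)) + \<zeta>) = j}) sequentially"
      using J_eq
    proof eventually_elim
      case (elim i)
      have "d = J i \<longleftrightarrow> int d - round (log q (real (k i)) + \<zeta>) = j" for d
        using elim unfolding R_def by linarith
      then show ?case by simp
    qed
  qed
qed

theorem theorem7:
  fixes q :: nat
    and M :: "nat \<Rightarrow> 'w measure"
    and A :: "nat \<Rightarrow> nat \<Rightarrow> nat \<Rightarrow> 'w \<Rightarrow> 'a::{field,finite} mat"
    and k :: "nat \<Rightarrow> nat"
  assumes "prime q" and "CARD('a) = q"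
    and "\<And>n. even n \<Longrightarrow> n > 0 \<Longrightarrow> uniform_block_bidiagonal n (M n) (A n)"
    and "\<And>n. even n \<Longrightarrow> n > 0 \<Longrightarrow> k n > 0"
  shows
    "(\<forall>K. (\<forall>n. even n \<and> n > 0 \<longrightarrow> k n = K) \<longrightarrow>
        (\<forall>j::nat.
          ((\<lambda>n. measure (M n) {\<omega> \<in> space (M n). kernel_dim (corner_matrix n (k n) (A n) \<omega>) = j})
            \<longlongrightarrow> (\<Sum>r | r \<in> {1..K} \<rightarrow>\<^sub>E (UNIV :: nat set) \<and> (\<Sum>i=1..K. r i) = j.
                   qpoch_inf (1 / real q) (1 / real q) ^ K *
                   (\<Prod>i=1..K. (1 / real q) ^ (r i * (\<Sum>l=1..i. r l)) /
                     (qpoch (1 / real q) (1 / real q) (r i) *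
                      qpoch (1 / real q) (1 / real q) (\<Sum>l=1..i. r l)))))
          even_sequentially))
     \<and>
     (filterlim k at_top even_sequentially \<longrightarrow>
      ((\<lambda>n. real q powr (- real n / 2) / (real q - 1) * real (k n)) \<longlongrightarrow> 0) even_sequentially \<longrightarrow>
        (\<forall>(ns :: nat \<Rightarrow> nat) (\<zeta>::real).
          strict_mono ns \<longrightarrow> (\<forall>i. even (ns i) \<and> ns i > 0) \<longrightarrow>
          (\<lambda>i. frac (- log (real q) (real (k (ns i))))) \<longlonglongrightarrow> \<zeta> \<longrightarrow>
          (\<forall>j::int.
            (\<lambda>i. measure (M (ns i)) {\<omega> \<in> space (M (ns i)).
                   int (kernel_dim (corner_matrix (ns i) (k (ns i)) (A (ns i)) \<omega>))
                     - round (log (real q) (real (k (ns i))) + \<zeta>) = j})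
            \<longlonglongrightarrow> van_peski_mass (1 / real q) (real q powr (- \<zeta>) / (real q - 1)) j)))"
proof (intro conjI allI impI)
  fix K j :: nat
  assume K: "\<forall>n. even n \<and> n > 0 \<longrightarrow> k n = K"
  have "0 < K" using K assms(4)[of 2] by auto
  from kernel_dim_prob_tendsto_fixed[of M A, OF assms(3) this, of j]
  have "((\<lambda>n. measure (M n) {\<omega> \<in> space (M n). kernel_dim (corner_matrix n K (A n) \<omega>) = j})
      \<longlongrightarrow> limit_chain (1 / real q) K j) even_sequentially"
    by (simp add: assms(2))
  moreover have "eventually (\<lambda>n. k n = K) even_sequentially"
    unfolding eventually_even_sequentially
    using eventually_gt_at_top[of 0] by eventually_elim (use K in auto)
  ultimately show "((\<lambda>n. measure (M n) {\<omega> \<in> space (M n). kernel_dim (corner_matrix n (k n) (A n) \<omega>) = j})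
            \<longlongrightarrow> (\<Sum>r | r \<in> {1..K} \<rightarrow>\<^sub>E (UNIV :: nat set) \<and> (\<Sum>i=1..K. r i) = j.
                   qpoch_inf (1 / real q) (1 / real q) ^ K *
                   (\<Prod>i=1..K. (1 / real q) ^ (r i * (\<Sum>l=1..i. r l)) /
                     (qpoch (1 / real q) (1 / real q) (r i) *
                      qpoch (1 / real q) (1 / real q) (\<Sum>l=1..i. r l)))))
          even_sequentially"
    unfolding limit_chain_eq_sum_over_increments
    by (elim Lim_transform_eventually) (auto elim: eventually_mono)
next
  fix ns :: "nat \<Rightarrow> nat" and \<zeta> :: real and j :: int
  assume k: "filterlim k at_top even_sequentially"
    and small: "((\<lambda>n. real q powr (- real n / 2) / (real q - 1) * real (k n)) \<longlongrightarrow> 0) even_sequentially"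
    and ns: "strict_mono ns" "\<forall>i. even (ns i) \<and> ns i > 0"
    and frac: "(\<lambda>i. frac (- log (real q) (real (k (ns i))))) \<longlonglongrightarrow> \<zeta>"
  have q: "1 < q" using assms(1) by (rule prime_gt_1_nat)
  have lim: "filterlim ns even_sequentially sequentially"
    using ns by (intro filterlim_even_subsequence) auto
  have "(\<lambda>i. real q powr (- real (ns i) / 2) / (real q - 1) * real (k (ns i)) * (real q - 1)) \<longlonglongrightarrow> 0 * (real q - 1)"
    by (intro tendsto_mult_right filterlim_compose[OF small lim])
  then have small': "(\<lambda>i. real q powr (- real (ns i) / 2) * real (k (ns i))) \<longlonglongrightarrow> 0"
    using q by simp
  show "(\<lambda>i. measure (M (ns i)) {\<omega> \<in> space (M (ns i)).
                   int (kernel_dim (corner_matrix (ns i) (k (ns i)) (A (ns i)) \<omega>))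
                     - round (log (real q) (real (k (ns i))) + \<zeta>) = j})
            \<longlonglongrightarrow> van_peski_mass (1 / real q) (real q powr (- \<zeta>) / (real q - 1)) j"
    using kernel_dim_prob_tendsto_growing[where ns = ns and M = "\<lambda>i. M (ns i)" and A = "\<lambda>i. A (ns i)"
        and k = "\<lambda>i. k (ns i)" and \<zeta> = \<zeta> and j = j]
      assms(3,4) ns(2) filterlim_compose[OF k lim] small' frac
    by (simp add: assms(2))
qed

end
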